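(* Let $\alpha\in(\frac14,\frac13]$ (so $N=\lfloor 1/\alpha\rfloor=3$), let $\mathbf X$ be an $\alpha$-Hölder planarly branched rough path over the alphabet $A=\{1,\dots,d\}$ above $X=(X^1,\dots,X^d):[0,T]\to\mathbb R^d$, let $f=(f_1,\dots,f_d)$ with each $f_i:\mathbb R^n\to\mathbb R^n$ smooth, and let $\mathbf Y$, above $Y:[0,T]\to\mathbb R^n$, be an $\mathbf X$-controlled planarly branched rough path solving the rough differential equation $d\mathbf Y_t=f(\mathbf Y_t)\cdot dX_t$, $Y_0=\xi$. Let $\hat{\mathbf X}$ be a bracket extension of $\mathbf X$, above $\hat X=(X^1,\dots,X^d,(\hat X^{(ij)})_{1\le i,j\le d})$, and let $F:\mathbb R^n\to\mathbb R^n$ be a smooth function. For $i,j,k=1,\dots,d$ define $\tilde X^{(ijk)},\overline X^{(ijk)}:[0,T]\to\mathbb R$ (with given initial values) by $$\tilde X^{(ijk)}_t-\tilde X^{(ijk)}_s:=\big\langle\hat{\mathbf X}_{s,t},\ \bullet_k\bullet_j\bullet_i-[\bullet_k\bullet_j]_i-[\bullet_k]_{(ij)}\big\rangle,$$ $$\overline X^{(ijk)}_t-\overline X^{(ijk)}_s:=\big\langle\hat{\mathbf X}_{s,t},\ \bullet_i[\bullet_k]_j+[\bullet_k]_j\bullet_i-[[\bullet_k]_j]_i-[\bullet_k]_{(ij)}-[\bullet_k]_{(ji)}\big\rangle,\qquad s,t\in[0,T].$$ Then for all $s,t\in[0,T]$, $$\begin{aligned}F(Y_t)-F(Y_s)=&\sum_{i=1}^d\int_s^t\Big(DF(Y_r):\big(f_i(Y_r)\big)\Big)dX^i_r+\sum_{i,j=1}^d\int_s^t\Big(D^2F(Y_r):\big(f_i(Y_r),f_j(Y_r)\big)\Big)d\hat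 X^{(ij)}_r\\&+\sum_{i,j,k=1}^d\int_s^t\Big(D^3F(Y_r):\big(f_i(Y_r),f_j(Y_r),f_k(Y_r)\big)\Big)d\tilde X^{(ijk)}_r\\&+\sum_{i,j,k=1}^d\int_s^t\Big(D^2F(Y_r):\big(f_i(Y_r),Df_j(Y_r):f_k(Y_r)\big)\Big)d\overline X^{(ijk)}_r .\end{aligned}$$ Here the integrals against $X^i$ and $\hat X^{(ij)}$ are rough integrals; with $G_i(u):=DF(u):(f_i(u))$ and $G_{ij}(u):=D^2F(u):(f_i(u),f_j(u))$, the integrands are lifted to the controlled paths $G_i(\mathbf Y)$ ($\mathbf X$-controlled) and $G_{ij}(\mathbf Y)$ (regarded as $\hat{\mathbf X}$-controlled). The integrals against $\tilde X^{(ijk)}$ and $\overline X^{(ijk)}$ are Young integrals.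
   Context: Forests. For a finite set $B$, $\mathcal F_B$ is the set of $B$-decorated planar rooted forests, i.e. finite ordered (possibly empty) sequences of planar rooted trees with vertices decorated by $B$; concatenation is written as juxtaposition, $\mathbf 1$ is the empty forest, $|\tau|$ is the number of vertices, and $\mathcal F_B^{\le m}=\{\tau\in\mathcal F_B: |\tau|\le m\}$. For $\tau\in\mathcal F_B$ and $b\in B$, $[\tau]_b$ is the tree obtained by joining the roots of the trees of $\tau$ (in the same left-to-right order) to a new root decorated by $b$; $\bullet_b=[\mathbf 1]_b$. Thus $[\bullet_j]_i$ is the ladder with root $i$ and leaf $j$, $[[\bullet_k]_j]_i$ is the ladder with root $i$, middle vertex $j$, leaf $k$, and $[\bullet_k\bullet_j]_i$ is the cherry with root $i$, left leaf $k$, right leaf $j$. Munthe-Kaas–Wright (MKW) Hopf algebra over $B$: the vector space $\mathbb R\mathcal F_B$ with the shuffle product ⧢ (forests viewed as words whose letters are trees) and the coproduct $\Delta$ given recursively by $\Delta(\mathbf 1)=\mathbf 1\otimes\mathbf 1$ and $\Delta(\omega[\tau]_b)=\omega[\tau]_b\otimes\mathbf 1+\Delta(\omega)\cdot(\mathrm{id}\otimes[\,\cdot\,]_b)\Delta(\tau)$ for $\omega,\tau\in\mathcal F_B$, where $\cdot$ shuffles left tensor factors and concatenates right tensor factors (left admissible cuts). E.g. $\Delta(\bullet_j\bullet_i)=\bullet_j\bullet_i\otimes\mathbf 1+\bullet_j\otimes\bullet_i+\mathbf 1\otimes\bullet_j\bullet_i$ and $\Delta([\bullet_j]_i)=[\bullet_j]_i\otimes\mathbf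 1+\bullet_j\otimes\bullet_i+\mathbf 1\otimes[\bullet_j]_i$. The pairing is $\langle\tau,\tau'\rangle=\delta_{\tau,\tau'}$ on forests and $\star$ is the dual product: $\langle x\star y,\tau\rangle=\langle x\otimes y,\Delta\tau\rangle$. Everything is truncated at $\mathbb R\mathcal F_B^{\le N}$. Planarly branched rough path. Let $\alpha\in(0,1]$, $N=\lfloor1/\alpha\rfloor$. An $\alpha$-Hölder planarly branched rough path over $B$ is a map $\mathbf X:[0,T]^2\to\mathbb R\mathcal F_B^{\le N}$ with $\langle\mathbf X_{s,t},\mathbf 1\rangle=1$ such that (1) $\mathbf X_{s,u}\star\mathbf X_{u,t}=\mathbf X_{s,t}$ in the algebra truncated at $N$; (2) $\langle\mathbf X_{s,t},\sigma ⧢ \tau\rangle=\langle\mathbf X_{s,t},\sigma\rangle\langle\mathbf X_{s,t},\tau\rangle$ whenever $|\sigma|+|\tau|\le N$; (3) $\sup_{s\ne t}|\langle\mathbf X_{s,t},\tau\rangle|/|t-s|^{|\tau|\alpha}<\infty$ for all $\tau\in\mathcal F_B^{\le N}$. It is above a path $(X^b)_{b\in B}$ if $\langle\mathbf X_{s,t},\bullet_b\rangle=X^b_t-X^b_s$ for all $b\in B$. Controlled path. A map $\mathbf Y:[0,T]\to(\mathbb R\mathcal F_B^{\le N-1})^n$ (so $\langle\tau,\mathbf Y_t\rangle\in\mathbb R^n$) is an $\mathbf X$-controlled planarly branched rough path above $Y=\langle\mathbf 1,\mathbf Y\rangle$ if $|\langle\tau,\mathbf Y_t\rangle-\langle\mathbf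 X_{s,t}\star\tau,\mathbf Y_s\rangle|=O(|t-s|^{(N-|\tau|)\alpha})$ for all $\tau\in\mathcal F_B^{\le N-1}$. Rough integral. For $\mathbf Y$ $\mathbf X$-controlled above $Y$ and $b\in B$, $\int_s^tY_r\,dX^b_r$ is the limit, as the mesh of partitions $\pi$ of $[s,t]$ tends to $0$, of $\sum_{[u,v]\in\pi}\sum_{\tau\in\mathcal F_B^{\le N-1}}\langle\tau,\mathbf Y_u\rangle\langle\mathbf X_{u,v},[\tau]_b\rangle$ (for $\alpha\in(\frac14,\frac12]$ this limit exists). Young integral. $\int_s^tG_r\,dH_r=\lim\sum_{[u,v]\in\pi}G_u(H_v-H_u)$ along partitions $\pi$ of $[s,t]$ with mesh tending to $0$. Derivatives. For smooth $G:\mathbb R^n\to\mathbb R^n$, $D^mG(u):(v_1,\dots,v_m)=\sum_{a_1,\dots,a_m=1}^n\partial_{a_1}\cdots\partial_{a_m}G(u)\,v_1^{a_1}\cdots v_m^{a_m}$. Composition. For $\mathbf Y$ $\mathbf X$-controlled above $Y$ and smooth $G:\mathbb R^n\to\mathbb R^n$, $G(\mathbf Y)$ is the $\mathbf X$-controlled path with $\langle\mathbf 1,G(\mathbf Y)_t\rangle=G(Y_t)$ and $\langle\tau,G(\mathbf Y)_t\rangle=\sum_{m=1}^{N-1}\sum_{\tau_1\cdots\tau_m=\tau}D^mG(Y_t):(\langle\tau_1,\mathbf Y_t\rangle,\dots,\langle\tau_m,\mathbf Y_t\rangle)$ for $\tau\in\mathcal F_A^{\le N-1}\setminus\{\mathbf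 1\}$, the inner sum over factorizations of $\tau$ into nonempty forests. Solution of the RDE. $\mathbf Y$, $\mathbf X$-controlled above $Y$, solves $d\mathbf Y=f(\mathbf Y)\cdot dX$, $Y_0=\xi$, if $Y_t=\xi+\sum_{i=1}^d\int_0^tf_i(Y_r)\,dX^i_r$ (rough integrals of the lifts $f_i(\mathbf Y)$), $\langle[\tau]_i,\mathbf Y_t\rangle=\langle\tau,f_i(\mathbf Y)_t\rangle$ for $i\in A$, $\tau\in\mathcal F_A^{\le N-2}$, and $\langle\tau,\mathbf Y_t\rangle=0$ for every nonempty $\tau\in\mathcal F_A^{\le N-1}$ that is not a tree. Bracket extension. Let $\hat A=A\cup\{(ij): i,j=1,\dots,d\}$. A bracket extension of $\mathbf X$ (over $A$) is an $\alpha$-Hölder planarly branched rough path $\hat{\mathbf X}$ over $\hat A$ such that $\langle\hat{\mathbf X}_{s,t},\tau\rangle=\langle\mathbf X_{s,t},\tau\rangle$ for all forests $\tau\in\mathcal F_A^{\le N}$ and $\langle\hat{\mathbf X}_{s,t},\bullet_{(ij)}\rangle=\langle\mathbf X_{s,t},\bullet_j\bullet_i-[\bullet_j]_i\rangle$ for $i,j=1,\dots,d$. Its underlying path is $\hat X=(X^1,\dots,X^d,(\hat X^{(ij)})_{i,j})$ with $\hat X^{(ij)}_t-\hat X^{(ij)}_s=\langle\mathbf X_{s,t},\bullet_j\bullet_i-[\bullet_j]_i\rangle$. An $\mathbf X$-controlled path is regarded as $\hat{\mathbf X}$-controlled by giving it zero coefficient on forests containing a letter $(ij)$.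
   Formalization: As printed the formula fails; here the element defining X̄^(ijk) also subtracts [•_i•_k]_j and [•_k•_i]_j, and the bracket extension is assumed to satisfy ⟨X̂_{s,t},[τ]_(ij)⟩ = O(|t−s|^{(|τ|+2)α}) for forests τ over A with |τ| ≤ 2. *)

theory Defs
  imports "HOL-Analysis.Analysis" "HOL-Library.Poly_Mapping"
begin

section \<open>Free real vector spaces\<close>

text \<open>The real vector space with basis \<open>'a\<close> is the type \<open>'a \<Rightarrow>\<^sub>0 real\<close> of finitely
  supported functions; \<open>'a \<times> 'c \<Rightarrow>\<^sub>0 real\<close> serves as the tensor product.\<close>

instantiation poly_mapping :: (type, real_vector) real_vector
begin

definition scaleR_poly_mapping :: "real \<Rightarrow> ('a \<Rightarrow>\<^sub>0 'b) \<Rightarrow> ('a \<Rightarrow>\<^sub>0 'b)" where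
  "scaleR_poly_mapping c x = Poly_Mapping.map (\<lambda>v. c *\<^sub>R v) x"

lemma lookup_scaleR [simp]: "Poly_Mapping.lookup (c *\<^sub>R x) a = c *\<^sub>R Poly_Mapping.lookup x a"
  for x :: "'a \<Rightarrow>\<^sub>0 'b"
  by (simp add: scaleR_poly_mapping_def Poly_Mapping.map.rep_eq when_def)

instance
  by standard (rule poly_mapping_eqI; simp add: lookup_add algebra_simps)+

end

definition basis :: "'a \<Rightarrow> 'a \<Rightarrow>\<^sub>0 real" where
  "basis a = Poly_Mapping.single a 1"

definition lin_ext :: "('a \<Rightarrow> 'v::real_vector) \<Rightarrow> ('a \<Rightarrow>\<^sub>0 real) \<Rightarrow> 'v" where
  "lin_ext g x = (\<Sum>a\<in>Poly_Mapping.keys x. Poly_Mapping.lookup x a *\<^sub>R g a)"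

definition bilin_ext ::
    "('a \<Rightarrow> 'c \<Rightarrow> 'v::real_vector) \<Rightarrow> ('a \<Rightarrow>\<^sub>0 real) \<Rightarrow> ('c \<Rightarrow>\<^sub>0 real) \<Rightarrow> 'v" where
  "bilin_ext g x y = lin_ext (\<lambda>a. lin_ext (g a) y) x"

definition tensor :: "('a \<Rightarrow>\<^sub>0 real) \<Rightarrow> ('c \<Rightarrow>\<^sub>0 real) \<Rightarrow> ('a \<times> 'c \<Rightarrow>\<^sub>0 real)" where
  "tensor = bilin_ext (\<lambda>a c. basis (a, c))"

definition pairing :: "('a \<Rightarrow>\<^sub>0 real) \<Rightarrow> ('a \<Rightarrow>\<^sub>0 real) \<Rightarrow> real" where
  "pairing = bilin_ext (\<lambda>a b. if a = b then 1 else 0)"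

definition vpairing :: "('a \<Rightarrow>\<^sub>0 real) \<Rightarrow> ('a \<Rightarrow>\<^sub>0 real)^'n \<Rightarrow> real^'n" where
  "vpairing x y = (\<chi> c. pairing x (y $ c))"


section \<open>Planar forests and the Munthe-Kaas--Wright Hopf algebra\<close>

datatype 'b ptree = Node 'b "'b ptree list"

type_synonym 'b forest = "'b ptree list"

fun tree_nodes :: "'b ptree \<Rightarrow> nat" where
  "tree_nodes (Node b \<tau>) = Suc (sum_list (map tree_nodes \<tau>))"

definition nodes :: "'b forest \<Rightarrow> nat" where
  "nodes \<tau> = sum_list (map tree_nodes \<tau>)"

definition forests_upto :: "nat \<Rightarrow> 'b forest set" where
  "forests_upto m = {\<tau>. nodes \<tau> \<le> m}"

abbreviation graft :: "'b \<Rightarrow> 'b forest \<Rightarrow> 'b forest" where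
  "graft b \<tau> \<equiv> [Node b \<tau>]"

abbreviation leaf :: "'b \<Rightarrow> 'b forest" where
  "leaf b \<equiv> graft b []"

fun shuffle_words :: "'a list \<Rightarrow> 'a list \<Rightarrow> ('a list \<Rightarrow>\<^sub>0 real)" where
  "shuffle_words [] v = basis v"
| "shuffle_words u [] = basis u"
| "shuffle_words (a # u) (b # v) =
     lin_ext (\<lambda>w. basis (a # w)) (shuffle_words u (b # v)) +
     lin_ext (\<lambda>w. basis (b # w)) (shuffle_words (a # u) v)"

definition shuffle ::
    "('b forest \<Rightarrow>\<^sub>0 real) \<Rightarrow> ('b forest \<Rightarrow>\<^sub>0 real) \<Rightarrow> ('b forest \<Rightarrow>\<^sub>0 real)" where
  "shuffle = bilin_ext shuffle_words"

text \<open>Shuffle the left tensor factors, concatenate the right ones.\<close>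
definition shuffle_concat ::
    "('b forest \<times> 'b forest \<Rightarrow>\<^sub>0 real) \<Rightarrow> ('b forest \<times> 'b forest \<Rightarrow>\<^sub>0 real) \<Rightarrow>
     ('b forest \<times> 'b forest \<Rightarrow>\<^sub>0 real)" where
  "shuffle_concat = bilin_ext (\<lambda>(\<sigma>1, \<tau>1) (\<sigma>2, \<tau>2).
     tensor (shuffle_words \<sigma>1 \<sigma>2) (basis (\<tau>1 @ \<tau>2)))"

function coprod :: "'b forest \<Rightarrow> ('b forest \<times> 'b forest \<Rightarrow>\<^sub>0 real)" where
  "coprod [] = basis ([], [])"
| "coprod (\<omega> @ [Node b \<tau>]) =
     basis (\<omega> @ [Node b \<tau>], []) +
     shuffle_concat (coprod \<omega>) (lin_ext (\<lambda>(\<sigma>, \<rho>). basis (\<sigma>, graft b \<rho>)) (coprod \<tau>))"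
proof -
  fix P :: bool and x :: "'b forest"
  assume nil: "x = [] \<Longrightarrow> P" and snoc: "\<And>\<omega> b \<tau>. x = \<omega> @ [Node b \<tau>] \<Longrightarrow> P"
  show P
  proof (cases x rule: rev_cases)
    case (snoc \<omega> t)
    then show P using \<open>\<And>\<omega> b \<tau>. x = \<omega> @ [Node b \<tau>] \<Longrightarrow> P\<close> by (cases t) simp
  qed (use nil in simp)
qed auto
termination
  by (relation "Wellfounded.measure nodes") (auto simp: nodes_def)

text \<open>The product dual to the coproduct, truncated at level \<open>N\<close>. Letters range over a finite type,
  so the sum is over a finite set.\<close>
definition star ::
    "nat \<Rightarrow> ('b::finite forest \<Rightarrow>\<^sub>0 real) \<Rightarrow> ('b forest \<Rightarrow>\<^sub>0 real) \<Rightarrow> ('b forest \<Rightarrow>\<^sub>0 real)" where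
  "star N x y = (\<Sum>\<tau>\<in>forests_upto N. pairing (tensor x y) (coprod \<tau>) *\<^sub>R basis \<tau>)"


section \<open>Rough paths and controlled paths\<close>

definition level :: "real \<Rightarrow> nat" where
  "level \<alpha> = nat \<lfloor>1 / \<alpha>\<rfloor>"

definition planarly_branched_rough_path ::
    "real \<Rightarrow> real \<Rightarrow> (real \<Rightarrow> real \<Rightarrow> 'b::finite forest \<Rightarrow>\<^sub>0 real) \<Rightarrow> bool" where
  "planarly_branched_rough_path \<alpha> T X \<longleftrightarrow>
     (\<forall>s\<in>{0..T}. \<forall>t\<in>{0..T}.
        Poly_Mapping.keys (X s t) \<subseteq> forests_upto (level \<alpha>) \<and>
        pairing (X s t) (basis []) = 1) \<and>
     (\<forall>s\<in>{0..T}. \<forall>u\<in>{0..T}. \<forall>t\<in>{0..T}. star (level \<alpha>) (X s u) (X u t) = X s t) \<and>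
     (\<forall>s\<in>{0..T}. \<forall>t\<in>{0..T}. \<forall>\<sigma> \<tau>. nodes \<sigma> + nodes \<tau> \<le> level \<alpha> \<longrightarrow>
        pairing (X s t) (shuffle (basis \<sigma>) (basis \<tau>)) =
        pairing (X s t) (basis \<sigma>) * pairing (X s t) (basis \<tau>)) \<and>
     (\<forall>\<tau>\<in>forests_upto (level \<alpha>). \<exists>C. \<forall>s\<in>{0..T}. \<forall>t\<in>{0..T}. s \<noteq> t \<longrightarrow>
        \<bar>pairing (X s t) (basis \<tau>)\<bar> / \<bar>t - s\<bar> powr (real (nodes \<tau>) * \<alpha>) \<le> C)"

definition lies_above ::
    "real \<Rightarrow> (real \<Rightarrow> real \<Rightarrow> 'b forest \<Rightarrow>\<^sub>0 real) \<Rightarrow> ('b \<Rightarrow> real \<Rightarrow> real) \<Rightarrow> bool" where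
  "lies_above T X x \<longleftrightarrow>
     (\<forall>b. \<forall>s\<in>{0..T}. \<forall>t\<in>{0..T}. pairing (X s t) (basis (leaf b)) = x b t - x b s)"

definition controlled_path ::
    "real \<Rightarrow> real \<Rightarrow> (real \<Rightarrow> real \<Rightarrow> 'b::finite forest \<Rightarrow>\<^sub>0 real) \<Rightarrow>
     (real \<Rightarrow> ('b forest \<Rightarrow>\<^sub>0 real)^'n) \<Rightarrow> bool" where
  "controlled_path \<alpha> T X Y \<longleftrightarrow>
     (\<forall>t\<in>{0..T}. \<forall>c. Poly_Mapping.keys (Y t $ c) \<subseteq> forests_upto (level \<alpha> - 1)) \<and>
     (\<forall>\<tau>\<in>forests_upto (level \<alpha> - 1). \<exists>C. \<forall>s\<in>{0..T}. \<forall>t\<in>{0..T}.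
        norm (vpairing (basis \<tau>) (Y t) - vpairing (star (level \<alpha>) (X s t) (basis \<tau>)) (Y s))
          \<le> C * \<bar>t - s\<bar> powr (real (level \<alpha> - nodes \<tau>) * \<alpha>))"


section \<open>Integrals as limits along partitions\<close>

definition is_partition :: "real \<Rightarrow> real \<Rightarrow> real list \<Rightarrow> bool" where
  "is_partition s t ps \<longleftrightarrow> ps \<noteq> [] \<and> hd ps = s \<and> last ps = t \<and> sorted_wrt (<) ps"

definition mesh :: "real list \<Rightarrow> real" where
  "mesh ps = Max (insert 0 {ps ! Suc i - ps ! i | i. Suc i < length ps})"

definition partition_filter :: "real \<Rightarrow> real \<Rightarrow> real list filter" where
  "partition_filter s t = (INF \<delta>\<in>{0<..}. principal {ps. is_partition s t ps \<and> mesh ps < \<delta>})"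

definition partition_sum :: "(real \<Rightarrow> real \<Rightarrow> 'v::real_normed_vector) \<Rightarrow> real list \<Rightarrow> 'v" where
  "partition_sum \<Xi> ps = (\<Sum>i<length ps - 1. \<Xi> (ps ! i) (ps ! Suc i))"

text \<open>For \<open>t < s\<close> the integral from \<open>s\<close> to \<open>t\<close> is minus the integral from \<open>t\<close> to \<open>s\<close>.\<close>
definition has_partition_integral ::
    "(real \<Rightarrow> real \<Rightarrow> 'v::real_normed_vector) \<Rightarrow> real \<Rightarrow> real \<Rightarrow> 'v \<Rightarrow> bool" where
  "has_partition_integral \<Xi> s t I \<longleftrightarrow>
     (if s \<le> t then (partition_sum \<Xi> \<longlongrightarrow> I) (partition_filter s t)
      else (partition_sum \<Xi> \<longlongrightarrow> - I) (partition_filter t s))"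

definition rough_germ ::
    "nat \<Rightarrow> (real \<Rightarrow> real \<Rightarrow> 'b::finite forest \<Rightarrow>\<^sub>0 real) \<Rightarrow>
     (real \<Rightarrow> ('b forest \<Rightarrow>\<^sub>0 real)^'n) \<Rightarrow> 'b \<Rightarrow> real \<Rightarrow> real \<Rightarrow> real^'n" where
  "rough_germ N X Y b u v =
     (\<Sum>\<tau>\<in>forests_upto (N - 1).
        pairing (X u v) (basis (graft b \<tau>)) *\<^sub>R vpairing (basis \<tau>) (Y u))"

definition rough_integrable ::
    "nat \<Rightarrow> (real \<Rightarrow> real \<Rightarrow> 'b::finite forest \<Rightarrow>\<^sub>0 real) \<Rightarrow>
     (real \<Rightarrow> ('b forest \<Rightarrow>\<^sub>0 real)^'n) \<Rightarrow> 'b \<Rightarrow> real \<Rightarrow> real \<Rightarrow> bool" where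
  "rough_integrable N X Y b s t \<longleftrightarrow> (\<exists>I. has_partition_integral (rough_germ N X Y b) s t I)"

definition rough_integral ::
    "nat \<Rightarrow> (real \<Rightarrow> real \<Rightarrow> 'b::finite forest \<Rightarrow>\<^sub>0 real) \<Rightarrow>
     (real \<Rightarrow> ('b forest \<Rightarrow>\<^sub>0 real)^'n) \<Rightarrow> 'b \<Rightarrow> real \<Rightarrow> real \<Rightarrow> real^'n" where
  "rough_integral N X Y b s t = (THE I. has_partition_integral (rough_germ N X Y b) s t I)"

definition young_germ ::
    "(real \<Rightarrow> 'v::real_normed_vector) \<Rightarrow> (real \<Rightarrow> real) \<Rightarrow> real \<Rightarrow> real \<Rightarrow> 'v" where
  "young_germ G H u v = (H v - H u) *\<^sub>R G u"

definition young_integrable ::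
    "(real \<Rightarrow> 'v::real_normed_vector) \<Rightarrow> (real \<Rightarrow> real) \<Rightarrow> real \<Rightarrow> real \<Rightarrow> bool" where
  "young_integrable G H s t \<longleftrightarrow> (\<exists>I. has_partition_integral (young_germ G H) s t I)"

definition young_integral ::
    "(real \<Rightarrow> 'v::real_normed_vector) \<Rightarrow> (real \<Rightarrow> real) \<Rightarrow> real \<Rightarrow> real \<Rightarrow> 'v" where
  "young_integral G H s t = (THE I. has_partition_integral (young_germ G H) s t I)"


section \<open>Higher derivatives and composition with smooth functions\<close>

definition partial_deriv :: "'n::finite \<Rightarrow> (real^'n \<Rightarrow> real^'m) \<Rightarrow> real^'n \<Rightarrow> real^'m::finite" where
  "partial_deriv a G u = frechet_derivative G (at u) (axis a 1)"

text \<open>All iterated partial derivatives exist; each is differentiable, hence continuous.\<close>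
definition smooth :: "(real^'n::finite \<Rightarrow> real^'m::finite) \<Rightarrow> bool" where
  "smooth G \<longleftrightarrow> (\<forall>as u. foldr partial_deriv as G differentiable (at u))"

text \<open>\<open>higher_deriv G u [v\<^sub>1, \<dots>, v\<^sub>m]\<close> is \<open>D\<^sup>mG(u) : (v\<^sub>1, \<dots>, v\<^sub>m)\<close>.\<close>
definition higher_deriv :: "(real^'n \<Rightarrow> real^'m) \<Rightarrow> real^'n \<Rightarrow> (real^'n) list \<Rightarrow> real^'m" where
  "higher_deriv G u vs = (\<Sum>as | length as = length vs.
     (\<Prod>i<length vs. vs ! i $ (as ! i)) *\<^sub>R foldr partial_deriv as G u)"

text \<open>\<open>lift_path M G y\<close> has coefficients up to level \<open>M\<close>; for a path controlled by a rough path of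
  level \<open>N\<close> one has \<open>M = N - 1\<close>.\<close>
definition lift_coeff ::
    "nat \<Rightarrow> (real^'n \<Rightarrow> real^'n) \<Rightarrow> ('b forest \<Rightarrow>\<^sub>0 real)^'n \<Rightarrow> 'b forest \<Rightarrow> real^'n" where
  "lift_coeff M G y \<tau> =
     (let y0 = vpairing (basis []) y in
      if \<tau> = [] then G y0
      else \<Sum>m=1..M. \<Sum>\<tau>s | length \<tau>s = m \<and> [] \<notin> set \<tau>s \<and> concat \<tau>s = \<tau>.
             higher_deriv G y0 (map (\<lambda>\<sigma>. vpairing (basis \<sigma>) y) \<tau>s))"

definition lift_path ::
    "nat \<Rightarrow> (real^'n \<Rightarrow> real^'n) \<Rightarrow> ('b::finite forest \<Rightarrow>\<^sub>0 real)^'n \<Rightarrow> ('b forest \<Rightarrow>\<^sub>0 real)^'n"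
  where
  "lift_path M G y = (\<chi> c. \<Sum>\<tau>\<in>forests_upto M. (lift_coeff M G y \<tau> $ c) *\<^sub>R basis \<tau>)"

definition solves_rde ::
    "real \<Rightarrow> real \<Rightarrow> (real \<Rightarrow> real \<Rightarrow> 'b::finite forest \<Rightarrow>\<^sub>0 real) \<Rightarrow>
     ('b \<Rightarrow> real^'n \<Rightarrow> real^'n) \<Rightarrow> real^'n \<Rightarrow> (real \<Rightarrow> ('b forest \<Rightarrow>\<^sub>0 real)^'n) \<Rightarrow> bool" where
  "solves_rde \<alpha> T X f \<xi> Y \<longleftrightarrow>
     controlled_path \<alpha> T X Y \<and>
     (\<forall>t\<in>{0..T}. vpairing (basis []) (Y t) =
        \<xi> + (\<Sum>i\<in>UNIV. rough_integral (level \<alpha>) X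
                        (\<lambda>r. lift_path (level \<alpha> - 1) (f i) (Y r)) i 0 t)) \<and>
     (\<forall>t\<in>{0..T}. \<forall>i \<tau>. nodes \<tau> + 2 \<le> level \<alpha> \<longrightarrow>
        vpairing (basis (graft i \<tau>)) (Y t) =
        vpairing (basis \<tau>) (lift_path (level \<alpha> - 1) (f i) (Y t))) \<and>
     (\<forall>t\<in>{0..T}. \<forall>\<tau>\<in>forests_upto (level \<alpha> - 1). \<tau> \<noteq> [] \<and> length \<tau> \<noteq> 1 \<longrightarrow>
        vpairing (basis \<tau>) (Y t) = 0)"


section \<open>Bracket extensions\<close>

text \<open>The alphabet enlarged by the letters \<open>(ij)\<close>.\<close>
type_synonym 'd bletter = "'d + 'd \<times> 'd"

abbreviation br :: "'d \<Rightarrow> 'd \<Rightarrow> 'd bletter" where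
  "br i j \<equiv> Inr (i, j)"

definition embed_forest :: "'d forest \<Rightarrow> 'd bletter forest" where
  "embed_forest = map (map_ptree Inl)"

text \<open>An element over the small alphabet, extended by zero on forests with a letter \<open>(ij)\<close>.\<close>
definition extend_path :: "('d forest \<Rightarrow>\<^sub>0 real)^'n \<Rightarrow> ('d bletter forest \<Rightarrow>\<^sub>0 real)^'n" where
  "extend_path y = (\<chi> c. lin_ext (\<lambda>\<tau>. basis (embed_forest \<tau>)) (y $ c))"

definition bracket_extension ::
    "real \<Rightarrow> real \<Rightarrow> (real \<Rightarrow> real \<Rightarrow> 'd::finite forest \<Rightarrow>\<^sub>0 real) \<Rightarrow>
     (real \<Rightarrow> real \<Rightarrow> 'd bletter forest \<Rightarrow>\<^sub>0 real) \<Rightarrow> bool" where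
  "bracket_extension \<alpha> T X X' \<longleftrightarrow>
     planarly_branched_rough_path \<alpha> T X' \<and>
     (\<forall>s\<in>{0..T}. \<forall>t\<in>{0..T}.
        (\<forall>\<tau>\<in>forests_upto (level \<alpha>).
           pairing (X' s t) (basis (embed_forest \<tau>)) = pairing (X s t) (basis \<tau>)) \<and>
        (\<forall>i j. pairing (X' s t) (basis (leaf (br i j))) =
               pairing (X s t) (basis (leaf j @ leaf i) - basis (graft i (leaf j)))))"

text \<open>As \<open>X^(ij)\<close> is \<open>2\<alpha>\<close>-Hoelder, the iterated integral \<open>[\<tau>]_(ij)\<close> has order
  \<open>(|\<tau>| + 2)\<alpha>\<close>, i.e. the letter \<open>(ij)\<close> counts twice. Counting vertices alone would give only
  \<open>(|\<tau>| + 1)\<alpha>\<close>, which leaves the integrals against \<open>tilde_elem\<close> and \<open>bar_elem\<close> below the Young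
  regime and lets \<open>[\<tau>]_(ij)\<close> with \<open>|\<tau>| = 2\<close> carry an arbitrary Lipschitz contribution.\<close>
definition bracket_homogeneous ::
    "real \<Rightarrow> real \<Rightarrow> (real \<Rightarrow> real \<Rightarrow> 'd::finite bletter forest \<Rightarrow>\<^sub>0 real) \<Rightarrow> bool" where
  "bracket_homogeneous \<alpha> T X' \<longleftrightarrow>
     (\<forall>i j. \<forall>\<tau>\<in>forests_upto (level \<alpha> - 1). \<exists>C. \<forall>s\<in>{0..T}. \<forall>t\<in>{0..T}. s \<noteq> t \<longrightarrow>
        \<bar>pairing (X' s t) (basis (graft (br i j) (embed_forest \<tau>)))\<bar>
          / \<bar>t - s\<bar> powr (real (nodes \<tau> + 2) * \<alpha>) \<le> C)"

definition tilde_elem :: "'d \<Rightarrow> 'd \<Rightarrow> 'd \<Rightarrow> ('d bletter forest \<Rightarrow>\<^sub>0 real)" where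
  "tilde_elem i j k =
     basis (embed_forest (leaf k @ leaf j @ leaf i))
     - basis (embed_forest (graft i (leaf k @ leaf j)))
     - basis (graft (br i j) (embed_forest (leaf k)))"

text \<open>The two cherries, the grafting of the shuffle of \<open>i\<close> and \<open>k\<close> onto \<open>j\<close>, are what makes the
  increments of \<open>bar_elem\<close> additive.\<close>
definition bar_elem :: "'d \<Rightarrow> 'd \<Rightarrow> 'd \<Rightarrow> ('d bletter forest \<Rightarrow>\<^sub>0 real)" where
  "bar_elem i j k =
     basis (embed_forest (leaf i @ graft j (leaf k)))
     + basis (embed_forest (graft j (leaf k) @ leaf i))
     - basis (embed_forest (graft i (graft j (leaf k))))
     - basis (embed_forest (graft j (leaf i @ leaf k)))
     - basis (embed_forest (graft j (leaf k @ leaf i)))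
     - basis (graft (br i j) (embed_forest (leaf k)))
     - basis (graft (br j i) (embed_forest (leaf k)))"

end

theory Submission
  imports Defs
begin

text \<open>
  Every integral in the formula is the limit of sums of a germ \<open>\<Xi>\<close> whose defect
  \<open>\<Xi> u v - \<Xi> u m - \<Xi> m v\<close> is \<open>O(\<bar>v - u\<bar>\<^sup>4\<^sup>\<alpha>)\<close>. Since \<open>4\<alpha> > 1\<close>, the sewing lemma provides the limits, and
  two germs that agree up to \<open>O(\<bar>v - u\<bar>\<^sup>4\<^sup>\<alpha>)\<close> have the same limit. The controlledness hypothesis only
  determines \<open>Y\<^sub>v - Y\<^sub>u\<close> up to \<open>O(\<bar>v - u\<bar>\<^sup>3\<^sup>\<alpha>)\<close>; the integral equation, through the sewing estimate,
  determines it up to \<open>O(\<bar>v - u\<bar>\<^sup>4\<^sup>\<alpha>)\<close>. Inserting this in the third order Taylor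
  expansion of \<open>F\<close> and turning products of coefficients of \<open>X\<close> into sums by the shuffle relation
  gives the sum of the four germs, apart from the terms \<open>[\<tau>]\<^sub>(\<^sub>i\<^sub>j\<^sub>)\<close> with \<open>\<bar>\<tau>\<bar> = 2\<close>, which are negligible
  because the letter \<open>(ij)\<close> counts twice.\<close>

section \<open>Partitions and sewing\<close>

text \<open>The exponents pair off: a tree with \<open>m + 1\<close> vertices has a coefficient of
  order \<open>(m + 1) * \<alpha>\<close>, a controlled coefficient on \<open>m\<close> vertices has
  a remainder of order \<open>(3 - m) * \<alpha>\<close>, and the product is always of order
  \<open>4 * \<alpha>\<close>. So the weak expansion of \<open>Y\<close> already suffices to sew the
  integrals of the equation, and these in turn give the better expansion; there is no circle.
  Symmetry of \<open>D^2F\<close> and \<open>D^3F\<close> is the second ingredient: the Taylor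
  factors 1/2 and 1/6 cancel against the number of orderings in a shuffle product. What a single
  ordering of two leaves has beyond the ladder is carried by the letter \<open>(ij)\<close>.
  Differentiating the lifted integrands also hits the vector fields and yields terms
  \<open>D^2F : (f, Df : f)\<close> with permuted indices; after relabelling, the cherries and
  bracket trees in \<open>bar_elem\<close> compensate exactly these. The analysis runs on real
  functions of forests (\<open>W\<close>, \<open>Q\<close>), so that \<open>X\<close> and its
  bracket extension, over different alphabets, share one sewing argument.\<close>

lemma partition_sum_Nil [simp]: "partition_sum \<Xi> [] = 0"
  and partition_sum_singleton [simp]: "partition_sum \<Xi> [a] = 0"
  by (simp_all add: partition_sum_def)

lemma partition_sum_Cons_Cons [simp]:
  "partition_sum \<Xi> (a # b # ps) = \<Xi> a b + partition_sum \<Xi> (b # ps)"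
proof -
  have "partition_sum \<Xi> (a # b # ps) = (\<Sum>i<Suc (length ps). \<Xi> ((a # b # ps) ! i) ((a # b # ps) ! Suc i))"
    by (simp add: partition_sum_def)
  also have "\<dots> = \<Xi> a b + partition_sum \<Xi> (b # ps)"
    by (subst sum.lessThan_Suc_shift) (simp add: partition_sum_def)
  finally show ?thesis .
qed

lemma partition_sum_append:
  "ps \<noteq> [] \<Longrightarrow> partition_sum \<Xi> (ps @ q # qs) =
     partition_sum \<Xi> ps + \<Xi> (last ps) q + partition_sum \<Xi> (q # qs)"
proof (induction ps rule: induct_list012)
  case (2 x) then show ?case by simp
next
  case (3 x y zs) then show ?case by (simp add: algebra_simps)
qed simp

lemma partition_sum_join:
  "partition_sum \<Xi> (ps @ q # qs) = partition_sum \<Xi> (ps @ [q]) + partition_sum \<Xi> (q # qs)"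
  by (cases "ps = []") (simp_all add: partition_sum_append)

lemma partition_sum_cong:
  assumes "sorted_wrt (<) ps" "\<And>u v. u \<in> set ps \<Longrightarrow> v \<in> set ps \<Longrightarrow> u < v \<Longrightarrow> \<Xi> u v = \<Theta> u v"
  shows "partition_sum \<Xi> ps = partition_sum \<Theta> ps"
  using assms by (induction ps rule: induct_list012) auto

lemma partition_sum_add: "partition_sum (\<lambda>u v. \<Xi> u v + \<Theta> u v) ps = partition_sum \<Xi> ps + partition_sum \<Theta> ps"
  by (simp add: partition_sum_def sum.distrib)

lemma partition_sum_sum: "partition_sum (\<lambda>u v. \<Sum>i\<in>I. \<Xi> i u v) ps = (\<Sum>i\<in>I. partition_sum (\<Xi> i) ps)"
  unfolding partition_sum_def by (rule sum.swap)

lemma partition_sum_increment: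
  "ps \<noteq> [] \<Longrightarrow> partition_sum (\<lambda>u v. g v - g u) ps = g (last ps) - g (hd ps)"
  by (induction ps rule: induct_list012) auto

lemma partition_sum_diff_le:
  fixes \<Xi> \<Theta> :: "real \<Rightarrow> real \<Rightarrow> 'v::real_normed_vector"
  assumes "sorted_wrt (<) ps"
    and "\<And>u v. u \<in> set ps \<Longrightarrow> v \<in> set ps \<Longrightarrow> u < v \<Longrightarrow> norm (\<Xi> u v - \<Theta> u v) \<le> e u v"
  shows "norm (partition_sum \<Xi> ps - partition_sum \<Theta> ps) \<le> partition_sum e ps"
  using assms
proof (induction ps rule: induct_list012)
  case (3 x y zs)
  have "norm (\<Xi> x y - \<Theta> x y) \<le> e x y" using 3 by auto
  moreover have "norm (partition_sum \<Xi> (y # zs) - partition_sum \<Theta> (y # zs)) \<le> partition_sum e (y # zs)"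
    using 3 by auto
  ultimately show ?case
    using norm_triangle_ineq[of "\<Xi> x y - \<Theta> x y" "partition_sum \<Xi> (y # zs) - partition_sum \<Theta> (y # zs)"]
    by (simp add: algebra_simps)
qed auto

section \<open>The mesh of a partition, and joining partitions\<close>

lemma mesh_finite: "finite {ps ! Suc i - ps ! i | i. Suc i < length ps}"
  by (rule finite_subset[of _ "(\<lambda>i. ps ! Suc i - ps ! i) ` {..<length ps}"]) auto

text \<open>The maximum in \<open>mesh\<close> includes 0 so that it exists for a one-point
  partition; this is where \<open>0 < d\<close> comes from.\<close>

lemma mesh_less_iff:
  "mesh ps < d \<longleftrightarrow> 0 < d \<and> (\<forall>i. Suc i < length ps \<longrightarrow> ps ! Suc i - ps ! i < d)"
  unfolding mesh_def using mesh_finite[of ps] by (subst Max_less_iff) auto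

lemma mesh_less_Cons [simp]:
  "mesh (a # b # ps) < d \<longleftrightarrow> b - a < d \<and> mesh (b # ps) < d"
  unfolding mesh_less_iff by (auto simp: less_Suc_eq_0_disj nth_Cons split: nat.splits)

lemma mesh_singleton [simp]: "mesh [a] = 0"
  by (simp add: mesh_def)

lemma mesh_join:
  "mesh (ps @ [q]) < d \<Longrightarrow> mesh (q # qs) < d \<Longrightarrow> mesh (ps @ q # qs) < d"
  by (induction ps rule: induct_list012) auto

text \<open>One factor \<open>v - u\<close> is kept to telescope over the partition, the remaining
  power \<open>\<theta> - 1\<close> is bounded by the mesh. For this reason errors of order above 1
  disappear in the limit.\<close>

lemma partition_sum_powr_le:
  assumes "sorted_wrt (<) ps" "ps \<noteq> []" "mesh ps < d" "\<theta> \<ge> 1" "K \<ge> 0"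
  shows "partition_sum (\<lambda>u v. K * (v - u) powr \<theta>) ps \<le> K * d powr (\<theta> - 1) * (last ps - hd ps)"
  using assms
proof (induction ps rule: induct_list012)
  case (3 x y zs)
  have xy: "0 < y - x" "y - x < d" using 3 by auto
  have "(y - x) powr \<theta> = (y - x) powr (\<theta> - 1) * (y - x)"
    using xy powr_mult_base[of "y - x" "\<theta> - 1"] by (simp add: mult.commute)
  also have "\<dots> \<le> d powr (\<theta> - 1) * (y - x)"
    using xy 3 by (intro mult_right_mono powr_mono2) auto
  finally have "K * (y - x) powr \<theta> \<le> K * (d powr (\<theta> - 1) * (y - x))"
    using 3 by (intro mult_left_mono) auto
  moreover have "partition_sum (\<lambda>u v. K * (v - u) powr \<theta>) (y # zs)
      \<le> K * d powr (\<theta> - 1) * (last (y # zs) - hd (y # zs))"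
    using 3 by auto
  ultimately show ?case by (simp add: algebra_simps)
qed auto

lemma sorted_wrt_less_hd_last:
  assumes "sorted_wrt (<) (ps::real list)" "x \<in> set ps"
  shows "hd ps \<le> x" "x \<le> last ps"
  using assms by (induction ps rule: induct_list012) (auto simp: less_imp_le intro: order_trans)

lemma is_partition_mem: "is_partition s t ps \<Longrightarrow> u \<in> set ps \<Longrightarrow> s \<le> u \<and> u \<le> t"
  using sorted_wrt_less_hd_last unfolding is_partition_def by blast

text \<open>\<open>tl\<close> drops the point \<open>b\<close> that both partitions contain.\<close>

lemma is_partition_join:
  assumes "is_partition a b ps" "is_partition b c qs"
  shows "is_partition a c (ps @ tl qs)"
    "partition_sum \<Xi> (ps @ tl qs) = partition_sum \<Xi> ps + partition_sum \<Xi> qs"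
    "mesh ps < d \<Longrightarrow> mesh qs < d \<Longrightarrow> mesh (ps @ tl qs) < d"
proof -
  obtain ps' where ps: "ps = ps' @ [b]"
    using assms(1) unfolding is_partition_def by (metis append_butlast_last_id)
  obtain qs' where qs: "qs = b # qs'"
    using assms(2) unfolding is_partition_def by (metis list.collapse)
  show "is_partition a c (ps @ tl qs)"
    using assms unfolding ps qs is_partition_def
    by (auto simp: sorted_wrt_append hd_append split: if_splits) (meson less_trans)
  show "partition_sum \<Xi> (ps @ tl qs) = partition_sum \<Xi> ps + partition_sum \<Xi> qs"
    using partition_sum_join[of \<Xi> ps' b qs'] by (simp add: ps qs)
  show "mesh ps < d \<Longrightarrow> mesh qs < d \<Longrightarrow> mesh (ps @ tl qs) < d"
    using mesh_join[of ps' b d qs'] by (simp add: ps qs)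
qed

lemma ex_partition_mesh_less:
  assumes "a \<le> b" "0 < d"
  shows "\<exists>ps. is_partition a b ps \<and> mesh ps < d"
proof -
  \<comment> \<open>\<open>n\<close> counts steps of length \<open>d / 2\<close>, strictly below the
    mesh bound; the right endpoint is quantified so that the last step can be split off.\<close>
  have "\<forall>b. a \<le> b \<and> b - a \<le> real n * (d / 2) \<longrightarrow> (\<exists>ps. is_partition a b ps \<and> mesh ps < d)" for n
  proof (induction n)
    case 0
    show ?case using assms by (auto simp: is_partition_def intro!: exI[of _ "[a]"])
  next
    case (Suc n)
    show ?case
    proof (intro allI impI)
      fix b assume b: "a \<le> b \<and> b - a \<le> real (Suc n) * (d / 2)"
      show "\<exists>ps. is_partition a b ps \<and> mesh ps < d"
      proof (cases "b - d / 2 \<le> a")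
        case True
        show ?thesis
        proof (cases "a = b")
          case True
          then show ?thesis using assms by (auto simp: is_partition_def intro!: exI[of _ "[a]"])
        next
          case False
          then show ?thesis using b assms True
            by (auto simp: is_partition_def intro!: exI[of _ "[a, b]"])
        qed
      next
        case False
        then obtain ps where ps: "is_partition a (b - d / 2) ps" "mesh ps < d"
          using Suc b by (auto simp: algebra_simps dest!: spec[of _ "b - d / 2"])
        have q: "is_partition (b - d / 2) b [b - d / 2, b]" "mesh [b - d / 2, b] < d"
          using assms by (auto simp: is_partition_def)
        show ?thesis
          using is_partition_join(1)[OF ps(1) q(1)] is_partition_join(3)[OF ps(1) q(1) ps(2) q(2)] by blast
      qed
    qed
  qed
  moreover obtain n where "(b - a) / (d / 2) \<le> real n" using real_arch_simple by blast
  then have "b - a \<le> real n * (d / 2)" using assms by (simp add: field_simps)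
  ultimately show ?thesis using assms by blast
qed

section \<open>Limits along the partition filter\<close>

lemma eventually_partition_filter:
  "eventually P (partition_filter s t) \<longleftrightarrow> (\<exists>d>0. \<forall>ps. is_partition s t ps \<and> mesh ps < d \<longrightarrow> P ps)"
  unfolding partition_filter_def
proof (subst eventually_INF_base)
  fix a b :: real assume "a \<in> {0<..}" "b \<in> {0<..}"
  then show "\<exists>x\<in>{0<..}. principal {ps. is_partition s t ps \<and> mesh ps < x} \<le>
      inf (principal {ps. is_partition s t ps \<and> mesh ps < a}) (principal {ps. is_partition s t ps \<and> mesh ps < b})"
    by (intro bexI[of _ "min a b"]) auto
qed (auto simp: eventually_principal)

text \<open>In a trivial filter every value would be a limit; uniqueness of the integrals rests on
  this.\<close>

lemma partition_filter_nontrivial: "s \<le> t \<Longrightarrow> partition_filter s t \<noteq> bot"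
  unfolding trivial_limit_def eventually_partition_filter using ex_partition_mesh_less by blast

lemma tendsto_partition_filter_iff:
  fixes I :: "'v::real_normed_vector"
  shows "(S \<longlongrightarrow> I) (partition_filter s t) \<longleftrightarrow>
    (\<forall>e>0. \<exists>d>0. \<forall>ps. is_partition s t ps \<and> mesh ps < d \<longrightarrow> norm (S ps - I) < e)"
  unfolding tendsto_iff eventually_partition_filter dist_norm by auto

text \<open>Joining fine partitions of the two subintervals gives a fine partition of the whole. As
  the limit over the whole interval is assumed to exist, it may be tested along such
  partitions.\<close>

lemma partition_limit_add:
  fixes \<Xi> :: "real \<Rightarrow> real \<Rightarrow> 'v::real_normed_vector"
  assumes "a \<le> b" "b \<le> c"
    and I: "(partition_sum \<Xi> \<longlongrightarrow> I) (partition_filter a b)"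
    and J: "(partition_sum \<Xi> \<longlongrightarrow> J) (partition_filter b c)"
    and L: "(partition_sum \<Xi> \<longlongrightarrow> L) (partition_filter a c)"
  shows "L = I + J"
proof (rule ccontr)
  assume "L \<noteq> I + J"
  then have e: "norm (I + J - L) / 3 > 0" (is "?e > 0") by simp
  obtain d1 where d1: "d1 > 0" "\<And>ps. is_partition a b ps \<Longrightarrow> mesh ps < d1 \<Longrightarrow> norm (partition_sum \<Xi> ps - I) < ?e"
    using I e unfolding tendsto_partition_filter_iff by blast
  obtain d2 where d2: "d2 > 0" "\<And>ps. is_partition b c ps \<Longrightarrow> mesh ps < d2 \<Longrightarrow> norm (partition_sum \<Xi> ps - J) < ?e"
    using J e unfolding tendsto_partition_filter_iff by blast
  obtain d3 where d3: "d3 > 0" "\<And>ps. is_partition a c ps \<Longrightarrow> mesh ps < d3 \<Longrightarrow> norm (partition_sum \<Xi> ps - L) < ?e"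
    using L e unfolding tendsto_partition_filter_iff by blast
  define d where "d = min d1 (min d2 d3)"
  have "d > 0" using d1 d2 d3 by (simp add: d_def)
  then obtain ps qs where p: "is_partition a b ps" "mesh ps < d" and q: "is_partition b c qs" "mesh qs < d"
    using ex_partition_mesh_less assms by metis
  note j = is_partition_join[OF p(1) q(1)]
  have "norm (partition_sum \<Xi> ps + partition_sum \<Xi> qs - L) < ?e"
    using d3(2)[OF j(1)] j(3)[of d] p q by (simp add: j(2) d_def)
  moreover have "norm (partition_sum \<Xi> ps - I) < ?e" using d1 p by (simp add: d_def)
  moreover have "norm (partition_sum \<Xi> qs - J) < ?e" using d2 q by (simp add: d_def)
  moreover have tri: "norm (x - y - z) \<le> norm x + norm y + norm z" for x y z :: 'v
    using norm_triangle_ineq4[of "x - y" z] norm_triangle_ineq4[of x y] by linarith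
  ultimately show False
    using tri[of "partition_sum \<Xi> ps + partition_sum \<Xi> qs - L" "partition_sum \<Xi> ps - I" "partition_sum \<Xi> qs - J"]
    by (simp add: algebra_simps)
qed

text \<open>Splitting at the midpoint leaves two partitions of intervals of at most half the length, and
  \<open>2 (1/2)\<^sup>\<theta> < 1\<close>.\<close>
lemma partition_sum_germ_le:
  fixes \<Xi> :: "real \<Rightarrow> real \<Rightarrow> 'v::real_normed_vector"
  assumes \<theta>: "\<theta> > 1" and C: "C \<ge> 0"
    and \<delta>: "\<And>u m v. a \<le> u \<Longrightarrow> u < m \<Longrightarrow> m < v \<Longrightarrow> v \<le> b \<Longrightarrow>
      norm (\<Xi> u v - \<Xi> u m - \<Xi> m v) \<le> C * (v - u) powr \<theta>"
    and "is_partition u v ps" "a \<le> u" "u < v" "v \<le> b"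
  shows "norm (partition_sum \<Xi> ps - \<Xi> u v) \<le> 2 * C / (1 - 2 powr (1 - \<theta>)) * (v - u) powr \<theta>"
proof -
  \<comment> \<open>\<open>K\<close> is the fixed point of
    \<open>K = K * 2 powr (1 - \<theta>) + 2 * C\<close>: two pieces of at most half the length,
    plus two defects.\<close>
  define K where "K = 2 * C / (1 - 2 powr (1 - \<theta>))"
  have p1: "2 powr (1 - \<theta>) < (1::real)" using \<theta> by (simp add: powr_less_one)
  have K0: "K \<ge> 0" using C p1 by (simp add: K_def)
  have K: "K * 2 powr (1 - \<theta>) + 2 * C = K" 
  proof -
    have "K * (1 - 2 powr (1 - \<theta>)) = 2 * C" using p1 \<theta> by (simp add: K_def)
    then show ?thesis by (simp add: algebra_simps)
  qed
  \<comment> \<open>The cut may leave a piece consisting of one point. A germ that vanishes on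
    degenerate intervals keeps the induction hypothesis true there, whatever
    \<open>\<Xi> u u\<close> is.\<close>
  define Z where "Z = (\<lambda>u v. if u < v then \<Xi> u v else 0)"
  have \<delta>Z: "norm (Z u v - Z u m - Z m v) \<le> C * (v - u) powr \<theta>"
    if "a \<le> u" "u \<le> m" "m \<le> v" "v \<le> b" for u m v
    using \<delta>[of u m v] that C by (auto simp: Z_def)
  have "norm (partition_sum Z ps - Z u v) \<le> K * (v - u) powr \<theta>"
    if "is_partition u v ps" "a \<le> u" "u \<le> v" "v \<le> b" for u v ps
    using that
  proof (induction ps arbitrary: u v rule: length_induct)
    case (1 ps)
    show ?case
    proof (cases "u = v")
      case True
      have "ps = [u]" using 1(2) True is_partition_mem[OF 1(2)] unfolding is_partition_def
        by (cases ps rule: remdups_adj.cases) force+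
      then show ?thesis using True by (simp add: Z_def)
    next
      case False
      then have uv: "u < v" using 1 by simp
      define m where "m = (u + v) / 2"
      have m: "u < m" "m < v" using uv by (auto simp: m_def)
      \<comment> \<open>The midpoint need not be a partition point: it falls into the gap from
        \<open>p\<close> to \<open>q\<close>, and both outer pieces have at most half the
        length.\<close>
      define P where "P = takeWhile (\<lambda>x. x \<le> m) ps"
      define Q where "Q = dropWhile (\<lambda>x. x \<le> m) ps"
      have PQ: "ps = P @ Q" by (simp add: P_def Q_def)
      have ps: "ps \<noteq> []" "hd ps = u" "last ps = v" "sorted_wrt (<) ps"
        using 1(2) by (auto simp: is_partition_def)
      have P: "P \<noteq> []" using ps m by (cases ps) (auto simp: P_def)
      have "v \<in> set ps" "\<not> v \<le> m" using ps(1,3) m last_in_set[of ps] by auto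
      then have Q: "Q \<noteq> []" unfolding Q_def dropWhile_eq_Nil_conv by blast
      define p where "p = last P"
      define q where "q = hd Q"
      have pm: "p \<le> m" using P last_in_set[OF P] set_takeWhileD[of p "\<lambda>x. x \<le> m" ps]
        by (auto simp: p_def P_def)
      have qm: "q > m" using Q hd_dropWhile[of "\<lambda>x. x \<le> m" ps] by (auto simp: q_def Q_def)
      have isP: "is_partition u p P" and isQ: "is_partition q v Q"
        using ps P Q unfolding PQ is_partition_def p_def q_def by (auto simp: sorted_wrt_append)
      have up: "u \<le> p" "q \<le> v"
        using is_partition_mem[OF isP] is_partition_mem[OF isQ] P Q by (auto simp: p_def q_def)
      have S: "partition_sum Z ps = partition_sum Z P + Z p q + partition_sum Z Q"
        using partition_sum_append[OF P, of Z q "tl Q"] Q by (simp add: PQ p_def q_def)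
      have half: "2 * ((v - u) / 2) powr \<theta> = 2 powr (1 - \<theta>) * (v - u) powr \<theta>"
        using uv by (simp add: powr_divide powr_diff)
      have "norm (partition_sum Z P - Z u p) \<le> K * (p - u) powr \<theta>"
        using 1(1)[rule_format, of P u p] isP up pm m 1(3-5) Q by (simp add: PQ)
      also have "\<dots> \<le> K * ((v - u) / 2) powr \<theta>"
        using up pm K0 \<theta> by (intro mult_left_mono powr_mono2) (auto simp: m_def field_simps)
      finally have e1: "norm (partition_sum Z P - Z u p) \<le> K * ((v - u) / 2) powr \<theta>" .
      have "norm (partition_sum Z Q - Z q v) \<le> K * (v - q) powr \<theta>"
        using 1(1)[rule_format, of Q q v] isQ up qm m 1(3-5) P by (simp add: PQ)
      also have "\<dots> \<le> K * ((v - u) / 2) powr \<theta>"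
        using up qm K0 \<theta> by (intro mult_left_mono powr_mono2) (auto simp: m_def field_simps)
      finally have e2: "norm (partition_sum Z Q - Z q v) \<le> K * ((v - u) / 2) powr \<theta>" .
      have e3: "norm (Z u v - Z u p - Z p v) \<le> C * (v - u) powr \<theta>"
        using \<delta>Z[of u p v] up pm m 1(3-5) by simp
      have "norm (Z p v - Z p q - Z q v) \<le> C * (v - p) powr \<theta>"
        using \<delta>Z[of p q v] up pm qm m 1(3-5) by simp
      also have "\<dots> \<le> C * (v - u) powr \<theta>"
        using up pm m C \<theta> by (intro mult_left_mono powr_mono2) auto
      finally have e4: "norm (Z p v - Z p q - Z q v) \<le> C * (v - u) powr \<theta>" .
      \<comment> \<open>Inserting \<open>p\<close> and then \<open>q\<close> into the interval costs
        two defects, hence \<open>2 * C\<close>.\<close>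
      have "norm (partition_sum Z ps - Z u v) = norm ((partition_sum Z P - Z u p) + (partition_sum Z Q - Z q v)
          - (Z u v - Z u p - Z p v) - (Z p v - Z p q - Z q v))"
        by (simp add: S algebra_simps)
      also have "\<dots> \<le> K * ((v - u) / 2) powr \<theta> + K * ((v - u) / 2) powr \<theta> + C * (v - u) powr \<theta> + C * (v - u) powr \<theta>"
        by (intro norm_triangle_le_diff norm_triangle_le add_mono e1 e2 e3 e4)
      also have "\<dots> = K * (2 * ((v - u) / 2) powr \<theta>) + 2 * C * (v - u) powr \<theta>" by simp
      also have "\<dots> = (K * 2 powr (1 - \<theta>) + 2 * C) * (v - u) powr \<theta>"
        unfolding half by (simp add: algebra_simps)
      finally show ?thesis unfolding K .
    qed
  qed
  from this[OF assms(4,5) _ assms(7)] assms(6)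
  have "norm (partition_sum Z ps - Z u v) \<le> K * (v - u) powr \<theta>" by simp
  moreover have "partition_sum Z ps = partition_sum \<Xi> ps"
    using assms(4) unfolding is_partition_def by (intro partition_sum_cong) (auto simp: Z_def)
  ultimately show ?thesis using assms(6) by (simp add: Z_def K_def)
qed

text \<open>Between consecutive points of \<open>ps\<close>, the finer \<open>qs\<close> is a
  partition of that interval, so the germ estimate applies interval by interval. Only the left end
  varies, which suits peeling off the first point.\<close>

lemma partition_sum_refinement_le:
  fixes \<Xi> :: "real \<Rightarrow> real \<Rightarrow> 'v::real_normed_vector"
  assumes *: "\<And>u v qs. is_partition u v qs \<Longrightarrow> a \<le> u \<Longrightarrow> u < v \<Longrightarrow> v \<le> b \<Longrightarrow>
      norm (partition_sum \<Xi> qs - \<Xi> u v) \<le> e u v"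
    and "is_partition u b ps" "is_partition u b qs" "set ps \<subseteq> set qs" "a \<le> u"
  shows "norm (partition_sum \<Xi> qs - partition_sum \<Xi> ps) \<le> partition_sum e ps"
  using assms(2-)
proof (induction ps arbitrary: u qs rule: induct_list012)
  case 1 then show ?case by (simp add: is_partition_def)
next
  case (2 x)
  then have "u = b" by (auto simp: is_partition_def)
  then have "qs = [b]" using 2(2) is_partition_mem[OF 2(2)]
    unfolding is_partition_def by (cases qs rule: remdups_adj.cases) force+
  then show ?case by simp
next
  case (3 x y zs)
  have ux: "u = x" and xy: "x < y" using 3(3) by (auto simp: is_partition_def)
  have "y \<in> set qs" using 3 by auto
  then obtain q1 q2 where q: "qs = q1 @ y # q2" by (meson split_list)
  have "q1 \<noteq> []" using q 3(4) xy ux by (cases q1) (auto simp: is_partition_def)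
  then have h1: "is_partition u y (q1 @ [y])" and h2: "is_partition y b (y # q2)"
    using 3(4) unfolding q is_partition_def by (auto simp: sorted_wrt_append)
  have yb: "y \<le> b" using is_partition_mem[OF 3(3), of y] by simp
  have iz: "is_partition y b (y # zs)" using 3(3) by (auto simp: is_partition_def)
  \<comment> \<open>As \<open>qs\<close> is sorted, all its points from \<open>y\<close> on lie in
    \<open>y # q2\<close>.\<close>
  have "set (y # zs) \<subseteq> set (y # q2)"
  proof
    fix w assume w: "w \<in> set (y # zs)"
    then have "w \<ge> y" using is_partition_mem[OF iz] by blast
    moreover have "w \<in> set qs" using w 3(5) by auto
    ultimately show "w \<in> set (y # q2)" using 3(4) unfolding q is_partition_def
      by (force simp: sorted_wrt_append)
  qed
  then have "norm (partition_sum \<Xi> (y # q2) - partition_sum \<Xi> (y # zs)) \<le> partition_sum e (y # zs)"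
    using 3(2)[OF iz h2] 3(6) ux xy by auto
  moreover have "norm (partition_sum \<Xi> (q1 @ [y]) - \<Xi> x y) \<le> e x y"
    using *[OF h1] 3(6) ux xy yb by auto
  ultimately show ?case
    using norm_triangle_ineq[of "partition_sum \<Xi> (y # q2) - partition_sum \<Xi> (y # zs)" "partition_sum \<Xi> (q1 @ [y]) - \<Xi> x y"]
    unfolding q partition_sum_join[of _ q1 y q2] by (simp add: algebra_simps)
qed

lemma is_partition_common_refinement:
  assumes "is_partition a b ps" "is_partition a b qs"
  obtains rs where "is_partition a b rs" "set ps \<subseteq> set rs" "set qs \<subseteq> set rs"
proof
  let ?rs = "sorted_list_of_set (set ps \<union> set qs)"
  have mem: "a \<le> x \<and> x \<le> b" if "x \<in> set ps \<union> set qs" for x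
    using that assms is_partition_mem by blast
  have ab: "a \<in> set ps" "b \<in> set ps" using assms by (auto simp: is_partition_def)
  have ne: "?rs \<noteq> []" and s: "sorted_wrt (<) ?rs" 
    using ab sorted_list_of_set_eq_Nil_iff[of "set ps \<union> set qs"] strict_sorted_list_of_set[of "set ps \<union> set qs"]
    by auto
  have set: "set ?rs = set ps \<union> set qs" by (subst set_sorted_list_of_set) auto
  have "hd ?rs = a"
    using sorted_wrt_less_hd_last(1)[OF s, of a] mem hd_in_set[OF ne] ab unfolding set by fastforce
  moreover have "last ?rs = b"
    using sorted_wrt_less_hd_last(2)[OF s, of b] mem last_in_set[OF ne] ab unfolding set by fastforce
  ultimately show "is_partition a b ?rs" using ne s by (simp add: is_partition_def)
  show "set ps \<subseteq> set ?rs" "set qs \<subseteq> set ?rs" using set by auto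
qed

lemma powr_mesh_small:
  assumes "\<theta> > 1" "e > 0" "M \<ge> 0"
  shows "\<exists>d>0. M * d powr (\<theta> - 1) < (e::real)"
proof (intro exI conjI)
  \<comment> \<open>\<open>M + 1\<close> in place of \<open>M\<close> covers \<open>M = 0\<close>
    and makes the final inequality strict.\<close>
  let ?d = "(e / (M + 1)) powr (1 / (\<theta> - 1))"
  show "?d > 0" using assms by simp
  have "?d powr (\<theta> - 1) = e / (M + 1)" using assms by (simp add: powr_powr)
  moreover have "M * (e / (M + 1)) < e" using assms by (simp add: divide_simps algebra_simps)
  ultimately show "M * ?d powr (\<theta> - 1) < e" by simp
qed

text \<open>The estimate for a single interval, summed over a partition, leaves a power of the mesh;
  this makes the sums Cauchy, and on the whole interval it survives the limit.\<close>

theorem sewing: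
  fixes \<Xi> :: "real \<Rightarrow> real \<Rightarrow> 'v::banach"
  assumes \<theta>: "\<theta> > 1" and C: "C \<ge> 0" and ab: "a \<le> b"
    and \<delta>: "\<And>u m v. a \<le> u \<Longrightarrow> u < m \<Longrightarrow> m < v \<Longrightarrow> v \<le> b \<Longrightarrow>
      norm (\<Xi> u v - \<Xi> u m - \<Xi> m v) \<le> C * (v - u) powr \<theta>"
  obtains I where "(partition_sum \<Xi> \<longlongrightarrow> I) (partition_filter a b)"
    "a < b \<Longrightarrow> norm (I - \<Xi> a b) \<le> 2 * C / (1 - 2 powr (1 - \<theta>)) * (b - a) powr \<theta>"
proof -
  define K where "K = 2 * C / (1 - 2 powr (1 - \<theta>))"
  have p1: "2 powr (1 - \<theta>) < (1::real)" using \<theta> by (simp add: powr_less_one)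
  have K0: "K \<ge> 0" using C p1 by (simp add: K_def)
  have germ: "norm (partition_sum \<Xi> qs - \<Xi> u v) \<le> K * (v - u) powr \<theta>"
    if "is_partition u v qs" "a \<le> u" "u < v" "v \<le> b" for u v qs
    unfolding K_def by (rule partition_sum_germ_le[OF \<theta> C \<delta>]) (use that in auto)
  \<comment> \<open>Both sums are compared with the one over a common refinement; the bound sees the
    partitions only through their mesh.\<close>
  have cauchy: "norm (partition_sum \<Xi> ps - partition_sum \<Xi> qs) \<le> 2 * (K * (b - a)) * d powr (\<theta> - 1)"
    if part: "is_partition a b ps" "is_partition a b qs" "mesh ps < d" "mesh qs < d" for ps qs d
  proof -
    obtain rs where rs: "is_partition a b rs" "set ps \<subseteq> set rs" "set qs \<subseteq> set rs"
      using is_partition_common_refinement[OF part(1,2)] .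
    have r: "norm (partition_sum \<Xi> rs - partition_sum \<Xi> ps) \<le> K * (b - a) * d powr (\<theta> - 1)"
      if ps: "is_partition a b ps" "mesh ps < d" "set ps \<subseteq> set rs" for ps
    proof -
      have "norm (partition_sum \<Xi> rs - partition_sum \<Xi> ps) \<le> partition_sum (\<lambda>u v. K * (v - u) powr \<theta>) ps"
        by (rule partition_sum_refinement_le[OF germ ps(1) rs(1) ps(3)]) auto
      also have "\<dots> \<le> K * d powr (\<theta> - 1) * (last ps - hd ps)"
        by (rule partition_sum_powr_le) (use ps \<theta> K0 in \<open>auto simp: is_partition_def\<close>)
      finally show ?thesis using ps by (simp add: is_partition_def algebra_simps)
    qed
    show ?thesis
      using norm_triangle_ineq4[of "partition_sum \<Xi> rs - partition_sum \<Xi> qs" "partition_sum \<Xi> rs - partition_sum \<Xi> ps"]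
        r[of ps] r[of qs] part rs by simp
  qed
  \<comment> \<open>Completeness is used along one sequence of partitions; \<open>cauchy\<close>
    then carries its limit to all fine partitions.\<close>
  have "\<exists>ps. is_partition a b ps \<and> mesh ps < 1 / real (Suc n)" for n
    by (rule ex_partition_mesh_less[OF ab]) simp
  then obtain p where p: "\<And>n. is_partition a b (p n)" "\<And>n. mesh (p n) < 1 / real (Suc n)" by metis
  have small: "\<exists>d>0. 2 * (K * (b - a)) * d powr (\<theta> - 1) < e" if "e > 0" for e
    using K0 ab that by (intro powr_mesh_small \<theta>) auto
  have fine: "\<exists>N. \<forall>n\<ge>N. mesh (p n) < d" if "d > 0" for d
  proof -
    obtain N where N: "1 / real (Suc N) < d" using \<open>d > 0\<close> by (metis nat_approx_posE)
    have "mesh (p n) < d" if "n \<ge> N" for n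
    proof -
      have "1 / real (Suc n) \<le> 1 / real (Suc N)" using that by (intro divide_left_mono) auto
      then show ?thesis using p(2)[of n] N by linarith
    qed
    then show ?thesis by blast
  qed
  have "Cauchy (\<lambda>n. partition_sum \<Xi> (p n))"
    unfolding Cauchy_iff
  proof (intro allI impI)
    fix e :: real assume "e > 0"
    then obtain d where d: "d > 0" "2 * (K * (b - a)) * d powr (\<theta> - 1) < e" using small by blast
    then obtain N where "\<forall>n\<ge>N. mesh (p n) < d" using fine by blast
    then show "\<exists>M. \<forall>m\<ge>M. \<forall>n\<ge>M. norm (partition_sum \<Xi> (p m) - partition_sum \<Xi> (p n)) < e"
      using cauchy[OF p(1) p(1), of _ d] d(2) by (meson le_less_trans)
  qed
  then obtain I where I: "(\<lambda>n. partition_sum \<Xi> (p n)) \<longlonglongrightarrow> I" using Cauchy_convergent convergent_def by blast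
  have lim: "(partition_sum \<Xi> \<longlongrightarrow> I) (partition_filter a b)"
    unfolding tendsto_partition_filter_iff
  proof (intro allI impI)
    fix e :: real assume "e > 0"
    then obtain d where d: "d > 0" "2 * (K * (b - a)) * d powr (\<theta> - 1) < e / 2" using small[of "e / 2"] by auto
    then obtain N where N: "\<And>n. n\<ge>N \<Longrightarrow> mesh (p n) < d" using fine by blast
    obtain M where M: "\<And>n. n \<ge> M \<Longrightarrow> norm (partition_sum \<Xi> (p n) - I) < e / 2"
      using I \<open>e > 0\<close> unfolding LIMSEQ_iff by (meson half_gt_zero)
    define n where "n = max M N"
    show "\<exists>d>0. \<forall>ps. is_partition a b ps \<and> mesh ps < d \<longrightarrow> norm (partition_sum \<Xi> ps - I) < e"
    proof (intro exI[of _ d] conjI allI impI d(1))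
      fix ps assume ps: "is_partition a b ps \<and> mesh ps < d"
      have "norm (partition_sum \<Xi> ps - partition_sum \<Xi> (p n)) < e / 2"
        using cauchy[of ps "p n" d] ps p(1) N[of n] d(2) by (simp add: n_def)
      then show "norm (partition_sum \<Xi> ps - I) < e"
        using M[of n] norm_triangle_ineq[of "partition_sum \<Xi> ps - partition_sum \<Xi> (p n)" "partition_sum \<Xi> (p n) - I"]
        by (simp add: n_def)
    qed
  qed
  \<comment> \<open>Asserted for \<open>a < b\<close> only, since \<open>\<Xi> a a\<close> is
    arbitrary.\<close>
  have "norm (I - \<Xi> a b) \<le> K * (b - a) powr \<theta>" if "a < b"
  proof (rule tendsto_upperbound)
    show "((\<lambda>ps. norm (partition_sum \<Xi> ps - \<Xi> a b)) \<longlongrightarrow> norm (I - \<Xi> a b)) (partition_filter a b)"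
      by (intro tendsto_intros lim)
    show "\<forall>\<^sub>F ps in partition_filter a b. norm (partition_sum \<Xi> ps - \<Xi> a b) \<le> K * (b - a) powr \<theta>"
      unfolding eventually_partition_filter using germ[of a b] that by (intro exI[of _ 1]) auto
  qed (use partition_filter_nontrivial ab in auto)
  then show thesis using that lim unfolding K_def by blast
qed

text \<open>The increments of \<open>g\<close> telescope exactly, and the deviations add up to a
  positive power of the mesh.\<close>

lemma partition_sum_tendsto_increment:
  fixes g :: "real \<Rightarrow> 'v::real_normed_vector"
  assumes \<theta>: "\<theta> > 1" and C: "C \<ge> 0" and ab: "a \<le> b"
    and *: "\<And>u v. a \<le> u \<Longrightarrow> u < v \<Longrightarrow> v \<le> b \<Longrightarrow> norm (\<Xi> u v - (g v - g u)) \<le> C * (v - u) powr \<theta>"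
  shows "(partition_sum \<Xi> \<longlongrightarrow> g b - g a) (partition_filter a b)"
  unfolding tendsto_partition_filter_iff
proof (intro allI impI)
  fix e :: real assume "e > 0"
  then obtain d where d: "d > 0" "C * (b - a) * d powr (\<theta> - 1) < e"
    using powr_mesh_small[OF \<theta> _, of e "C * (b - a)"] C ab by auto
  show "\<exists>d>0. \<forall>ps. is_partition a b ps \<and> mesh ps < d \<longrightarrow> norm (partition_sum \<Xi> ps - (g b - g a)) < e"
  proof (intro exI[of _ d] conjI allI impI d(1))
    fix ps assume ps: "is_partition a b ps \<and> mesh ps < d"
    then have "norm (partition_sum \<Xi> ps - partition_sum (\<lambda>u v. g v - g u) ps)
        \<le> partition_sum (\<lambda>u v. C * (v - u) powr \<theta>) ps"
      using is_partition_mem[of a b ps] by (intro partition_sum_diff_le *) (auto simp: is_partition_def)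
    also have "\<dots> \<le> C * d powr (\<theta> - 1) * (last ps - hd ps)"
      using ps \<theta> C by (intro partition_sum_powr_le) (auto simp: is_partition_def)
    finally show "norm (partition_sum \<Xi> ps - (g b - g a)) < e"
      using ps d(2) by (simp add: is_partition_def partition_sum_increment algebra_simps)
  qed
qed

text \<open>Common form of \<open>rough_integral\<close> and \<open>young_integral\<close>, which
  differ only in their germ.\<close>

definition partition_integral :: "(real \<Rightarrow> real \<Rightarrow> 'v::real_normed_vector) \<Rightarrow> real \<Rightarrow> real \<Rightarrow> 'v" where
  "partition_integral \<Xi> s t = (THE I. has_partition_integral \<Xi> s t I)"

lemma has_partition_integral_unique:
  "has_partition_integral \<Xi> s t I \<Longrightarrow> has_partition_integral \<Xi> s t J \<Longrightarrow> I = J"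
  using tendsto_unique[OF partition_filter_nontrivial[of s t], of "partition_sum \<Xi>" I J]
    tendsto_unique[OF partition_filter_nontrivial[of t s], of "partition_sum \<Xi>" "-I" "-J"]
  unfolding has_partition_integral_def by (auto split: if_splits)

lemma partition_integral_eq: "has_partition_integral \<Xi> s t I \<Longrightarrow> partition_integral \<Xi> s t = I"
  unfolding partition_integral_def by (rule the_equality) (auto dest: has_partition_integral_unique)

lemma has_partition_integral_reverse:
  assumes "s \<le> t" "has_partition_integral \<Xi> s t I"
  shows "has_partition_integral \<Xi> t s (- I)"
proof (cases "s = t")
  case True
  \<comment> \<open>For \<open>s = t\<close> both orientations fall into the same branch, so the
    value must be 0. No \<open>u < v\<close> fits into the interval, hence any exponent above 1
    works with the constant 0.\<close>
  have "(partition_sum \<Xi> \<longlongrightarrow> 0) (partition_filter s s)"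
    using partition_sum_tendsto_increment[of 2 0 s s \<Xi> "\<lambda>_. 0"] by simp
  then have "I = 0" using assms True has_partition_integral_unique[of \<Xi> s s I 0]
    by (simp add: has_partition_integral_def)
  then show ?thesis using assms True by simp
next
  case False
  then show ?thesis using assms by (simp add: has_partition_integral_def)
qed

section \<open>Smooth maps and their Taylor expansion\<close>

lemma partial_deriv_eq: "(G has_derivative G') (at u) \<Longrightarrow> partial_deriv a G u = G' (axis a 1)"
  unfolding partial_deriv_def using frechet_derivative_at by metis

lemma has_derivative_partial_deriv:
  fixes G :: "real^'n::finite \<Rightarrow> real^'m::finite"
  assumes "G differentiable (at u)"
  shows "(G has_derivative (\<lambda>h. \<Sum>a\<in>UNIV. h $ a *\<^sub>R partial_deriv a G u)) (at u)"
proof -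
  define G' where "G' = frechet_derivative G (at u)"
  have G': "(G has_derivative G') (at u)" using assms frechet_derivative_works G'_def by blast
  then have lin: "linear G'" by (rule has_derivative_linear)
  have "G' = (\<lambda>h. \<Sum>a\<in>UNIV. h $ a *\<^sub>R partial_deriv a G u)"
  proof
    fix h :: "real^'n"
    have "G' h = G' (\<Sum>a\<in>UNIV. h $ a *\<^sub>R axis a 1)"
      using basis_expansion[of h] by (simp add: scalar_mult_eq_scaleR)
    also have "\<dots> = (\<Sum>a\<in>UNIV. h $ a *\<^sub>R partial_deriv a G u)"
      by (simp add: linear_sum[OF lin] linear_scale[OF lin] partial_deriv_eq[OF G'])
    finally show "G' h = \<dots>" .
  qed
  then show ?thesis using G' by simp
qed

text \<open>Smoothness offers no number to induct on; bounding the number of derivatives turns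
  closure under sums and products into an induction.\<close>

definition differentiable_upto :: "nat \<Rightarrow> (real^'n::finite \<Rightarrow> real^'m::finite) \<Rightarrow> bool" where
  "differentiable_upto n G \<longleftrightarrow>
     (\<forall>as u. length as \<le> n \<longrightarrow> foldr partial_deriv as G differentiable (at u))"

lemma smooth_iff_upto: "smooth G \<longleftrightarrow> (\<forall>n. differentiable_upto n G)"
  by (auto simp: smooth_def differentiable_upto_def)

lemma differentiable_upto_0: "differentiable_upto 0 G \<longleftrightarrow> (\<forall>u. G differentiable (at u))"
  by (auto simp: differentiable_upto_def)

text \<open>\<open>foldr\<close> applies the last index first, so the innermost derivative is split
  off at the end of the list.\<close>

lemma differentiable_upto_Suc:
  "differentiable_upto (Suc n) G \<longleftrightarrow>
     (\<forall>u. G differentiable (at u)) \<and> (\<forall>a. differentiable_upto n (partial_deriv a G))"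
proof
  assume *: "differentiable_upto (Suc n) G"
  have "foldr partial_deriv as (partial_deriv a G) differentiable (at u)" if "length as \<le> n" for as a u
    using *[unfolded differentiable_upto_def, rule_format, of "as @ [a]" u] that by simp
  moreover have "G differentiable (at u)" for u
    using *[unfolded differentiable_upto_def, rule_format, of "[]" u] by simp
  ultimately show "(\<forall>u. G differentiable (at u)) \<and> (\<forall>a. differentiable_upto n (partial_deriv a G))"
    by (auto simp: differentiable_upto_def)
next
  assume *: "(\<forall>u. G differentiable (at u)) \<and> (\<forall>a. differentiable_upto n (partial_deriv a G))"
  show "differentiable_upto (Suc n) G"
    unfolding differentiable_upto_def
  proof (intro allI impI)
    fix as :: "'a list" and u assume "length as \<le> Suc n"
    then show "foldr partial_deriv as G differentiable (at u)"
      using * by (cases as rule: rev_cases) (auto simp: differentiable_upto_def)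
  qed
qed

lemma differentiable_upto_mono: "differentiable_upto (Suc n) G \<Longrightarrow> differentiable_upto n G"
  by (auto simp: differentiable_upto_def)

lemma differentiable_upto_imp: "differentiable_upto n G \<Longrightarrow> G differentiable (at u)"
  unfolding differentiable_upto_def by (drule spec[of _ "[]"]) simp

lemma smooth_partial_deriv: "smooth G \<Longrightarrow> smooth (partial_deriv a G)"
  unfolding smooth_iff_upto using differentiable_upto_Suc by blast

lemma smooth_differentiable: "smooth G \<Longrightarrow> G differentiable (at u)"
  using differentiable_upto_imp[of 0] by (auto simp: smooth_iff_upto)

lemma partial_deriv_sum:
  assumes "\<And>i u. i \<in> I \<Longrightarrow> G i differentiable (at u)"
  shows "partial_deriv a (\<lambda>u. \<Sum>i\<in>I. G i u) = (\<lambda>u. \<Sum>i\<in>I. partial_deriv a (G i) u)"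
proof
  fix u
  have "((\<lambda>u. \<Sum>i\<in>I. G i u) has_derivative (\<lambda>h. \<Sum>i\<in>I. frechet_derivative (G i) (at u) h)) (at u)"
    by (intro has_derivative_sum) (use assms frechet_derivative_works in blast)
  then show "partial_deriv a (\<lambda>u. \<Sum>i\<in>I. G i u) u = (\<Sum>i\<in>I. partial_deriv a (G i) u)"
    by (subst partial_deriv_eq) (auto simp: partial_deriv_def)
qed

lemma differentiable_upto_sum:
  "(\<And>i. i \<in> I \<Longrightarrow> differentiable_upto n (G i)) \<Longrightarrow> finite I \<Longrightarrow> differentiable_upto n (\<lambda>u. \<Sum>i\<in>I. G i u)"
proof (induction n arbitrary: G)
  case 0
  then show ?case by (auto simp: differentiable_upto_0 intro!: differentiable_sum)
next
  case (Suc n)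
  have d: "G i differentiable (at u)" if "i \<in> I" for i u using Suc(2)[OF that] by (rule differentiable_upto_imp)
  then show ?case
    using Suc by (auto simp: differentiable_upto_Suc partial_deriv_sum intro!: differentiable_sum)
qed

lemma smooth_sum: "(\<And>i. i \<in> I \<Longrightarrow> smooth (G i)) \<Longrightarrow> finite I \<Longrightarrow> smooth (\<lambda>u. \<Sum>i\<in>I. G i u)"
  by (auto simp: smooth_iff_upto intro: differentiable_upto_sum)

lemma has_derivative_coord_scaleR:
  assumes "(p has_derivative p') (at u)" "(G has_derivative G') (at u)"
  shows "((\<lambda>u. (p u $ a) *\<^sub>R G u) has_derivative (\<lambda>h. (p u $ a) *\<^sub>R G' h + (p' h $ a) *\<^sub>R G u)) (at u)"
proof -
  have "((\<lambda>u. p u $ a) has_derivative (\<lambda>h. p' h $ a)) (at u)"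
    using bounded_linear.has_derivative[OF bounded_linear_vec_nth assms(1)] .
  from has_derivative_scaleR[OF this assms(2)] show ?thesis by simp
qed

lemma differentiable_upto_coord_scaleR:
  fixes p :: "real^'n::finite \<Rightarrow> real^'k::finite" and G :: "real^'n \<Rightarrow> real^'m::finite"
  shows "differentiable_upto n p \<Longrightarrow> differentiable_upto n G \<Longrightarrow> differentiable_upto n (\<lambda>u. (p u $ a) *\<^sub>R G u)"
proof (induction n arbitrary: p G)
  case 0
  then show ?case unfolding differentiable_upto_0 differentiable_def
    using has_derivative_coord_scaleR by blast
next
  case (Suc n)
  have d: "p differentiable (at u)" "G differentiable (at u)" for u
    using Suc(2,3) differentiable_upto_imp by auto
  have diff: "(\<lambda>u. (p u $ a) *\<^sub>R G u) differentiable (at u)" for u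
    using d[of u] unfolding differentiable_def using has_derivative_coord_scaleR by blast
  \<comment> \<open>The two terms of the product rule are written as a sum over the booleans, so
    that \<open>differentiable_upto_sum\<close> covers the addition.\<close>
  have pd: "partial_deriv b (\<lambda>u. (p u $ a) *\<^sub>R G u) =
      (\<lambda>u. \<Sum>i\<in>{True, False}. if i then (p u $ a) *\<^sub>R partial_deriv b G u else (partial_deriv b p u $ a) *\<^sub>R G u)" for b
  proof
    fix u
    have "(p has_derivative frechet_derivative p (at u)) (at u)" "(G has_derivative frechet_derivative G (at u)) (at u)"
      using d frechet_derivative_works by blast+
    from partial_deriv_eq[OF has_derivative_coord_scaleR[OF this]]
    show "partial_deriv b (\<lambda>u. (p u $ a) *\<^sub>R G u) u =
      (\<Sum>i\<in>{True, False}. if i then (p u $ a) *\<^sub>R partial_deriv b G u else (partial_deriv b p u $ a) *\<^sub>R G u)"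
      by (simp add: partial_deriv_def)
  qed
  have "differentiable_upto n (partial_deriv b (\<lambda>u. (p u $ a) *\<^sub>R G u))" for b
    unfolding pd
  proof (rule differentiable_upto_sum)
    fix i :: bool
    have "differentiable_upto n p" "differentiable_upto n G"
      "differentiable_upto n (partial_deriv b p)" "differentiable_upto n (partial_deriv b G)"
      using Suc(2,3) differentiable_upto_mono unfolding differentiable_upto_Suc by blast+
    then show "differentiable_upto n (\<lambda>u. if i then (p u $ a) *\<^sub>R partial_deriv b G u else (partial_deriv b p u $ a) *\<^sub>R G u)"
      using Suc(1)[of p "partial_deriv b G"] Suc(1)[of "partial_deriv b p" G] by (cases i) auto
  qed simp
  then show ?case using diff by (simp add: differentiable_upto_Suc)
qed

lemma smooth_coord_scaleR: "smooth p \<Longrightarrow> smooth G \<Longrightarrow> smooth (\<lambda>u. (p u $ a) *\<^sub>R G u)"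
  by (auto simp: smooth_iff_upto intro: differentiable_upto_coord_scaleR)

section \<open>Calculus of the multilinear derivatives\<close>

lemma higher_deriv_Nil [simp]: "higher_deriv G u [] = G u"
proof -
  have "{as::'a list. length as = 0} = {[]}" by auto
  then show ?thesis by (simp add: higher_deriv_def)
qed

text \<open>The last direction belongs to the innermost partial derivative. Lists of directions are
  therefore treated from the end, with \<open>G\<close> replaced by its partial derivatives.\<close>

lemma higher_deriv_snoc:
  fixes G :: "real^'n::finite \<Rightarrow> real^'m::finite"
  shows "higher_deriv G u (vs @ [v]) = (\<Sum>a\<in>UNIV. v $ a *\<^sub>R higher_deriv (partial_deriv a G) u vs)"
proof -
  have bij: "bij_betw (\<lambda>(a, as). as @ [a]) (UNIV \<times> {as::'n list. length as = length vs})
      {as. length as = length (vs @ [v])}"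
  proof (rule bij_betwI[where g = "\<lambda>as. (last as, butlast as)"])
    show "(\<lambda>as. (last as, butlast as)) \<in> {as. length as = length (vs @ [v])} \<rightarrow> UNIV \<times> {as::'n list. length as = length vs}"
      by auto
    fix as :: "'n list" assume "as \<in> {as. length as = length (vs @ [v])}"
    then have "as \<noteq> []" by auto
    then show "(case (last as, butlast as) of (a, as) \<Rightarrow> as @ [a]) = as" by simp
  qed auto
  have "higher_deriv G u (vs @ [v]) =
      (\<Sum>(a, as)\<in>UNIV \<times> {as. length as = length vs}.
        (\<Prod>i<length (vs @ [v]). (vs @ [v]) ! i $ ((as @ [a]) ! i)) *\<^sub>R foldr partial_deriv (as @ [a]) G u)"
    unfolding higher_deriv_def by (subst sum.reindex_bij_betw[OF bij, symmetric]) (simp add: case_prod_beta)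
  also have "\<dots> = (\<Sum>(a, as)\<in>UNIV \<times> {as. length as = length vs}.
        v $ a *\<^sub>R ((\<Prod>i<length vs. vs ! i $ (as ! i)) *\<^sub>R foldr partial_deriv as (partial_deriv a G) u))"
    by (intro sum.cong) (auto simp: nth_append mult.commute)
  also have "\<dots> = (\<Sum>a\<in>UNIV. v $ a *\<^sub>R higher_deriv (partial_deriv a G) u vs)"
    unfolding higher_deriv_def scaleR_sum_right by (subst sum.cartesian_product[symmetric]) simp
  finally show ?thesis .
qed

lemma smooth_higher_deriv:
  assumes "\<And>p. p \<in> set ps \<Longrightarrow> smooth p" "smooth F"
  shows "smooth (\<lambda>u. higher_deriv F u (map (\<lambda>p. p u) ps))"
  using assms
proof (induction ps arbitrary: F rule: rev_induct)
  case (snoc p ps)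
  then have "smooth (\<lambda>u. \<Sum>a\<in>UNIV. (p u $ a) *\<^sub>R higher_deriv (partial_deriv a F) u (map (\<lambda>p. p u) ps))"
    by (intro smooth_sum smooth_coord_scaleR) (auto intro: smooth_partial_deriv)
  then show ?case by (simp add: higher_deriv_snoc)
qed simp

text \<open>A further differentiation acts outermost, so its direction enters at the front, while
  the induction peels directions at the back; the two ends do not interact.\<close>

lemma has_derivative_higher_deriv:
  assumes "smooth F"
  shows "((\<lambda>u. higher_deriv F u vs) has_derivative (\<lambda>h. higher_deriv F u (h # vs))) (at u)"
  using assms
proof (induction vs arbitrary: F rule: rev_induct)
  case Nil
  have "higher_deriv F u [h] = (\<Sum>a\<in>UNIV. h $ a *\<^sub>R partial_deriv a F u)" for h
    using higher_deriv_snoc[of F u "[]" h] by simp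
  then show ?case using has_derivative_partial_deriv[OF smooth_differentiable[OF Nil]] by simp
next
  case (snoc v vs)
  have "((\<lambda>u. \<Sum>a\<in>UNIV. v $ a *\<^sub>R higher_deriv (partial_deriv a F) u vs) has_derivative
      (\<lambda>h. \<Sum>a\<in>UNIV. v $ a *\<^sub>R higher_deriv (partial_deriv a F) u (h # vs))) (at u)"
    by (intro has_derivative_sum has_derivative_scaleR_right snoc smooth_partial_deriv)
  then show ?case
    using higher_deriv_snoc[of F _ vs v] higher_deriv_snoc[of F u "_ # vs" v] by simp
qed

lemma higher_deriv_1_eqI: "(G has_derivative G') (at u) \<Longrightarrow> smooth G \<Longrightarrow> higher_deriv G u [h] = G' h"
  using has_derivative_unique[OF has_derivative_higher_deriv[of G "[]" u, unfolded higher_deriv_Nil], of G'] by metis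

lemma has_derivative_higher_deriv_1:
  assumes "smooth F" and p: "(p has_derivative p') (at u)"
  shows "((\<lambda>u. higher_deriv F u [p u]) has_derivative
     (\<lambda>h. higher_deriv F u [h, p u] + higher_deriv F u [p' h])) (at u)"
proof -
  note F = has_derivative_higher_deriv[OF smooth_partial_deriv[OF assms(1)], of _ "[]"]
  have "((\<lambda>u. \<Sum>a\<in>UNIV. p u $ a *\<^sub>R higher_deriv (partial_deriv a F) u []) has_derivative
     (\<lambda>h. \<Sum>a\<in>UNIV. p u $ a *\<^sub>R higher_deriv (partial_deriv a F) u [h] + p' h $ a *\<^sub>R higher_deriv (partial_deriv a F) u [])) (at u)"
    by (intro has_derivative_sum has_derivative_coord_scaleR p F)
  then show ?thesis
    using higher_deriv_snoc[of F _ "[]"] higher_deriv_snoc[of F u "[_]" "p u"] by (simp add: sum.distrib)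
qed

text \<open>Peeling the slot of \<open>q\<close> reduces this to the rule for one field, applied to
  every partial derivative of \<open>F\<close>.\<close>

lemma has_derivative_higher_deriv_2:
  assumes "smooth F" and p: "(p has_derivative p') (at u)" and q: "(q has_derivative q') (at u)"
  shows "((\<lambda>u. higher_deriv F u [p u, q u]) has_derivative
     (\<lambda>h. higher_deriv F u [h, p u, q u] + higher_deriv F u [p' h, q u] + higher_deriv F u [p u, q' h])) (at u)"
proof -
  note F = has_derivative_higher_deriv_1[OF smooth_partial_deriv[OF assms(1)] p]
  have "((\<lambda>u. \<Sum>a\<in>UNIV. q u $ a *\<^sub>R higher_deriv (partial_deriv a F) u [p u]) has_derivative
     (\<lambda>h. \<Sum>a\<in>UNIV. q u $ a *\<^sub>R (higher_deriv (partial_deriv a F) u [h, p u] + higher_deriv (partial_deriv a F) u [p' h])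
         + q' h $ a *\<^sub>R higher_deriv (partial_deriv a F) u [p u])) (at u)"
    by (intro has_derivative_sum has_derivative_coord_scaleR q F)
  then show ?thesis
    using higher_deriv_snoc[of F _ "[_]"] higher_deriv_snoc[of F u "[_, _]" "q u"]
    by (simp add: sum.distrib scaleR_add_right)
qed

lemma linear_higher_deriv: "linear (\<lambda>v. higher_deriv F u (vs @ v # ws))"
proof (induction ws arbitrary: F rule: rev_induct)
  case Nil
  show ?case unfolding higher_deriv_snoc
    by (intro linear_compose_sum ballI linearI) (simp_all add: scaleR_add_left)
next
  case (snoc w ws)
  have "linear (\<lambda>v. \<Sum>a\<in>UNIV. w $ a *\<^sub>R higher_deriv (partial_deriv a F) u (vs @ v # ws))"
    by (intro linear_compose_sum ballI linear_compose_scale_right snoc)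
  then show ?case using higher_deriv_snoc[of F u "vs @ _ # ws" w] by simp
qed

lemma continuous_on_smooth: "smooth G \<Longrightarrow> continuous_on S G"
  by (metis continuous_at_imp_continuous_on differentiable_imp_continuous_within smooth_differentiable)

lemma higher_deriv_bounded:
  fixes F :: "real^'n::finite \<Rightarrow> real^'m::finite"
  assumes "smooth F" "compact S"
  shows "\<exists>C\<ge>0. \<forall>u\<in>S. \<forall>vs. length vs = n \<longrightarrow> norm (higher_deriv F u vs) \<le> C * prod_list (map norm vs)"
  using assms(1)
proof (induction n arbitrary: F)
  case 0
  have "bounded (F ` S)"
    by (intro compact_imp_bounded compact_continuous_image continuous_on_smooth 0 assms)
  then obtain C where "\<forall>x\<in>F ` S. norm x \<le> C" unfolding bounded_iff by blast
  then show ?case by (intro exI[of _ "max 0 C"]) (auto simp: le_max_iff_disj)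
next
  case (Suc n)
  have "\<forall>a. \<exists>C\<ge>0. \<forall>u\<in>S. \<forall>vs. length vs = n \<longrightarrow>
      norm (higher_deriv (partial_deriv a F) u vs) \<le> C * prod_list (map norm vs)"
    using Suc smooth_partial_deriv by blast
  then obtain C where C: "\<And>a. C a \<ge> 0" "\<And>a u vs. u \<in> S \<Longrightarrow> length vs = n \<Longrightarrow>
      norm (higher_deriv (partial_deriv a F) u vs) \<le> C a * prod_list (map norm vs)"
    by metis
  show ?case
  proof (intro exI[of _ "\<Sum>a\<in>UNIV. C a"] conjI ballI allI impI sum_nonneg C(1))
    fix u and ws :: "(real^'n) list" assume u: "u \<in> S" and "length ws = Suc n"
    then obtain vs v where ws: "ws = vs @ [v]" "length vs = n"
      by (metis length_Suc_conv_rev)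
    have pos: "0 \<le> prod_list (map norm vs)" by (induction vs) auto
    have "norm (higher_deriv F u ws) \<le> (\<Sum>a\<in>UNIV. norm (v $ a *\<^sub>R higher_deriv (partial_deriv a F) u vs))"
      unfolding ws higher_deriv_snoc by (rule norm_sum)
    also have "\<dots> \<le> (\<Sum>a\<in>UNIV. norm v * (C a * prod_list (map norm vs)))"
    proof (intro sum_mono)
      fix a show "norm (v $ a *\<^sub>R higher_deriv (partial_deriv a F) u vs) \<le> norm v * (C a * prod_list (map norm vs))"
        using C(2)[OF u ws(2), of a] C(1)[of a] pos component_le_norm_cart[of v a]
        by (auto intro!: mult_mono)
    qed
    also have "\<dots> = (\<Sum>a\<in>UNIV. C a) * prod_list (map norm ws)"
      by (simp add: ws sum_distrib_left sum_distrib_right mult_ac)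
    finally show "norm (higher_deriv F u ws) \<le> (\<Sum>a\<in>UNIV. C a) * prod_list (map norm ws)" .
  qed
qed

section \<open>Taylor's theorem along segments\<close>

lemma higher_deriv_line_deriv:
  assumes "smooth G"
  shows "((\<lambda>s. higher_deriv G (u + s *\<^sub>R h) vs $ c) has_real_derivative
    (higher_deriv G (u + s *\<^sub>R h) (h # vs) $ c)) (at s)"
proof -
  have line: "((\<lambda>s. u + s *\<^sub>R h) has_derivative (\<lambda>r. r *\<^sub>R h)) (at s)"
    by (auto intro!: derivative_eq_intros)
  have "((\<lambda>s. higher_deriv G (u + s *\<^sub>R h) vs) has_derivative
      (\<lambda>r. higher_deriv G (u + s *\<^sub>R h) ((r *\<^sub>R h) # vs))) (at s)"
    using has_derivative_compose[OF line has_derivative_higher_deriv[OF assms, of vs]] .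
  moreover have "higher_deriv G (u + s *\<^sub>R h) ((r *\<^sub>R h) # vs) = r *\<^sub>R higher_deriv G (u + s *\<^sub>R h) (h # vs)" for r
    using linear_scale[OF linear_higher_deriv[of G _ "[]" vs]] by simp
  ultimately have "((\<lambda>s. higher_deriv G (u + s *\<^sub>R h) vs) has_derivative
      (\<lambda>r. r *\<^sub>R higher_deriv G (u + s *\<^sub>R h) (h # vs))) (at s)" by simp
  from bounded_linear.has_derivative[OF bounded_linear_vec_nth this, of c]
  show ?thesis unfolding has_field_derivative_def by (rule has_derivative_eq_rhs) (auto simp: mult.commute)
qed

text \<open>Maclaurin's formula has an intermediate point that depends on the component, so it is
  applied to each component along the segment from \<open>u\<close> to \<open>v\<close>. The segment
  stays in the convex ball, where the derivatives of order \<open>n\<close> are bounded;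
  \<open>CARD('m)\<close> comes from summing the components.\<close>

theorem higher_deriv_taylor:
  fixes G :: "real^'n::finite \<Rightarrow> real^'m::finite"
  assumes "smooth G"
  shows "\<exists>C\<ge>0. \<forall>u\<in>cball 0 R. \<forall>v\<in>cball 0 R.
    norm (G v - (\<Sum>m<n. (1 / fact m) *\<^sub>R higher_deriv G u (replicate m (v - u)))) \<le> C * norm (v - u) ^ n"
proof -
  obtain C where C: "C \<ge> 0" "\<And>u vs. u \<in> cball 0 R \<Longrightarrow> length vs = n \<Longrightarrow>
      norm (higher_deriv G u vs) \<le> C * prod_list (map norm vs)"
    using higher_deriv_bounded[OF assms compact_cball, of 0 R n] by blast
  show ?thesis
  proof (intro exI[of _ "real CARD('m) * C"] conjI ballI)
    fix u v :: "real^'n" assume uv: "u \<in> cball 0 R" "v \<in> cball 0 R"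
    let ?r = "G v - (\<Sum>m<n. (1 / fact m) *\<^sub>R higher_deriv G u (replicate m (v - u)))"
    have "\<bar>?r $ c\<bar> \<le> C * norm (v - u) ^ n" for c
    proof -
      let ?d = "\<lambda>m s. higher_deriv G (u + s *\<^sub>R (v - u)) (replicate m (v - u)) $ c"
      have "\<exists>t. 0 < t \<and> t \<le> 1 \<and> ?d 0 1 = (\<Sum>m<n. ?d m 0 / fact m * 1 ^ m) + ?d n t / fact n * 1 ^ n"
        by (rule Maclaurin2) (use higher_deriv_line_deriv[OF assms] in auto)
      then obtain t where t: "0 < t" "t \<le> 1" "?r $ c = ?d n t / fact n" by auto
      have "u + t *\<^sub>R (v - u) = (1 - t) *\<^sub>R u + t *\<^sub>R v" by (simp add: algebra_simps)
      also have "\<dots> \<in> cball 0 R" using uv t by (intro convexD[OF convex_cball]) auto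
      finally have "norm (higher_deriv G (u + t *\<^sub>R (v - u)) (replicate n (v - u))) \<le> C * norm (v - u) ^ n"
        using C(2)[of "u + t *\<^sub>R (v - u)" "replicate n (v - u)"] by simp
      then have "\<bar>?d n t\<bar> \<le> C * norm (v - u) ^ n" using component_le_norm_cart order_trans by blast
      moreover have "\<bar>?d n t / fact n\<bar> \<le> \<bar>?d n t\<bar>"
        using mult_left_mono[OF fact_ge_1[of n, where 'a = real], of "\<bar>?d n t\<bar>"] by (simp add: abs_divide divide_le_eq)
      ultimately show ?thesis unfolding t(3) by linarith
    qed
    then have "(\<Sum>c\<in>UNIV. \<bar>?r $ c\<bar>) \<le> (\<Sum>c\<in>(UNIV::'m set). C * norm (v - u) ^ n)" by (intro sum_mono)
    then show "norm ?r \<le> real CARD('m) * C * norm (v - u) ^ n"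
      using norm_le_l1_cart[of ?r] by simp
  qed (use C in simp)
qed

section \<open>Symmetry of the higher derivatives\<close>

lemma partial_deriv_higher: "smooth G \<Longrightarrow> partial_deriv a G u = higher_deriv G u [axis a 1]"
  using partial_deriv_eq[OF has_derivative_higher_deriv[of G "[]"]] by simp

text \<open>The mean value theorem is used twice, along \<open>a\<close> and then along
  \<open>b\<close>. The left side is symmetric in \<open>a\<close> and \<open>b\<close>, which makes
  the two mixed derivatives comparable.\<close>

lemma mixed_difference:
  fixes G :: "real^'n::finite \<Rightarrow> real^'m::finite"
  assumes "smooth G" "h > 0"
  shows "\<exists>p. norm (p - u) \<le> 2 * h \<and>
    (G (u + h *\<^sub>R axis a 1 + h *\<^sub>R axis b 1) - G (u + h *\<^sub>R axis a 1) - G (u + h *\<^sub>R axis b 1) + G u) $ c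
      = h * (h * (partial_deriv b (partial_deriv a G) p $ c))"
proof -
  let ?a = "axis a 1 :: real^'n" and ?b = "axis b 1 :: real^'n"
  have line: "((\<lambda>s. H (w + s *\<^sub>R axis i 1) $ c) has_real_derivative (partial_deriv i H (w + s *\<^sub>R axis i 1) $ c)) (at s)"
    if "smooth H" for H :: "real^'n::finite \<Rightarrow> real^'m::finite" and w i s
    using higher_deriv_line_deriv[OF that, of w "axis i 1" "[]" c s] by (simp add: partial_deriv_higher[OF that])
  have "\<exists>s. 0 < s \<and> s < h \<and>
     (G ((u + h *\<^sub>R ?b) + h *\<^sub>R ?a) $ c - G (u + h *\<^sub>R ?a) $ c) - (G ((u + h *\<^sub>R ?b) + 0 *\<^sub>R ?a) $ c - G (u + 0 *\<^sub>R ?a) $ c)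
     = (h - 0) * (partial_deriv a G ((u + h *\<^sub>R ?b) + s *\<^sub>R ?a) $ c - partial_deriv a G (u + s *\<^sub>R ?a) $ c)"
    by (rule MVT2) (use assms in \<open>auto intro!: DERIV_diff line\<close>)
  then obtain s where s: "0 < s" "s < h" and
    1: "(G (u + h *\<^sub>R ?a + h *\<^sub>R ?b) - G (u + h *\<^sub>R ?a) - G (u + h *\<^sub>R ?b) + G u) $ c
      = h * (partial_deriv a G ((u + s *\<^sub>R ?a) + h *\<^sub>R ?b) $ c - partial_deriv a G ((u + s *\<^sub>R ?a) + 0 *\<^sub>R ?b) $ c)"
    by (auto simp: algebra_simps)
  have "\<exists>r. 0 < r \<and> r < h \<and>
      partial_deriv a G ((u + s *\<^sub>R ?a) + h *\<^sub>R ?b) $ c - partial_deriv a G ((u + s *\<^sub>R ?a) + 0 *\<^sub>R ?b) $ c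
      = (h - 0) * (partial_deriv b (partial_deriv a G) ((u + s *\<^sub>R ?a) + r *\<^sub>R ?b) $ c)"
    by (rule MVT2) (use assms smooth_partial_deriv in \<open>auto intro!: line\<close>)
  then obtain r where r: "0 < r" "r < h" and
    2: "partial_deriv a G ((u + s *\<^sub>R ?a) + h *\<^sub>R ?b) $ c - partial_deriv a G ((u + s *\<^sub>R ?a) + 0 *\<^sub>R ?b) $ c
      = h * (partial_deriv b (partial_deriv a G) ((u + s *\<^sub>R ?a) + r *\<^sub>R ?b) $ c)" by auto
  have "norm (s *\<^sub>R ?a + r *\<^sub>R ?b) \<le> s + r"
    using norm_triangle_ineq[of "s *\<^sub>R ?a" "r *\<^sub>R ?b"] s r by simp
  then have "norm ((u + s *\<^sub>R ?a + r *\<^sub>R ?b) - u) \<le> 2 * h" using s r by (simp add: algebra_simps)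
  then show ?thesis using 1 2 by metis
qed

text \<open>Evaluated in both orders, the second difference gives each mixed derivative at some
  point within \<open>2 * h\<close> of \<open>u\<close>, and both are continuous.\<close>

lemma partial_deriv_commute:
  fixes G :: "real^'n::finite \<Rightarrow> real^'m::finite"
  assumes "smooth G"
  shows "partial_deriv a (partial_deriv b G) = partial_deriv b (partial_deriv a G)"
proof (rule ext, subst vec_eq_iff, rule allI)
  fix u c
  let ?A = "\<lambda>u. partial_deriv a (partial_deriv b G) u $ c" and ?B = "\<lambda>u. partial_deriv b (partial_deriv a G) u $ c"
  show "?A u = ?B u"
  proof (rule ccontr)
    assume ne: "?A u \<noteq> ?B u"
    define e where "e = \<bar>?A u - ?B u\<bar> / 2"
    have e: "e > 0" using ne by (simp add: e_def)
    have cont: "isCont (\<lambda>u. H u $ c) u" if "smooth H" for H :: "real^'n::finite \<Rightarrow> real^'m::finite"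
      using continuous_on_smooth[OF that, of UNIV] by (auto simp: continuous_on_eq_continuous_at intro!: continuous_intros)
    have "isCont ?A u" "isCont ?B u" using cont assms smooth_partial_deriv by blast+
    then obtain d1 d2 where d: "d1 > 0" "\<And>p. dist p u < d1 \<Longrightarrow> dist (?A p) (?A u) < e"
        "d2 > 0" "\<And>p. dist p u < d2 \<Longrightarrow> dist (?B p) (?B u) < e"
      using e unfolding continuous_at_eps_delta by metis
    \<comment> \<open>A third of the radius, so that points at distance at most \<open>2 * h\<close>
      are still inside.\<close>
    define h where "h = min d1 d2 / 3"
    have h: "h > 0" "2 * h < d1" "2 * h < d2" using d by (auto simp: h_def)
    obtain p where p: "norm (p - u) \<le> 2 * h"
      "(G (u + h *\<^sub>R axis a 1 + h *\<^sub>R axis b 1) - G (u + h *\<^sub>R axis a 1) - G (u + h *\<^sub>R axis b 1) + G u) $ c = h * (h * ?B p)"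
      using mixed_difference[OF assms h(1), of u a b c] by blast
    obtain q where q: "norm (q - u) \<le> 2 * h"
      "(G (u + h *\<^sub>R axis b 1 + h *\<^sub>R axis a 1) - G (u + h *\<^sub>R axis b 1) - G (u + h *\<^sub>R axis a 1) + G u) $ c = h * (h * ?A q)"
      using mixed_difference[OF assms h(1), of u b a c] by blast
    have "h * (h * ?A q) = h * (h * ?B p)" using p(2) q(2) by (auto simp: algebra_simps)
    then have "?A q = ?B p" using h by simp
    moreover have "\<bar>?A q - ?A u\<bar> < e" using d(2)[of q] q(1) h by (simp add: dist_norm)
    moreover have "\<bar>?B p - ?B u\<bar> < e" using d(4)[of p] p(1) h by (simp add: dist_norm)
    ultimately show False unfolding e_def by (simp add: abs_if split: if_splits)
  qed
qed

lemma higher_deriv_swap_last: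
  fixes G :: "real^'n::finite \<Rightarrow> real^'m::finite"
  assumes "smooth G"
  shows "higher_deriv G u (vs @ [v, w]) = higher_deriv G u (vs @ [w, v])"
proof -
  have "higher_deriv G u (vs @ [v, w]) = (\<Sum>a\<in>UNIV. w $ a *\<^sub>R (\<Sum>b\<in>UNIV. v $ b *\<^sub>R higher_deriv (partial_deriv b (partial_deriv a G)) u vs))" for v w
    using higher_deriv_snoc[of G u "vs @ [v]" w] by (simp add: higher_deriv_snoc)
  note eq = this[of v w] this[of w v]
  show ?thesis unfolding eq scaleR_sum_right
    by (subst sum.swap, intro sum.cong refl) (simp add: partial_deriv_commute[OF assms] mult.commute)
qed

text \<open>Swapping the first two of three directions reduces to swapping the last two once
  \<open>z\<close> is peeled off.\<close>

lemma higher_deriv_swap: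
  fixes G :: "real^'n::finite \<Rightarrow> real^'m::finite"
  assumes "smooth G"
  shows "higher_deriv G u [v, w] = higher_deriv G u [w, v]"
    "higher_deriv G u [v, w, z] = higher_deriv G u [w, v, z]"
    "higher_deriv G u [v, w, z] = higher_deriv G u [v, z, w]"
  using higher_deriv_swap_last[OF assms, of u "[]"] higher_deriv_swap_last[OF assms, of u "[v]"]
    higher_deriv_swap_last[OF smooth_partial_deriv[OF assms], of _ u "[]" v w]
    higher_deriv_snoc[of G u "[v, w]" z] higher_deriv_snoc[of G u "[w, v]" z] by simp_all

section \<open>Coproducts of forests of order at most three\<close>

lemma lookup_basis: "Poly_Mapping.lookup (basis a) b = (if a = b then 1 else 0)"
  by (simp add: basis_def lookup_single when_def)

text \<open>Supports change under addition; a common finite superset makes the sums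
  comparable.\<close>

lemma lin_ext_superset:
  assumes "finite S" "Poly_Mapping.keys x \<subseteq> S"
  shows "lin_ext g x = (\<Sum>a\<in>S. Poly_Mapping.lookup x a *\<^sub>R g a)"
  unfolding lin_ext_def using assms
  by (intro sum.mono_neutral_left) (auto simp: in_keys_iff)

lemma lin_ext_basis [simp]: "lin_ext g (basis a) = g a"
  by (simp add: lin_ext_def basis_def)

lemma linear_lin_ext:
  fixes g :: "'a \<Rightarrow> 'v::real_vector"
  shows "linear (lin_ext g)"
proof
  fix x y :: "'a \<Rightarrow>\<^sub>0 real"
  let ?S = "Poly_Mapping.keys x \<union> Poly_Mapping.keys y"
  have "Poly_Mapping.keys (x + y) \<subseteq> ?S" by (rule keys_add)
  then show "lin_ext g (x + y) = lin_ext g x + lin_ext g y"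
    by (simp add: lin_ext_superset[of ?S] lookup_add scaleR_add_left sum.distrib)
next
  fix r :: real and x :: "'a \<Rightarrow>\<^sub>0 real"
  have "Poly_Mapping.keys (r *\<^sub>R x) \<subseteq> Poly_Mapping.keys x"
    by (auto simp: in_keys_iff)
  then show "lin_ext g (r *\<^sub>R x) = r *\<^sub>R lin_ext g x"
    by (simp add: lin_ext_superset[of "Poly_Mapping.keys x"] scaleR_sum_right)
qed

lemmas lin_ext_add = linear_add[OF linear_lin_ext]
  and lin_ext_diff = linear_diff[OF linear_lin_ext]

lemma lookup_sum_scaleR_basis:
  "finite S \<Longrightarrow> Poly_Mapping.lookup (\<Sum>a\<in>S. c a *\<^sub>R basis a) b = (if b \<in> S then c b else 0)"
  by (simp add: lookup_sum lookup_basis sum.delta if_distrib cong: if_cong)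

lemma lin_ext_id: "lin_ext basis x = x"
  by (rule poly_mapping_eqI) (simp add: lin_ext_def lookup_sum_scaleR_basis in_keys_iff)

lemma bilin_ext_basis_left: "bilin_ext g (basis a) y = lin_ext (g a) y"
  by (simp add: bilin_ext_def)

text \<open>The diagonal kernel collapses the double sum, so the pairing can be computed term by
  term on a coproduct.\<close>

lemma pairing_lookup: "pairing x y = lin_ext (Poly_Mapping.lookup x) y"
proof -
  let ?S = "Poly_Mapping.keys x \<union> Poly_Mapping.keys y"
  have "pairing x y = (\<Sum>a\<in>?S. \<Sum>b\<in>?S. Poly_Mapping.lookup x a * (Poly_Mapping.lookup y b * (if a = b then 1 else 0)))"
    by (simp add: pairing_def bilin_ext_def lin_ext_superset[of ?S] sum_distrib_left)
  also have "\<dots> = (\<Sum>a\<in>?S. Poly_Mapping.lookup x a * Poly_Mapping.lookup y a)"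
    by (intro sum.cong refl) (simp add: sum.delta' if_distrib cong: if_cong)
  finally show ?thesis by (simp add: lin_ext_superset[of ?S] mult.commute)
qed

lemma pairing_basis [simp]: "pairing x (basis a) = Poly_Mapping.lookup x a"
  by (simp add: pairing_lookup)

lemma pairing_basis_left [simp]: "pairing (basis a) y = Poly_Mapping.lookup y a"
  by (simp add: pairing_def bilin_ext_basis_left lin_ext_def in_keys_iff
      sum.delta' if_distrib cong: if_cong)

lemma pairing_add: "pairing x (y + z) = pairing x y + pairing x z"
  by (simp add: pairing_lookup lin_ext_add)

lemma pairing_diff: "pairing x (y - z) = pairing x y - pairing x z"
  by (simp add: pairing_lookup lin_ext_diff)

lemma vpairing_basis: "vpairing (basis a) y = (\<chi> c. Poly_Mapping.lookup (y $ c) a)"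
  by (simp add: vpairing_def)

lemma tensor_basis [simp]: "tensor (basis a) (basis c) = basis (a, c)"
  by (simp add: tensor_def bilin_ext_basis_left)

lemma lookup_tensor:
  "Poly_Mapping.lookup (tensor x y) (a, c) = Poly_Mapping.lookup x a * Poly_Mapping.lookup y c"
proof -
  have "tensor x y = (\<Sum>a\<in>Poly_Mapping.keys x. \<Sum>c\<in>Poly_Mapping.keys y.
      (Poly_Mapping.lookup x a * Poly_Mapping.lookup y c) *\<^sub>R basis (a, c))"
    by (simp add: tensor_def bilin_ext_def lin_ext_def scaleR_sum_right)
  also have "\<dots> = (\<Sum>p\<in>Poly_Mapping.keys x \<times> Poly_Mapping.keys y.
      (Poly_Mapping.lookup x (fst p) * Poly_Mapping.lookup y (snd p)) *\<^sub>R basis p)"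
    by (simp add: sum.cartesian_product case_prod_beta)
  finally show ?thesis by (auto simp: lookup_sum_scaleR_basis in_keys_iff)
qed

section \<open>Small forests, their shuffles and coproducts\<close>

lemma nodes_simps [simp]: "nodes [] = 0" "nodes (Node b \<tau> # \<rho>) = Suc (nodes \<tau> + nodes \<rho>)"
  by (simp_all add: nodes_def)

lemma nodes_append: "nodes (\<sigma> @ \<tau>) = nodes \<sigma> + nodes \<tau>"
  by (simp add: nodes_def)

text \<open>A sum over an infinite set is 0 by convention; \<open>star\<close> and the rough germs
  have their intended meaning because of this finiteness.\<close>

lemma finite_forests_upto: "finite (forests_upto n :: 'b::finite forest set)"
proof (induction n)
  case 0
  have "\<tau> = []" if "nodes \<tau> = 0" for \<tau> :: "'b forest"
  proof (cases \<tau>)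
    case (Cons t \<rho>) then show ?thesis using that by (cases t) auto
  qed
  then have "forests_upto 0 \<subseteq> {[] :: 'b forest}" by (auto simp: forests_upto_def)
  then show ?case using finite_subset by blast
next
  case (Suc n)
  have "forests_upto (Suc n) \<subseteq> insert []
      ((\<lambda>((b, \<tau>), \<rho>). Node b \<tau> # \<rho>) ` (((UNIV :: 'b set) \<times> forests_upto n) \<times> forests_upto n))"
  proof
    fix \<sigma> :: "'b forest" assume *: "\<sigma> \<in> forests_upto (Suc n)"
    show "\<sigma> \<in> insert [] ((\<lambda>((b, \<tau>), \<rho>). Node b \<tau> # \<rho>) ` ((UNIV \<times> forests_upto n) \<times> forests_upto n))"
    proof (cases \<sigma>)
      case (Cons t \<rho>)
      obtain b \<tau> where t: "t = Node b \<tau>" by (cases t)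
      have "((b, \<tau>), \<rho>) \<in> (UNIV \<times> forests_upto n) \<times> forests_upto n"
        using * by (simp add: Cons t forests_upto_def)
      then show ?thesis unfolding Cons t by force
    qed simp
  qed
  then show ?case by (rule finite_subset) (simp add: Suc)
qed

lemma lookup_star:
  "Poly_Mapping.lookup (star N x y) \<tau> =
     (if nodes \<tau> \<le> N then pairing (tensor x y) (coprod \<tau>) else 0)"
  unfolding star_def
  by (simp add: lookup_sum_scaleR_basis[OF finite_forests_upto]) (simp add: forests_upto_def)

lemma shuffle_basis: "shuffle (basis \<sigma>) (basis \<tau>) = shuffle_words \<sigma> \<tau>"
  by (simp add: shuffle_def bilin_ext_basis_left)

lemma shuffle_words_Nil_right [simp]: "shuffle_words u [] = basis u"
  by (cases u) auto

lemma shuffle_words_singletons: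
  "shuffle_words [a] [b] = basis [a, b] + basis [b, a]"
  "shuffle_words [a] [b, c] = basis [a, b, c] + (basis [b, a, c] + basis [b, c, a])"
  by (simp_all add: lin_ext_add)

lemma shuffle_concat_unit: "shuffle_concat (basis ([], [])) z = z"
proof -
  have "(\<lambda>(\<sigma>2, \<tau>2). tensor (shuffle_words [] \<sigma>2) (basis ([] @ \<tau>2))) = basis"
    by auto
  then show ?thesis by (simp add: shuffle_concat_def bilin_ext_basis_left lin_ext_id)
qed

text \<open>For a single tree the forest to its left is empty and contributes the unit, so the
  recursion merely regrafts the right factors. A genuine product occurs only in
  \<open>coprod_leaf_leaf\<close>.\<close>

lemma coprod_graft:
  "coprod (graft b \<tau>) = basis (graft b \<tau>, []) + lin_ext (\<lambda>(\<sigma>, \<rho>). basis (\<sigma>, graft b \<rho>)) (coprod \<tau>)"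
  using coprod.simps(2)[of "[]" b \<tau>] by (simp add: shuffle_concat_unit)

lemma coprod_leaf_leaf:
  "coprod [Node k [], Node j []] =
     basis ([Node k [], Node j []], []) + (basis (leaf k, leaf j) + basis ([], [Node k [], Node j []]))"
  using coprod.simps(2)[of "[Node k []]" j "[]"]
  by (simp add: coprod_graft shuffle_concat_def bilin_ext_def lin_ext_add)

text \<open>Two is \<open>N - 1\<close>, the range of controlled coefficients: the empty forest, a
  leaf, a ladder, or two leaves.\<close>

lemma sum_forests_upto_2:
  fixes \<phi> :: "'b::finite forest \<Rightarrow> 'v::comm_monoid_add"
  shows "(\<Sum>\<tau>\<in>forests_upto 2. \<phi> \<tau>) = \<phi> [] + (\<Sum>k\<in>UNIV. \<phi> (leaf k))
    + (\<Sum>j\<in>UNIV. \<Sum>k\<in>UNIV. \<phi> (graft j (leaf k))) + (\<Sum>j\<in>UNIV. \<Sum>k\<in>UNIV. \<phi> (leaf k @ leaf j))"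
proof -
  let ?A = "range (\<lambda>k::'b. leaf k)" and ?B = "range (\<lambda>(j::'b, k). graft j (leaf k))"
    and ?C = "range (\<lambda>(j::'b, k). leaf k @ leaf j)"
  have nodes0: "nodes \<tau> = 0 \<longleftrightarrow> \<tau> = []" for \<tau> :: "'b forest"
  proof (cases \<tau>)
    case (Cons t \<rho>) then show ?thesis by (cases t) auto
  qed simp
  have nodes1: "nodes \<tau> = Suc 0 \<longleftrightarrow> (\<exists>k. \<tau> = leaf k)" for \<tau> :: "'b forest"
  proof (cases \<tau>)
    case (Cons t \<rho>) then show ?thesis by (cases t) (auto simp: nodes0)
  qed simp
  have "\<tau> \<in> insert [] (?A \<union> ?B \<union> ?C)" if "nodes \<tau> \<le> 2" for \<tau> :: "'b forest"
  proof (cases \<tau>)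
    case (Cons t \<rho>)
    obtain b \<sigma> where t: "t = Node b \<sigma>" by (cases t)
    from that consider "nodes \<sigma> = 0" "nodes \<rho> = 0" | "nodes \<sigma> = Suc 0" "nodes \<rho> = 0" | "nodes \<sigma> = 0" "nodes \<rho> = Suc 0"
      by (fastforce simp: Cons t)
    then show ?thesis
      by cases (auto simp: Cons t nodes0 nodes1)
  qed simp
  then have eq: "forests_upto 2 = insert [] (?A \<union> ?B \<union> ?C)" by (auto simp: forests_upto_def)
  have "sum \<phi> (?A \<union> ?B \<union> ?C) = sum \<phi> (?A \<union> ?B) + sum \<phi> ?C"
    by (rule sum.union_disjoint) auto
  also have "sum \<phi> (?A \<union> ?B) = sum \<phi> ?A + sum \<phi> ?B"
    by (rule sum.union_disjoint) auto
  finally have "(\<Sum>\<tau>\<in>forests_upto 2. \<phi> \<tau>) = \<phi> [] + (sum \<phi> ?A + sum \<phi> ?B + sum \<phi> ?C)"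
    unfolding eq by (subst sum.insert) auto
  also have "sum \<phi> ?A = (\<Sum>k\<in>UNIV. \<phi> (leaf k))"
    by (subst sum.reindex) (auto simp: inj_def)
  also have "sum \<phi> ?B = (\<Sum>j\<in>UNIV. \<Sum>k\<in>UNIV. \<phi> (graft j (leaf k)))"
    by (subst sum.reindex) (auto simp: inj_def sum.cartesian_product case_prod_beta)
  also have "sum \<phi> ?C = (\<Sum>j\<in>UNIV. \<Sum>k\<in>UNIV. \<phi> (leaf k @ leaf j))"
    by (subst sum.reindex) (auto simp: inj_def sum.cartesian_product case_prod_beta)
  finally show ?thesis by (simp add: add.assoc)
qed

lemma vpairing_lift_path:
  "nodes \<tau> \<le> M \<Longrightarrow> vpairing (basis \<tau>) (lift_path M G y) = lift_coeff M G y \<tau>"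
  by (simp add: vpairing_basis lift_path_def lookup_sum_scaleR_basis[OF finite_forests_upto])
    (simp add: forests_upto_def)

lemma higher_deriv_0 [simp]: "higher_deriv G u [0] = 0"
  using linear_0[OF linear_higher_deriv[of G u "[]" "[]"]] by simp

lemma factorizations_1: "\<tau> \<noteq> [] \<Longrightarrow> {\<tau>s. length \<tau>s = Suc 0 \<and> [] \<notin> set \<tau>s \<and> concat \<tau>s = \<tau>} = {[\<tau>]}"
  by (auto simp: length_Suc_conv)

lemma factorizations_2:
  "{\<tau>s. length \<tau>s = 2 \<and> [] \<notin> set \<tau>s \<and> concat \<tau>s = [a]} = {}"
  "{\<tau>s. length \<tau>s = 2 \<and> [] \<notin> set \<tau>s \<and> concat \<tau>s = [a, b]} = {[[a], [b]]}"
  by (auto simp: length_Suc_conv numeral_2_eq_2 append_eq_Cons_conv)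

text \<open>A single tree factors only trivially, two trees also into two factors; hence the second
  derivative appears for \<open>[a, b]\<close> alone.\<close>

lemma lift_coeff_2:
  "lift_coeff 2 G y [] = G (vpairing (basis []) y)"
  "lift_coeff 2 G y [a] = higher_deriv G (vpairing (basis []) y) [vpairing (basis [a]) y]"
  "lift_coeff 2 G y [a, b] = higher_deriv G (vpairing (basis []) y) [vpairing (basis [a, b]) y]
     + higher_deriv G (vpairing (basis []) y) [vpairing (basis [a]) y, vpairing (basis [b]) y]"
proof -
  have eq: "{Suc 0..2} = {Suc 0, 2}" by auto
  show "lift_coeff 2 G y [] = G (vpairing (basis []) y)"
    "lift_coeff 2 G y [a] = higher_deriv G (vpairing (basis []) y) [vpairing (basis [a]) y]"
    "lift_coeff 2 G y [a, b] = higher_deriv G (vpairing (basis []) y) [vpairing (basis [a, b]) y]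
     + higher_deriv G (vpairing (basis []) y) [vpairing (basis [a]) y, vpairing (basis [b]) y]"
    by (simp_all add: lift_coeff_def Let_def eq factorizations_1 factorizations_2)
qed

lemma embed_forest_simps [simp]:
  "embed_forest [] = []"
  "embed_forest (Node b \<tau> # \<rho>) = Node (Inl b) (embed_forest \<tau>) # embed_forest \<rho>"
  by (simp_all add: embed_forest_def)

lemma inj_embed_forest: "inj embed_forest"
  unfolding embed_forest_def by (simp add: ptree.inj_map)

lemma nodes_embed_forest [simp]: "nodes (embed_forest \<tau>) = nodes \<tau>"
proof -
  have "tree_nodes (map_ptree Inl t :: 'a bletter ptree) = tree_nodes t" for t :: "'a ptree"
  proof (induction t)
    case (Node b \<tau>)
    then show ?case by (simp add: comp_def cong: map_cong)
  qed
  then show ?thesis by (simp add: nodes_def embed_forest_def comp_def)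
qed

lemma lookup_extend_path:
  "Poly_Mapping.lookup (extend_path y $ c) (embed_forest \<tau>) = Poly_Mapping.lookup (y $ c) \<tau>"
  "\<sigma> \<notin> range embed_forest \<Longrightarrow> Poly_Mapping.lookup (extend_path y $ c) \<sigma> = 0"
  by (simp add: extend_path_def lin_ext_def lookup_sum lookup_basis inj_eq[OF inj_embed_forest] in_keys_iff
      if_distrib sum.delta cong: if_cong)
    (auto simp: extend_path_def lin_ext_def lookup_sum lookup_basis intro!: sum.neutral)

lemma vpairing_extend_path:
  "vpairing (basis (embed_forest \<tau>)) (extend_path y) = vpairing (basis \<tau>) y"
  "\<sigma> \<notin> range embed_forest \<Longrightarrow> vpairing (basis \<sigma>) (extend_path y) = 0"
  by (simp_all add: vpairing_basis lookup_extend_path vec_eq_iff)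

text \<open>Forests with a bracket letter have coefficient 0 and the embedding preserves the number
  of vertices, so the sum shrinks to the small alphabet; only the root letter \<open>b\<close> is
  taken from the large one.\<close>

lemma rough_germ_extend_path:
  fixes Y :: "real \<Rightarrow> ('d::finite forest \<Rightarrow>\<^sub>0 real)^'n"
  shows "rough_germ N X (\<lambda>r. extend_path (Y r)) b u v =
    (\<Sum>\<tau>\<in>forests_upto (N - 1). Poly_Mapping.lookup (X u v) (graft b (embed_forest \<tau>)) *\<^sub>R vpairing (basis \<tau>) (Y u))"
proof -
  have "rough_germ N X (\<lambda>r. extend_path (Y r)) b u v = (\<Sum>\<tau>\<in>embed_forest ` forests_upto (N - 1).
        pairing (X u v) (basis (graft b \<tau>)) *\<^sub>R vpairing (basis \<tau>) (extend_path (Y u)))"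
    unfolding rough_germ_def
  proof (rule sum.mono_neutral_right[OF finite_forests_upto])
    show "embed_forest ` forests_upto (N - 1) \<subseteq> forests_upto (N - 1)" by (auto simp: forests_upto_def)
    show "\<forall>\<tau>\<in>forests_upto (N - 1) - embed_forest ` forests_upto (N - 1).
       pairing (X u v) (basis (graft b \<tau>)) *\<^sub>R vpairing (basis \<tau>) (extend_path (Y u)) = 0"
    proof
      fix \<tau> :: "'d bletter forest"
      assume "\<tau> \<in> forests_upto (N - 1) - embed_forest ` forests_upto (N - 1)"
      then have "\<tau> \<notin> range embed_forest" by (auto simp: forests_upto_def)
      then show "pairing (X u v) (basis (graft b \<tau>)) *\<^sub>R vpairing (basis \<tau>) (extend_path (Y u)) = 0"
        by (simp add: vpairing_extend_path)
    qed
  qed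
  then show ?thesis
    by (simp add: sum.reindex[OF inj_on_subset[OF inj_embed_forest]] vpairing_extend_path)
qed

section \<open>Germs of a given order\<close>

text \<open>A Landau symbol, uniform on the interval from 0 to \<open>T\<close>, with the constant
  hidden. Only \<open>u < v\<close> is asked for, as partition intervals are ordered; reversed
  integrals are derived at the end.\<close>

definition germ_order :: "real \<Rightarrow> real \<Rightarrow> (real \<Rightarrow> real \<Rightarrow> 'v::real_normed_vector) \<Rightarrow> bool" where
  "germ_order T \<beta> R \<longleftrightarrow>
     (\<exists>C. \<forall>u v. 0 \<le> u \<longrightarrow> u < v \<longrightarrow> v \<le> T \<longrightarrow> norm (R u v) \<le> C * (v - u) powr \<beta>)"

lemma germ_orderI:
  "(\<And>u v. 0 \<le> u \<Longrightarrow> u < v \<Longrightarrow> v \<le> T \<Longrightarrow> norm (R u v) \<le> C * (v - u) powr \<beta>) \<Longrightarrow> germ_order T \<beta> R"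
  unfolding germ_order_def by blast

lemma germ_orderE:
  assumes "germ_order T \<beta> R"
  obtains C where "C \<ge> 0" "\<And>u v. 0 \<le> u \<Longrightarrow> u < v \<Longrightarrow> v \<le> T \<Longrightarrow> norm (R u v) \<le> C * (v - u) powr \<beta>"
proof -
  obtain C where C: "\<And>u v. 0 \<le> u \<Longrightarrow> u < v \<Longrightarrow> v \<le> T \<Longrightarrow> norm (R u v) \<le> C * (v - u) powr \<beta>"
    using assms unfolding germ_order_def by blast
  have "norm (R u v) \<le> max 0 C * (v - u) powr \<beta>" if "0 \<le> u" "u < v" "v \<le> T" for u v
    using C[OF that] by (rule order_trans) (auto intro: mult_right_mono)
  then show thesis using that[of "max 0 C"] by simp
qed

lemma germ_order_cong:
  "germ_order T \<beta> R \<Longrightarrow> (\<And>u v. 0 \<le> u \<Longrightarrow> u < v \<Longrightarrow> v \<le> T \<Longrightarrow> S u v = R u v) \<Longrightarrow> germ_order T \<beta> S"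
  unfolding germ_order_def by metis

lemma germ_order_dominated:
  assumes "germ_order T \<beta> R" "\<And>u v. 0 \<le> u \<Longrightarrow> u < v \<Longrightarrow> v \<le> T \<Longrightarrow> norm (S u v) \<le> M * norm (R u v)"
  shows "germ_order T \<beta> S"
proof -
  obtain C where C: "C \<ge> 0" "\<And>u v. 0 \<le> u \<Longrightarrow> u < v \<Longrightarrow> v \<le> T \<Longrightarrow> norm (R u v) \<le> C * (v - u) powr \<beta>"
    using germ_orderE[OF assms(1)] by blast
  show ?thesis
  proof (rule germ_orderI)
    fix u v assume uv: "0 \<le> u" "u < v" "v \<le> T"
    have "norm (S u v) \<le> \<bar>M\<bar> * norm (R u v)"
      using assms(2)[OF uv] by (rule order_trans) (auto intro: mult_right_mono)
    also have "\<dots> \<le> \<bar>M\<bar> * (C * (v - u) powr \<beta>)" using C(2)[OF uv] by (intro mult_left_mono) auto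
    finally show "norm (S u v) \<le> (\<bar>M\<bar> * C) * (v - u) powr \<beta>" by simp
  qed
qed

text \<open>On a bounded interval surplus powers of \<open>v - u\<close> are absorbed into the
  constant as powers of \<open>T\<close>.\<close>

lemma germ_order_mono:
  assumes "germ_order T \<beta> R" "\<beta>' \<le> \<beta>"
  shows "germ_order T \<beta>' R"
proof -
  obtain C where C: "C \<ge> 0" "\<And>u v. 0 \<le> u \<Longrightarrow> u < v \<Longrightarrow> v \<le> T \<Longrightarrow> norm (R u v) \<le> C * (v - u) powr \<beta>"
    using germ_orderE[OF assms(1)] by blast
  show ?thesis
  proof (rule germ_orderI)
    fix u v assume uv: "0 \<le> u" "u < v" "v \<le> T"
    have "(v - u) powr \<beta> = (v - u) powr (\<beta> - \<beta>') * (v - u) powr \<beta>'" by (simp add: powr_add[symmetric])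
    also have "\<dots> \<le> T powr (\<beta> - \<beta>') * (v - u) powr \<beta>'"
      using uv assms(2) by (intro mult_right_mono powr_mono2) auto
    finally have "C * (v - u) powr \<beta> \<le> C * (T powr (\<beta> - \<beta>') * (v - u) powr \<beta>')"
      using C(1) by (rule mult_left_mono)
    then show "norm (R u v) \<le> (C * T powr (\<beta> - \<beta>')) * (v - u) powr \<beta>'" using C(2)[OF uv] by simp
  qed
qed

lemma germ_order_zero [simp]: "germ_order T \<beta> (\<lambda>u v. 0)"
  by (rule germ_orderI[of _ _ 0]) simp

lemma germ_order_const: "germ_order T 0 (\<lambda>u v. c)"
  by (rule germ_orderI[of _ _ "norm c"]) simp

lemma germ_order_add:
  assumes "germ_order T \<beta> R" "germ_order T \<beta> S"
  shows "germ_order T \<beta> (\<lambda>u v. R u v + S u v)"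
proof -
  obtain C where C: "\<And>u v. 0 \<le> u \<Longrightarrow> u < v \<Longrightarrow> v \<le> T \<Longrightarrow> norm (R u v) \<le> C * (v - u) powr \<beta>"
    using assms(1) unfolding germ_order_def by blast
  obtain D where D: "\<And>u v. 0 \<le> u \<Longrightarrow> u < v \<Longrightarrow> v \<le> T \<Longrightarrow> norm (S u v) \<le> D * (v - u) powr \<beta>"
    using assms(2) unfolding germ_order_def by blast
  show ?thesis
    by (rule germ_orderI[of _ _ "C + D"], rule norm_triangle_le)
      (use C D in \<open>auto simp: distrib_right intro: add_mono\<close>)
qed

lemma germ_order_minus: "germ_order T \<beta> R \<Longrightarrow> germ_order T \<beta> (\<lambda>u v. - R u v)"
  by (simp add: germ_order_def)

lemma germ_order_diff:
  "germ_order T \<beta> R \<Longrightarrow> germ_order T \<beta> S \<Longrightarrow> germ_order T \<beta> (\<lambda>u v. R u v - S u v)"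
  using germ_order_add[OF _ germ_order_minus] by fastforce

lemma germ_order_sum:
  "(\<And>i. i \<in> I \<Longrightarrow> germ_order T \<beta> (R i)) \<Longrightarrow> germ_order T \<beta> (\<lambda>u v. \<Sum>i\<in>I. R i u v)"
  by (induction I rule: infinite_finite_induct) (auto intro: germ_order_add)

lemma germ_order_prod:
  assumes "germ_order T \<beta> R" "germ_order T \<gamma> S"
    "\<And>u v. 0 \<le> u \<Longrightarrow> u < v \<Longrightarrow> v \<le> T \<Longrightarrow> norm (Q u v) \<le> M * (norm (R u v) * norm (S u v))"
  shows "germ_order T (\<beta> + \<gamma>) Q"
proof -
  obtain C where C: "C \<ge> 0" "\<And>u v. 0 \<le> u \<Longrightarrow> u < v \<Longrightarrow> v \<le> T \<Longrightarrow> norm (R u v) \<le> C * (v - u) powr \<beta>"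
    using germ_orderE[OF assms(1)] by blast
  obtain D where D: "D \<ge> 0" "\<And>u v. 0 \<le> u \<Longrightarrow> u < v \<Longrightarrow> v \<le> T \<Longrightarrow> norm (S u v) \<le> D * (v - u) powr \<gamma>"
    using germ_orderE[OF assms(2)] by blast
  have "germ_order T (\<beta> + \<gamma>) (\<lambda>u v. norm (R u v) * norm (S u v))"
  proof (rule germ_orderI)
    fix u v assume uv: "0 \<le> u" "u < v" "v \<le> T"
    have "norm (R u v) * norm (S u v) \<le> (C * (v - u) powr \<beta>) * (D * (v - u) powr \<gamma>)"
      using C D uv by (intro mult_mono) auto
    then show "norm (norm (R u v) * norm (S u v)) \<le> (C * D) * (v - u) powr (\<beta> + \<gamma>)"
      by (simp add: powr_add mult_ac)
  qed
  then show ?thesis by (rule germ_order_dominated) (use assms(3) in auto)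
qed

lemma germ_order_scaleR:
  "germ_order T \<beta> a \<Longrightarrow> germ_order T \<gamma> R \<Longrightarrow> germ_order T (\<beta> + \<gamma>) (\<lambda>u v. a u v *\<^sub>R R u v)"
  by (rule germ_order_prod[of T \<beta> a \<gamma> R _ 1]) auto

lemma germ_order_scaleR_const: "germ_order T \<beta> R \<Longrightarrow> germ_order T \<beta> (\<lambda>u v. c *\<^sub>R R u v)"
  by (rule germ_order_dominated[of T \<beta> R _ "\<bar>c\<bar>"]) auto

lemma germ_order_norm_power:
  "germ_order T \<beta> R \<Longrightarrow> germ_order T (real n * \<beta>) (\<lambda>u v. norm (R u v) ^ n)"
proof (induction n)
  case 0
  then show ?case using germ_order_const[of T "1::real"] by simp
next
  case (Suc n)
  have "germ_order T (\<beta> + real n * \<beta>) (\<lambda>u v. norm (R u v) ^ Suc n)"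
    by (rule germ_order_prod[OF Suc(2) Suc(1)[OF Suc(2)], of _ 1]) simp
  then show ?case by (simp add: algebra_simps)
qed

section \<open>Defects of germs and uniform sewing\<close>

definition defect_order :: "real \<Rightarrow> real \<Rightarrow> (real \<Rightarrow> real \<Rightarrow> real \<Rightarrow> 'v::real_normed_vector) \<Rightarrow> bool" where
  "defect_order T \<theta> D \<longleftrightarrow> (\<exists>C. \<forall>u m v. 0 \<le> u \<longrightarrow> u < m \<longrightarrow> m < v \<longrightarrow> v \<le> T \<longrightarrow>
     norm (D u m v) \<le> C * (v - u) powr \<theta>)"

lemma defect_order_zero [simp]: "defect_order T \<theta> (\<lambda>u m v. 0)"
  unfolding defect_order_def by (auto intro: exI[of _ 0])

lemma defect_order_add:
  assumes "defect_order T \<theta> D" "defect_order T \<theta> E"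
  shows "defect_order T \<theta> (\<lambda>u m v. D u m v + E u m v)"
proof -
  obtain C where C: "\<And>u m v. 0 \<le> u \<Longrightarrow> u < m \<Longrightarrow> m < v \<Longrightarrow> v \<le> T \<Longrightarrow> norm (D u m v) \<le> C * (v - u) powr \<theta>"
    using assms(1) unfolding defect_order_def by blast
  obtain C' where C': "\<And>u m v. 0 \<le> u \<Longrightarrow> u < m \<Longrightarrow> m < v \<Longrightarrow> v \<le> T \<Longrightarrow> norm (E u m v) \<le> C' * (v - u) powr \<theta>"
    using assms(2) unfolding defect_order_def by blast
  show ?thesis unfolding defect_order_def
    by (rule exI[of _ "C + C'"]) (use C C' in \<open>auto simp: distrib_right intro!: norm_triangle_le add_mono\<close>)
qed

lemma defect_order_minus: "defect_order T \<theta> D \<Longrightarrow> defect_order T \<theta> (\<lambda>u m v. - D u m v)"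
  by (simp add: defect_order_def)

lemma defect_order_sum:
  "(\<And>i. i \<in> I \<Longrightarrow> defect_order T \<theta> (D i)) \<Longrightarrow> defect_order T \<theta> (\<lambda>u m v. \<Sum>i\<in>I. D i u m v)"
  by (induction I rule: infinite_finite_induct) (auto intro: defect_order_add)

lemma defect_order_cong:
  "defect_order T \<theta> D \<Longrightarrow> (\<And>u m v. 0 \<le> u \<Longrightarrow> u < m \<Longrightarrow> m < v \<Longrightarrow> v \<le> T \<Longrightarrow> E u m v = D u m v) \<Longrightarrow>
   defect_order T \<theta> E"
  unfolding defect_order_def by metis

text \<open>The shape of every defect below: an integrator on the second interval times a remainder
  on the first. Nonnegative exponents allow both lengths to be replaced by
  \<open>v - u\<close>.\<close>

lemma defect_order_scaleR:
  assumes "germ_order T \<beta> a" "germ_order T \<gamma> R" "\<beta> \<ge> 0" "\<gamma> \<ge> 0" "\<beta> + \<gamma> = \<theta>"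
  shows "defect_order T \<theta> (\<lambda>u m v. a m v *\<^sub>R R u m)"
proof -
  obtain C where C: "C \<ge> 0" "\<And>u v. 0 \<le> u \<Longrightarrow> u < v \<Longrightarrow> v \<le> T \<Longrightarrow> norm (a u v) \<le> C * (v - u) powr \<beta>"
    using germ_orderE[OF assms(1)] by blast
  obtain D where D: "D \<ge> 0" "\<And>u v. 0 \<le> u \<Longrightarrow> u < v \<Longrightarrow> v \<le> T \<Longrightarrow> norm (R u v) \<le> D * (v - u) powr \<gamma>"
    using germ_orderE[OF assms(2)] by blast
  have "norm (a m v *\<^sub>R R u m) \<le> (C * D) * (v - u) powr \<theta>"
    if "0 \<le> u" "u < m" "m < v" "v \<le> T" for u m v
  proof -
    have "norm (a m v *\<^sub>R R u m) \<le> (C * (v - m) powr \<beta>) * (D * (m - u) powr \<gamma>)"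
      using C(2)[of m v] D(2)[of u m] that C(1) by (auto intro!: mult_mono)
    also have "\<dots> \<le> (C * (v - u) powr \<beta>) * (D * (v - u) powr \<gamma>)"
      using that C(1) D(1) assms by (intro mult_mono mult_left_mono powr_mono2) auto
    also have "\<dots> = (C * D) * (v - u) powr \<theta>" by (simp add: assms(5)[symmetric] powr_add)
    finally show ?thesis .
  qed
  then show ?thesis unfolding defect_order_def by blast
qed

text \<open>\<open>K\<close> is chosen before \<open>s\<close> and \<open>t\<close>; this uniformity
  later turns the sewing estimate into a \<open>germ_order\<close>.\<close>

lemma sewing_defect_order:
  fixes \<Xi> :: "real \<Rightarrow> real \<Rightarrow> 'v::banach"
  assumes "defect_order T \<theta> (\<lambda>u m v. \<Xi> u v - \<Xi> u m - \<Xi> m v)" "\<theta> > 1"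
  obtains K where "\<And>s t. 0 \<le> s \<Longrightarrow> s \<le> t \<Longrightarrow> t \<le> T \<Longrightarrow>
      \<exists>I. has_partition_integral \<Xi> s t I \<and> (s < t \<longrightarrow> norm (I - \<Xi> s t) \<le> K * (t - s) powr \<theta>)"
proof -
  obtain C where C: "\<And>u m v. 0 \<le> u \<Longrightarrow> u < m \<Longrightarrow> m < v \<Longrightarrow> v \<le> T \<Longrightarrow>
      norm (\<Xi> u v - \<Xi> u m - \<Xi> m v) \<le> C * (v - u) powr \<theta>"
    using assms(1) unfolding defect_order_def by blast
  have C': "norm (\<Xi> u v - \<Xi> u m - \<Xi> m v) \<le> max 0 C * (v - u) powr \<theta>"
    if "0 \<le> u" "u < m" "m < v" "v \<le> T" for u m v
    using C[OF that] by (rule order_trans) (auto intro: mult_right_mono)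
  show thesis
  proof
    fix s t assume st: "0 \<le> s" "s \<le> t" "t \<le> T"
    obtain I where "(partition_sum \<Xi> \<longlongrightarrow> I) (partition_filter s t)"
      "s < t \<Longrightarrow> norm (I - \<Xi> s t) \<le> 2 * max 0 C / (1 - 2 powr (1 - \<theta>)) * (t - s) powr \<theta>"
      by (rule sewing[OF assms(2) _ st(2), of "max 0 C" \<Xi>]) (use C' st in auto)
    then show "\<exists>I. has_partition_integral \<Xi> s t I \<and>
        (s < t \<longrightarrow> norm (I - \<Xi> s t) \<le> 2 * max 0 C / (1 - 2 powr (1 - \<theta>)) * (t - s) powr \<theta>)"
      using st unfolding has_partition_integral_def by auto
  qed
qed

section \<open>Multilinearity and symmetrised sums\<close>

lemma linear_higher_deriv_slots:
  "linear (\<lambda>v. higher_deriv G u [v])"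
  "linear (\<lambda>v. higher_deriv G u [v, w])"
  "linear (\<lambda>v. higher_deriv G u [w, v])"
  "linear (\<lambda>v. higher_deriv G u [v, w, z])"
  "linear (\<lambda>v. higher_deriv G u [w, v, z])"
  "linear (\<lambda>v. higher_deriv G u [w, z, v])"
  using linear_higher_deriv[of G u "[]" "[]"] linear_higher_deriv[of G u "[]" "[w]"]
    linear_higher_deriv[of G u "[w]" "[]"] linear_higher_deriv[of G u "[]" "[w, z]"]
    linear_higher_deriv[of G u "[w]" "[z]"] linear_higher_deriv[of G u "[w, z]" "[]"] by simp_all

lemmas higher_deriv_add = linear_higher_deriv_slots[THEN linear_add]
lemmas higher_deriv_diff = linear_higher_deriv_slots[THEN linear_diff]
lemmas higher_deriv_scaleR = linear_higher_deriv_slots[THEN linear_scale]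
lemmas higher_deriv_sum = linear_higher_deriv_slots[THEN linear_sum]

lemma sum_swap3:
  fixes g :: "'d::finite \<Rightarrow> 'd \<Rightarrow> 'd \<Rightarrow> 'v::comm_monoid_add"
  shows "(\<Sum>i\<in>UNIV. \<Sum>j\<in>UNIV. \<Sum>k\<in>UNIV. g i j k) = (\<Sum>i\<in>UNIV. \<Sum>j\<in>UNIV. \<Sum>k\<in>UNIV. g j i k)"
    "(\<Sum>i\<in>UNIV. \<Sum>j\<in>UNIV. \<Sum>k\<in>UNIV. g i j k) = (\<Sum>i\<in>UNIV. \<Sum>j\<in>UNIV. \<Sum>k\<in>UNIV. g i k j)"
  by (rule sum.swap) (rule sum.cong, rule refl, rule sum.swap)

text \<open>A symmetric \<open>B\<close> cannot distinguish \<open>s i j\<close> from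
  \<open>s j i\<close>, so both terms of the shuffle product contribute equally and cancel the
  factor 1/2.\<close>

lemma half_square:
  fixes B :: "'d::finite \<Rightarrow> 'd \<Rightarrow> 'v::real_vector" and x :: "'d \<Rightarrow> real"
  assumes "\<And>i j. x i * x j = s i j + s j i" "\<And>i j. B i j = B j i"
  shows "(1/2) *\<^sub>R (\<Sum>i\<in>UNIV. \<Sum>j\<in>UNIV. (x i * x j) *\<^sub>R B i j) = (\<Sum>i\<in>UNIV. \<Sum>j\<in>UNIV. s j i *\<^sub>R B i j)"
proof -
  have "(\<Sum>i\<in>UNIV. \<Sum>j\<in>UNIV. (x i * x j) *\<^sub>R B i j) =
      (\<Sum>i\<in>UNIV. \<Sum>j\<in>UNIV. s i j *\<^sub>R B i j) + (\<Sum>i\<in>UNIV. \<Sum>j\<in>UNIV. s j i *\<^sub>R B i j)"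
    by (simp add: assms(1) scaleR_add_left sum.distrib)
  also have "(\<Sum>i\<in>UNIV. \<Sum>j\<in>UNIV. s i j *\<^sub>R B i j) = (\<Sum>i\<in>UNIV. \<Sum>j\<in>UNIV. s j i *\<^sub>R B i j)"
    by (subst sum.swap) (simp add: assms(2))
  finally show ?thesis by (simp add: scaleR_2[symmetric])
qed

text \<open>The six orderings of a triple shuffle contribute equally against a symmetric
  \<open>E\<close>. \<open>S1\<close> and \<open>S2\<close> are the adjacent transpositions, which
  generate all permutations.\<close>

lemma sixth_cube:
  fixes E :: "'d::finite \<Rightarrow> 'd \<Rightarrow> 'd \<Rightarrow> 'v::real_vector" and x :: "'d \<Rightarrow> real"
  assumes x: "\<And>i j k. x i * x j * x k = s i j k + s i k j + s j i k + s j k i + s k i j + s k j i"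
    and E: "\<And>i j k. E i j k = E j i k" "\<And>i j k. E i j k = E i k j"
  shows "(1/6) *\<^sub>R (\<Sum>i\<in>UNIV. \<Sum>j\<in>UNIV. \<Sum>k\<in>UNIV. (x i * x j * x k) *\<^sub>R E i j k) =
    (\<Sum>i\<in>UNIV. \<Sum>j\<in>UNIV. \<Sum>k\<in>UNIV. s k j i *\<^sub>R E i j k)"
proof -
  define S where "S = (\<lambda>h :: 'd \<Rightarrow> 'd \<Rightarrow> 'd \<Rightarrow> real. \<Sum>i\<in>UNIV. \<Sum>j\<in>UNIV. \<Sum>k\<in>UNIV. h i j k *\<^sub>R E i j k)"
  have S1: "S h = S (\<lambda>i j k. h j i k)" for h
    unfolding S_def by (subst sum_swap3(1)) (simp add: E(1)[symmetric])
  have S2: "S h = S (\<lambda>i j k. h i k j)" for h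
    unfolding S_def by (subst sum_swap3(2)) (simp add: E(2)[symmetric])
  have six: "z + z + z + z + z + z = 6 *\<^sub>R z" for z :: 'v
  proof -
    have "6 *\<^sub>R z = (1 + 1 + 1 + 1 + 1 + 1) *\<^sub>R z" by simp
    then show ?thesis by (simp only: scaleR_add_left scaleR_one)
  qed
  \<comment> \<open>Reversing three indices takes three adjacent transpositions.\<close>
  have a: "S s = S (\<lambda>i j k. s k j i)"
    using S1[of s] S2[of "\<lambda>i j k. s j i k"] S1[of "\<lambda>i j k. s k i j"] by simp
  have "(\<Sum>i\<in>UNIV. \<Sum>j\<in>UNIV. \<Sum>k\<in>UNIV. (x i * x j * x k) *\<^sub>R E i j k) =
      S (\<lambda>i j k. s i j k) + S (\<lambda>i j k. s i k j) + S (\<lambda>i j k. s j i k) + S (\<lambda>i j k. s j k i)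
      + S (\<lambda>i j k. s k i j) + S (\<lambda>i j k. s k j i)"
    by (simp add: S_def x scaleR_add_left sum.distrib)
  also have "\<dots> = 6 *\<^sub>R S (\<lambda>i j k. s k j i)"
    using a S2[of s] S1[of s] S1[of "\<lambda>i j k. s i k j"] S2[of "\<lambda>i j k. s j i k"]
    by (simp add: six)
  finally show ?thesis by (simp add: S_def)
qed

text \<open>All terms of the third order Ito expansion beyond the first derivative, with
  \<open>B i j = D\<^sup>2F : (f\<^sub>i, f\<^sub>j)\<close>, \<open>C i j k = D\<^sup>2F : (f\<^sub>i, Df\<^sub>j : f\<^sub>k)\<close> and \<open>E i j k = D\<^sup>3F : (f\<^sub>i, f\<^sub>j, f\<^sub>k)\<close>; the
  real coefficients are \<open>x i = X\<^sup>i\<close>, \<open>t j k\<close> the ladder with root \<open>j\<close>, \<open>l\<close> the long ladder, \<open>c i k j\<close> the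
  cherry with root \<open>i\<close>, and \<open>q i j k\<close> the bracket letter \<open>(ij)\<close> grafted on \<open>k\<close>.\<close>
lemma ito_expansion_identity:
  fixes B :: "'d::finite \<Rightarrow> 'd \<Rightarrow> 'v::real_vector" and x :: "'d \<Rightarrow> real"
  assumes x2: "\<And>i j. x i * x j = s i j + s j i" and B: "\<And>i j. B i j = B j i"
    and x3: "\<And>i j k. x i * x j * x k = r i j k + r i k j + r j i k + r j k i + r k i j + r k j i"
    and E: "\<And>i j k. E i j k = E j i k" "\<And>i j k. E i j k = E i k j"
  shows "(1/2) *\<^sub>R (\<Sum>i\<in>UNIV. \<Sum>j\<in>UNIV. (x i * x j) *\<^sub>R B i j)
      + (\<Sum>i\<in>UNIV. \<Sum>j\<in>UNIV. \<Sum>k\<in>UNIV. (x i * t j k) *\<^sub>R C i j k)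
      + (1/6) *\<^sub>R (\<Sum>i\<in>UNIV. \<Sum>j\<in>UNIV. \<Sum>k\<in>UNIV. (x i * x j * x k) *\<^sub>R E i j k)
    = (\<Sum>i\<in>UNIV. \<Sum>j\<in>UNIV. t i j *\<^sub>R B i j)
      + (\<Sum>i\<in>UNIV. \<Sum>j\<in>UNIV. \<Sum>k\<in>UNIV. l i j k *\<^sub>R C i j k)
      + (\<Sum>i\<in>UNIV. \<Sum>j\<in>UNIV. \<Sum>k\<in>UNIV. c i k j *\<^sub>R (E i j k + C k i j + C j i k))
      + (\<Sum>i\<in>UNIV. \<Sum>j\<in>UNIV. (s j i - t i j) *\<^sub>R B i j)
      + (\<Sum>i\<in>UNIV. \<Sum>j\<in>UNIV. \<Sum>k\<in>UNIV. q i j k *\<^sub>R (E i j k + C j i k + C i j k))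
      + (\<Sum>i\<in>UNIV. \<Sum>j\<in>UNIV. \<Sum>k\<in>UNIV. (r k j i - c i k j - q i j k) *\<^sub>R E i j k)
      + (\<Sum>i\<in>UNIV. \<Sum>j\<in>UNIV. \<Sum>k\<in>UNIV.
          (x i * t j k - l i j k - c j i k - c j k i - q i j k - q j i k) *\<^sub>R C i j k)"
proof -
  \<comment> \<open>Relabelled onto \<open>C i j k\<close>, the \<open>C\<close> terms with permuted
    indices acquire the coefficients \<open>c j i k\<close>, \<open>c j k i\<close> and
    \<open>q j i k\<close>, which the last sum of the identity subtracts.\<close>
  have c1: "(\<Sum>i\<in>UNIV. \<Sum>j\<in>UNIV. \<Sum>k\<in>UNIV. c i k j *\<^sub>R C k i j)
      = (\<Sum>i\<in>UNIV. \<Sum>j\<in>UNIV. \<Sum>k\<in>UNIV. c j i k *\<^sub>R C i j k)"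
    by (subst sum_swap3(2), subst sum_swap3(1)) simp
  have c2: "(\<Sum>i\<in>UNIV. \<Sum>j\<in>UNIV. \<Sum>k\<in>UNIV. c i k j *\<^sub>R C j i k)
      = (\<Sum>i\<in>UNIV. \<Sum>j\<in>UNIV. \<Sum>k\<in>UNIV. c j k i *\<^sub>R C i j k)"
    by (subst sum_swap3(1)) simp
  have q1: "(\<Sum>i\<in>UNIV. \<Sum>j\<in>UNIV. \<Sum>k\<in>UNIV. q i j k *\<^sub>R C j i k)
      = (\<Sum>i\<in>UNIV. \<Sum>j\<in>UNIV. \<Sum>k\<in>UNIV. q j i k *\<^sub>R C i j k)"
    by (subst sum_swap3(1)) simp
  show ?thesis
    unfolding half_square[OF x2 B] sixth_cube[OF x3 E]
    by (simp add: scaleR_add_right scaleR_diff_left sum.distrib sum_subtractf c1 c2 q1)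
qed

section \<open>The expansion along a solution\<close>

lemma smooth_higher_deriv_1: "smooth F \<Longrightarrow> smooth p \<Longrightarrow> smooth (\<lambda>u. higher_deriv F u [p u])"
  using smooth_higher_deriv[of "[p]" F] by simp

lemma smooth_higher_deriv_2:
  "smooth F \<Longrightarrow> smooth p \<Longrightarrow> smooth q \<Longrightarrow> smooth (\<lambda>u. higher_deriv F u [p u, q u])"
  using smooth_higher_deriv[of "[p, q]" F] by auto

lemma smooth_higher_deriv_3:
  "smooth F \<Longrightarrow> smooth p \<Longrightarrow> smooth q \<Longrightarrow> smooth r \<Longrightarrow> smooth (\<lambda>u. higher_deriv F u [p u, q u, r u])"
  using smooth_higher_deriv[of "[p, q, r]" F] by auto

lemma higher_deriv_field_1:
  assumes "smooth g" "smooth p"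
  shows "higher_deriv (\<lambda>u. higher_deriv g u [p u]) u [h] =
    higher_deriv g u [h, p u] + higher_deriv g u [higher_deriv p u [h]]"
  by (rule higher_deriv_1_eqI[OF has_derivative_higher_deriv_1 smooth_higher_deriv_1])
    (use assms has_derivative_higher_deriv[of p "[]"] in simp_all)

lemma higher_deriv_field_2:
  assumes "smooth g" "smooth p" "smooth q"
  shows "higher_deriv (\<lambda>u. higher_deriv g u [p u, q u]) u [h] =
    higher_deriv g u [h, p u, q u] + higher_deriv g u [higher_deriv p u [h], q u]
    + higher_deriv g u [p u, higher_deriv q u [h]]"
  by (rule higher_deriv_1_eqI[OF has_derivative_higher_deriv_2 smooth_higher_deriv_2])
    (use assms has_derivative_higher_deriv[of p "[]"] has_derivative_higher_deriv[of q "[]"] in simp_all)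

text \<open>Gives the coefficient of the lift of \<open>DF : f_i\<close> on two leaves. The last
  term is \<open>Dg\<close> applied to the second derivative of the field and will reassemble into
  the expansion of \<open>Y\<close>; the first three remain as third order terms of the
  formula.\<close>

lemma higher_deriv_field_1_second:
  assumes g: "smooth g" and p: "smooth p"
  shows "higher_deriv (\<lambda>u. higher_deriv g u [p u]) u [v, w] =
    higher_deriv g u [v, w, p u] + higher_deriv g u [w, higher_deriv p u [v]]
    + higher_deriv g u [v, higher_deriv p u [w]] + higher_deriv g u [higher_deriv p u [v, w]]"
proof -
  have p': "(p has_derivative (\<lambda>h. higher_deriv p u [h])) (at u)"
    using has_derivative_higher_deriv[OF p, of "[]"] by simp
  \<comment> \<open>\<open>w\<close> does not move with \<open>u\<close>, hence the direction 0;
    this term is dropped at the end by linearity.\<close>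
  have "((\<lambda>u. higher_deriv g u [w, p u]) has_derivative
      (\<lambda>h. higher_deriv g u [h, w, p u] + higher_deriv g u [0, p u] + higher_deriv g u [w, higher_deriv p u [h]])) (at u)"
    by (rule has_derivative_higher_deriv_2[OF g has_derivative_const p'])
  moreover have "((\<lambda>u. higher_deriv g u [higher_deriv p u [w]]) has_derivative
      (\<lambda>h. higher_deriv g u [h, higher_deriv p u [w]] + higher_deriv g u [higher_deriv p u [h, w]])) (at u)"
    by (rule has_derivative_higher_deriv_1[OF g has_derivative_higher_deriv[OF p]])
  ultimately have "((\<lambda>u. higher_deriv g u [w, p u] + higher_deriv g u [higher_deriv p u [w]]) has_derivative
      (\<lambda>h. (higher_deriv g u [h, w, p u] + higher_deriv g u [0, p u] + higher_deriv g u [w, higher_deriv p u [h]])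
        + (higher_deriv g u [h, higher_deriv p u [w]] + higher_deriv g u [higher_deriv p u [h, w]]))) (at u)"
    by (rule has_derivative_add)
  then have "((\<lambda>u. higher_deriv (\<lambda>u. higher_deriv g u [p u]) u [w]) has_derivative
      (\<lambda>h. (higher_deriv g u [h, w, p u] + higher_deriv g u [0, p u] + higher_deriv g u [w, higher_deriv p u [h]])
        + (higher_deriv g u [h, higher_deriv p u [w]] + higher_deriv g u [higher_deriv p u [h, w]]))) (at u)"
    by (simp add: higher_deriv_field_1[OF g p])
  from has_derivative_unique[OF has_derivative_higher_deriv[OF smooth_higher_deriv_1[OF g p], of "[w]" u] this]
  have "higher_deriv (\<lambda>u. higher_deriv g u [p u]) u [v, w] =
      (higher_deriv g u [v, w, p u] + higher_deriv g u [0, p u] + higher_deriv g u [w, higher_deriv p u [v]])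
        + (higher_deriv g u [v, higher_deriv p u [w]] + higher_deriv g u [higher_deriv p u [v, w]])"
    by metis
  then show ?thesis using linear_0[OF linear_higher_deriv_slots(2)[of g u "p u"]] by simp
qed

lemma higher_deriv_sums:
  "higher_deriv G u [\<Sum>i\<in>I. a i *\<^sub>R v i] = (\<Sum>i\<in>I. a i *\<^sub>R higher_deriv G u [v i])"
  "higher_deriv G u [\<Sum>i\<in>I. a i *\<^sub>R v i, \<Sum>j\<in>J. b j *\<^sub>R w j] =
     (\<Sum>i\<in>I. \<Sum>j\<in>J. (a i * b j) *\<^sub>R higher_deriv G u [v i, w j])"
  "higher_deriv G u [\<Sum>i\<in>I. a i *\<^sub>R v i, \<Sum>j\<in>J. b j *\<^sub>R w j, \<Sum>k\<in>K. c k *\<^sub>R z k] =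
     (\<Sum>i\<in>I. \<Sum>j\<in>J. \<Sum>k\<in>K. (a i * b j * c k) *\<^sub>R higher_deriv G u [v i, w j, z k])"
proof -
  show "higher_deriv G u [\<Sum>i\<in>I. a i *\<^sub>R v i] = (\<Sum>i\<in>I. a i *\<^sub>R higher_deriv G u [v i])"
    by (simp add: higher_deriv_sum(1) higher_deriv_scaleR(1))
  show "higher_deriv G u [\<Sum>i\<in>I. a i *\<^sub>R v i, \<Sum>j\<in>J. b j *\<^sub>R w j] =
     (\<Sum>i\<in>I. \<Sum>j\<in>J. (a i * b j) *\<^sub>R higher_deriv G u [v i, w j])"
    unfolding higher_deriv_sum(2) higher_deriv_scaleR(2)
    by (simp add: higher_deriv_sum(3) higher_deriv_scaleR(3) scaleR_sum_right)
  show "higher_deriv G u [\<Sum>i\<in>I. a i *\<^sub>R v i, \<Sum>j\<in>J. b j *\<^sub>R w j, \<Sum>k\<in>K. c k *\<^sub>R z k] =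
     (\<Sum>i\<in>I. \<Sum>j\<in>J. \<Sum>k\<in>K. (a i * b j * c k) *\<^sub>R higher_deriv G u [v i, w j, z k])"
    unfolding higher_deriv_sum(4) higher_deriv_scaleR(4)
    unfolding higher_deriv_sum(5) higher_deriv_scaleR(5)
    by (simp add: higher_deriv_sum(6) higher_deriv_scaleR(6) scaleR_sum_right mult.assoc)
qed

text \<open>The germ of the rough integral of a controlled path with coefficients \<open>g0\<close>, \<open>g1 k\<close> (on
  \<open>\<bullet>\<^sub>k\<close>), \<open>g2 j k\<close> (on \<open>[\<bullet>\<^sub>k]\<^sub>j\<close>) and \<open>g3 j k\<close> (on \<open>\<bullet>\<^sub>k\<bullet>\<^sub>j\<close>) fails to be additive only by
  the remainders of the coefficients.\<close>
lemma germ_defect_identity: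
  fixes g0 g0' :: "'v::real_vector" and x p1 p1' p1'' :: "'d::finite \<Rightarrow> real"
  assumes "p0 = p0' + p0''" and "\<And>k. p1 k = p1' k + x k * p0'' + p1'' k"
    and "\<And>j k. p2 j k = p2' j k + t j k * p0'' + x k * p1'' j + p2'' j k"
    and "\<And>j k. p3 k j = p3' k j + s k j * p0'' + x k * p1'' j + p3'' k j"
  shows "(p0 *\<^sub>R g0 + (\<Sum>k\<in>UNIV. p1 k *\<^sub>R g1 k) + (\<Sum>j\<in>UNIV. \<Sum>k\<in>UNIV. p2 j k *\<^sub>R g2 j k)
       + (\<Sum>j\<in>UNIV. \<Sum>k\<in>UNIV. p3 k j *\<^sub>R g3 j k))
    - (p0' *\<^sub>R g0 + (\<Sum>k\<in>UNIV. p1' k *\<^sub>R g1 k) + (\<Sum>j\<in>UNIV. \<Sum>k\<in>UNIV. p2' j k *\<^sub>R g2 j k)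
       + (\<Sum>j\<in>UNIV. \<Sum>k\<in>UNIV. p3' k j *\<^sub>R g3 j k))
    - (p0'' *\<^sub>R g0' + (\<Sum>k\<in>UNIV. p1'' k *\<^sub>R g1' k) + (\<Sum>j\<in>UNIV. \<Sum>k\<in>UNIV. p2'' j k *\<^sub>R g2' j k)
       + (\<Sum>j\<in>UNIV. \<Sum>k\<in>UNIV. p3'' k j *\<^sub>R g3' j k))
    = - (p0'' *\<^sub>R (g0' - (g0 + (\<Sum>k\<in>UNIV. x k *\<^sub>R g1 k) + (\<Sum>j\<in>UNIV. \<Sum>k\<in>UNIV. t j k *\<^sub>R g2 j k)
           + (\<Sum>j\<in>UNIV. \<Sum>k\<in>UNIV. s k j *\<^sub>R g3 j k)))
       + (\<Sum>j\<in>UNIV. p1'' j *\<^sub>R (g1' j - (g1 j + (\<Sum>k\<in>UNIV. x k *\<^sub>R (g3 j k + g2 j k)))))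
       + (\<Sum>j\<in>UNIV. \<Sum>k\<in>UNIV. p2'' j k *\<^sub>R (g2' j k - g2 j k))
       + (\<Sum>j\<in>UNIV. \<Sum>k\<in>UNIV. p3'' k j *\<^sub>R (g3' j k - g3 j k)))"
  unfolding assms
  by (simp add: scaleR_add_left scaleR_add_right scaleR_diff_right sum.distrib sum_subtractf scaleR_sum_right mult.commute)

text \<open>Isolates what is used of \<open>X\<close> and \<open>Y\<close> before the integral
  equation: orders, shuffle relations and controlledness at the empty forest. Two leaves are absent
  from \<open>y_order_3\<close>, because a solution has coefficient 0 there.\<close>

locale rde_expansion =
  fixes \<alpha> T :: real and f :: "'d::finite \<Rightarrow> real^'n::finite \<Rightarrow> real^'n" and y :: "real \<Rightarrow> real^'n"
    and W :: "'d forest \<Rightarrow> real \<Rightarrow> real \<Rightarrow> real"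
  assumes \<alpha>_pos: "0 < \<alpha>" and \<alpha>_4: "1 < 4 * \<alpha>"
    and smooth_f: "\<And>i. smooth (f i)"
    and W_order: "\<And>\<tau>. nodes \<tau> \<le> 3 \<Longrightarrow> germ_order T (real (nodes \<tau>) * \<alpha>) (W \<tau>)"
    and W_shuffle: "\<And>a b u v. 0 \<le> u \<Longrightarrow> u < v \<Longrightarrow> v \<le> T \<Longrightarrow> nodes [a, b] \<le> 3 \<Longrightarrow>
      W [a] u v * W [b] u v = W [a, b] u v + W [b, a] u v"
    and W_shuffle3: "\<And>a b c u v. 0 \<le> u \<Longrightarrow> u < v \<Longrightarrow> v \<le> T \<Longrightarrow> nodes [a, b, c] \<le> 3 \<Longrightarrow>
      W [a] u v * W [b, c] u v = W [a, b, c] u v + W [b, a, c] u v + W [b, c, a] u v"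
    and y_order_3: "germ_order T (3 * \<alpha>) (\<lambda>u v. y v - y u - (\<Sum>i\<in>UNIV. W (leaf i) u v *\<^sub>R f i (y u))
      - (\<Sum>j\<in>UNIV. \<Sum>k\<in>UNIV. W (graft j (leaf k)) u v *\<^sub>R higher_deriv (f j) (y u) [f k (y u)]))"
begin

text \<open>\<open>P \<tau>\<close> models the coefficient on \<open>\<tau>\<close> grafted onto a
  fixed root letter, and the equations are Chen's relation. Only left cuts are admissible, so
  \<open>leaf k @ leaf j\<close> can lose \<open>leaf k\<close> alone but not \<open>leaf j\<close>
  alone. Root \<open>i\<close> in \<open>X\<close> and root \<open>(ij)\<close> in the bracket
  extension are both instances.\<close>

definition integrator :: "('d forest \<Rightarrow> real \<Rightarrow> real \<Rightarrow> real) \<Rightarrow> bool" where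
  "integrator P \<longleftrightarrow>
     (\<forall>\<tau>. nodes \<tau> \<le> 2 \<longrightarrow> germ_order T (real (Suc (nodes \<tau>)) * \<alpha>) (P \<tau>)) \<and>
     (\<forall>u m v. 0 \<le> u \<longrightarrow> u < m \<longrightarrow> m < v \<longrightarrow> v \<le> T \<longrightarrow>
        P [] u v = P [] u m + P [] m v \<and>
        (\<forall>k. P (leaf k) u v = P (leaf k) u m + W (leaf k) u m * P [] m v + P (leaf k) m v) \<and>
        (\<forall>j k. P (graft j (leaf k)) u v = P (graft j (leaf k)) u m + W (graft j (leaf k)) u m * P [] m v
           + W (leaf k) u m * P (leaf j) m v + P (graft j (leaf k)) m v) \<and>
        (\<forall>j k. P (leaf k @ leaf j) u v = P (leaf k @ leaf j) u m + W (leaf k @ leaf j) u m * P [] m v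
           + W (leaf k) u m * P (leaf j) m v + P (leaf k @ leaf j) m v))"

text \<open>The rough germ of the lift of \<open>g\<close>, with the coefficients of a solution
  inserted. On two leaves only the second derivative survives, since \<open>Y\<close> has
  coefficient 0 there.\<close>

definition germ :: "(real^'n \<Rightarrow> real^'n) \<Rightarrow> ('d forest \<Rightarrow> real \<Rightarrow> real \<Rightarrow> real) \<Rightarrow> real \<Rightarrow> real \<Rightarrow> real^'n" where
  "germ g P u v = P [] u v *\<^sub>R g (y u) + (\<Sum>k\<in>UNIV. P (leaf k) u v *\<^sub>R higher_deriv g (y u) [f k (y u)])
     + (\<Sum>j\<in>UNIV. \<Sum>k\<in>UNIV. P (graft j (leaf k)) u v *\<^sub>R higher_deriv g (y u) [higher_deriv (f j) (y u) [f k (y u)]])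
     + (\<Sum>j\<in>UNIV. \<Sum>k\<in>UNIV. P (leaf k @ leaf j) u v *\<^sub>R higher_deriv g (y u) [f k (y u), f j (y u)])"

lemma W_orders:
  "germ_order T \<alpha> (W (leaf i))"
  "germ_order T (2 * \<alpha>) (W (graft j (leaf k)))"
  "germ_order T (2 * \<alpha>) (W (leaf k @ leaf j))"
  using W_order[of "leaf i"] W_order[of "graft j (leaf k)"] W_order[of "leaf k @ leaf j"] by simp_all

lemma y_bounded: "\<exists>R. \<forall>t\<in>{0..T}. y t \<in> cball 0 R"
proof -
  define Z where "Z = (\<lambda>u v. (y v - y u - (\<Sum>i\<in>UNIV. W (leaf i) u v *\<^sub>R f i (y u))
      - (\<Sum>j\<in>UNIV. \<Sum>k\<in>UNIV. W (graft j (leaf k)) u v *\<^sub>R higher_deriv (f j) (y u) [f k (y u)]))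
     + (\<Sum>i\<in>UNIV. W (leaf i) u v *\<^sub>R f i (y 0))
     + (\<Sum>j\<in>UNIV. \<Sum>k\<in>UNIV. W (graft j (leaf k)) u v *\<^sub>R higher_deriv (f j) (y 0) [f k (y 0)]))"
  have c: "germ_order T 0 (\<lambda>u v. W \<tau> u v *\<^sub>R c)" if "nodes \<tau> \<le> 3" for \<tau> and c :: "real^'n"
    using germ_order_mono[OF germ_order_scaleR[OF W_order[OF that] germ_order_const], of 0] \<alpha>_pos by simp
  have "germ_order T 0 Z"
    unfolding Z_def
    by (intro germ_order_add germ_order_sum c germ_order_mono[OF y_order_3]) (use \<alpha>_pos in auto)
  then obtain C where C: "C \<ge> 0" "\<And>u v. 0 \<le> u \<Longrightarrow> u < v \<Longrightarrow> v \<le> T \<Longrightarrow> norm (Z u v) \<le> C * (v - u) powr 0"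
    using germ_orderE by blast
  have "norm (y t) \<le> norm (y 0) + C" if "t \<in> {0..T}" for t
  proof (cases "t = 0")
    case False
    then have "norm (Z 0 t) \<le> C" using C(2)[of 0 t] that by simp
    moreover have "Z 0 t = y t - y 0" by (simp add: Z_def)
    ultimately show ?thesis using norm_triangle_ineq[of "y 0" "y t - y 0"] by simp
  qed (use C in simp)
  then show ?thesis by (intro exI[of _ "norm (y 0) + C"]) (simp add: dist_norm)
qed

lemma coeff_bounded:
  assumes "smooth g"
  obtains C where "C \<ge> 0" "\<And>t vs. 0 \<le> t \<Longrightarrow> t \<le> T \<Longrightarrow> length vs = n \<Longrightarrow>
    norm (higher_deriv g (y t) vs) \<le> C * prod_list (map norm vs)"
proof -
  obtain R where R: "\<And>t. t \<in> {0..T} \<Longrightarrow> y t \<in> cball 0 R" using y_bounded by blast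
  obtain C where "C \<ge> 0" "\<forall>u\<in>cball 0 R. \<forall>vs. length vs = n \<longrightarrow> norm (higher_deriv g u vs) \<le> C * prod_list (map norm vs)"
    using higher_deriv_bounded[OF assms compact_cball] by blast
  then show thesis using that[of C] R by simp
qed

lemma coeff_order: "smooth p \<Longrightarrow> germ_order T 0 (\<lambda>u v. p (y u))"
proof -
  assume "smooth p"
  then obtain C where "\<And>t vs. 0 \<le> t \<Longrightarrow> t \<le> T \<Longrightarrow> length vs = 0 \<Longrightarrow>
    norm (higher_deriv p (y t) vs) \<le> C * prod_list (map norm vs)" using coeff_bounded by blast
  from this[of _ "[]"] show ?thesis by (intro germ_orderI[of _ _ C]) auto
qed

lemma scaleR_coeff_order:
  assumes "germ_order T \<beta> a" "smooth p"
  shows "germ_order T \<beta> (\<lambda>u v. a u v *\<^sub>R p (y u))"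
  using germ_order_scaleR[OF assms(1) coeff_order[OF assms(2)]] by simp

lemma higher_deriv_order_1:
  assumes "smooth g" "germ_order T \<beta> V"
  shows "germ_order T \<beta> (\<lambda>u v. higher_deriv g (y u) [V u v])"
proof -
  obtain C where C: "\<And>t vs. 0 \<le> t \<Longrightarrow> t \<le> T \<Longrightarrow> length vs = 1 \<Longrightarrow>
    norm (higher_deriv g (y t) vs) \<le> C * prod_list (map norm vs)" using coeff_bounded[OF assms(1)] by blast
  show ?thesis using C[of _ "[_]"] by (intro germ_order_dominated[OF assms(2), of _ C]) auto
qed

lemma higher_deriv_order_2:
  assumes "smooth g" "germ_order T \<beta> V" "germ_order T \<gamma> V'"
  shows "germ_order T (\<beta> + \<gamma>) (\<lambda>u v. higher_deriv g (y u) [V u v, V' u v])"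
proof -
  obtain C where C: "\<And>t vs. 0 \<le> t \<Longrightarrow> t \<le> T \<Longrightarrow> length vs = 2 \<Longrightarrow>
    norm (higher_deriv g (y t) vs) \<le> C * prod_list (map norm vs)" using coeff_bounded[OF assms(1)] by blast
  show ?thesis using C[of _ "[_, _]"] by (intro germ_order_prod[OF assms(2,3), of _ C]) auto
qed

lemma higher_deriv_order_3:
  assumes "smooth g" "germ_order T \<beta> V" "germ_order T \<gamma> V'" "germ_order T \<delta> V''"
  shows "germ_order T (\<beta> + (\<gamma> + \<delta>)) (\<lambda>u v. higher_deriv g (y u) [V u v, V' u v, V'' u v])"
proof -
  obtain C where C: "\<And>t vs. 0 \<le> t \<Longrightarrow> t \<le> T \<Longrightarrow> length vs = 3 \<Longrightarrow>
    norm (higher_deriv g (y t) vs) \<le> C * prod_list (map norm vs)" using coeff_bounded[OF assms(1)] by blast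
  have "germ_order T (\<gamma> + \<delta>) (\<lambda>u v. norm (V' u v) * norm (V'' u v))"
    by (rule germ_order_prod[OF assms(3,4), of _ 1]) simp
  then show ?thesis using C[of _ "[_, _, _]"]
    by (intro germ_order_prod[OF assms(2), of _ "\<lambda>u v. norm (V' u v) * norm (V'' u v)" _ C]) auto
qed

definition dy :: "real \<Rightarrow> real \<Rightarrow> real^'n" where
  "dy u v = y v - y u"

text \<open>\<open>A1\<close> and \<open>A2\<close> are the single terms of order
  \<open>\<alpha>\<close> and \<open>2 * \<alpha>\<close> in the expansion of an increment;
  \<open>A3\<close> below is cumulative and contains both.\<close>

definition A1 :: "real \<Rightarrow> real \<Rightarrow> real^'n" where
  "A1 u v = (\<Sum>i\<in>UNIV. W (leaf i) u v *\<^sub>R f i (y u))"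

definition A2 :: "real \<Rightarrow> real \<Rightarrow> real^'n" where
  "A2 u v = (\<Sum>j\<in>UNIV. \<Sum>k\<in>UNIV. W (graft j (leaf k)) u v *\<^sub>R higher_deriv (f j) (y u) [f k (y u)])"

lemma A1_order: "germ_order T \<alpha> A1"
  unfolding A1_def[abs_def] by (intro germ_order_sum scaleR_coeff_order W_orders smooth_f)

lemma A2_order: "germ_order T (2 * \<alpha>) A2"
  unfolding A2_def[abs_def]
  by (intro germ_order_sum scaleR_coeff_order[OF _ smooth_higher_deriv_1] W_orders smooth_f)

lemma dy_A1_A2_order: "germ_order T (3 * \<alpha>) (\<lambda>u v. dy u v - A1 u v - A2 u v)"
  using y_order_3 by (simp add: dy_def A1_def A2_def)

lemma dy_A1_order: "germ_order T (2 * \<alpha>) (\<lambda>u v. dy u v - A1 u v)"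
proof -
  have "germ_order T (2 * \<alpha>) (\<lambda>u v. (dy u v - A1 u v - A2 u v) + A2 u v)"
    by (intro germ_order_add A2_order germ_order_mono[OF dy_A1_A2_order]) (use \<alpha>_pos in simp)
  then show ?thesis by simp
qed

lemma dy_order: "germ_order T \<alpha> dy"
proof -
  have "germ_order T \<alpha> (\<lambda>u v. (dy u v - A1 u v) + A1 u v)"
    by (intro germ_order_add A1_order germ_order_mono[OF dy_A1_order]) (use \<alpha>_pos in simp)
  then show ?thesis by simp
qed

section \<open>Remainders of smooth functions of the solution\<close>

lemma taylor_order:
  assumes "smooth g"
  shows "germ_order T (real n * \<alpha>)
    (\<lambda>u v. g (y v) - (\<Sum>m<n. (1 / fact m) *\<^sub>R higher_deriv g (y u) (replicate m (dy u v))))"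
proof -
  obtain R where R: "\<And>t. t \<in> {0..T} \<Longrightarrow> y t \<in> cball 0 R" using y_bounded by blast
  obtain C where C: "\<And>u v. u\<in>cball 0 R \<Longrightarrow> v\<in>cball 0 R \<Longrightarrow>
    norm (g v - (\<Sum>m<n. (1 / fact m) *\<^sub>R higher_deriv g u (replicate m (v - u)))) \<le> C * norm (v - u) ^ n"
    using higher_deriv_taylor[OF assms] by blast
  show ?thesis
    by (rule germ_order_dominated[OF germ_order_norm_power[OF dy_order], of _ C])
      (use C R in \<open>simp add: dy_def\<close>)
qed

lemma remainder_0:
  assumes "smooth g"
  shows "germ_order T \<alpha> (\<lambda>u v. g (y v) - g (y u))"
  using taylor_order[OF assms, of 1] by simp

lemma remainder_1:
  assumes "smooth g"
  shows "germ_order T (2 * \<alpha>)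
    (\<lambda>u v. g (y v) - (g (y u) + (\<Sum>k\<in>UNIV. W (leaf k) u v *\<^sub>R higher_deriv g (y u) [f k (y u)])))"
proof -
  have "germ_order T (2 * \<alpha>) (\<lambda>u v. (g (y v) - (\<Sum>m<2. (1 / fact m) *\<^sub>R higher_deriv g (y u) (replicate m (dy u v))))
     + higher_deriv g (y u) [dy u v - A1 u v])"
    using taylor_order[OF assms, of 2] by (intro germ_order_add higher_deriv_order_1 assms dy_A1_order) simp
  then show ?thesis
    by (rule germ_order_cong)
      (simp add: numeral_2_eq_2 higher_deriv_diff A1_def higher_deriv_sums algebra_simps)
qed

lemma half_A1_A1:
  assumes "smooth g" "0 \<le> u" "u < v" "v \<le> T"
  shows "(1/2) *\<^sub>R higher_deriv g (y u) [A1 u v, A1 u v] =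
    (\<Sum>j\<in>UNIV. \<Sum>k\<in>UNIV. W (leaf k @ leaf j) u v *\<^sub>R higher_deriv g (y u) [f k (y u), f j (y u)])"
proof -
  have "(1/2) *\<^sub>R higher_deriv g (y u) [A1 u v, A1 u v] =
    (\<Sum>j\<in>UNIV. \<Sum>k\<in>UNIV. W (leaf k @ leaf j) u v *\<^sub>R higher_deriv g (y u) [f j (y u), f k (y u)])"
    unfolding A1_def higher_deriv_sums
    by (rule half_square) (use W_shuffle[OF assms(2-)] in \<open>auto intro: higher_deriv_swap[OF assms(1)]\<close>)
  then show ?thesis by (simp add: higher_deriv_swap(1)[OF assms(1), of _ "f _ (y u)" "f _ (y u)"])
qed

text \<open>In Taylor's formula up to the quadratic term, the increment is replaced by
  \<open>A1 + A2\<close> in the linear and by \<open>A1\<close> in the quadratic term. With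
  \<open>remainder_0\<close> and \<open>remainder_1\<close> this amounts to controlledness of the
  lift of \<open>g\<close>.\<close>

lemma remainder_2:
  assumes "smooth g"
  shows "germ_order T (3 * \<alpha>) (\<lambda>u v. g (y v) - (g (y u)
     + (\<Sum>k\<in>UNIV. W (leaf k) u v *\<^sub>R higher_deriv g (y u) [f k (y u)])
     + (\<Sum>j\<in>UNIV. \<Sum>k\<in>UNIV. W (graft j (leaf k)) u v *\<^sub>R higher_deriv g (y u) [higher_deriv (f j) (y u) [f k (y u)]])
     + (\<Sum>j\<in>UNIV. \<Sum>k\<in>UNIV. W (leaf k @ leaf j) u v *\<^sub>R higher_deriv g (y u) [f k (y u), f j (y u)])))"
proof -
  have t: "germ_order T (3 * \<alpha>) (\<lambda>u v. g (y v) - (\<Sum>m<3. (1 / fact m) *\<^sub>R higher_deriv g (y u) (replicate m (dy u v))))"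
    using taylor_order[OF assms, of 3] by simp
  \<comment> \<open>The quadratic error is split as
    \<open>dy^2 - A1^2 = (dy - A1) dy + A1 (dy - A1)\<close>, both parts of order
    \<open>3 * \<alpha>\<close>.\<close>
  have "germ_order T (3 * \<alpha>) (\<lambda>u v. (g (y v) - (\<Sum>m<3. (1 / fact m) *\<^sub>R higher_deriv g (y u) (replicate m (dy u v))))
     + higher_deriv g (y u) [dy u v - A1 u v - A2 u v]
     + (1/2) *\<^sub>R (higher_deriv g (y u) [dy u v - A1 u v, dy u v] + higher_deriv g (y u) [A1 u v, dy u v - A1 u v]))"
    by (intro germ_order_add t higher_deriv_order_1 assms dy_A1_A2_order germ_order_scaleR_const
        germ_order_mono[OF higher_deriv_order_2[OF assms dy_A1_order dy_order]]
        germ_order_mono[OF higher_deriv_order_2[OF assms A1_order dy_A1_order]]) simp_all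
  then show ?thesis
  proof (rule germ_order_cong)
    fix u v assume uv: "0 \<le> u" "u < v" "v \<le> T"
    have a1: "higher_deriv g (y u) [A1 u v] = (\<Sum>k\<in>UNIV. W (leaf k) u v *\<^sub>R higher_deriv g (y u) [f k (y u)])"
      by (simp add: A1_def higher_deriv_sums)
    have a2: "higher_deriv g (y u) [A2 u v] = (\<Sum>j\<in>UNIV. \<Sum>k\<in>UNIV. W (graft j (leaf k)) u v *\<^sub>R higher_deriv g (y u) [higher_deriv (f j) (y u) [f k (y u)]])"
      by (simp add: A2_def higher_deriv_sum(1) higher_deriv_scaleR(1))
    show "g (y v) - (g (y u)
     + (\<Sum>k\<in>UNIV. W (leaf k) u v *\<^sub>R higher_deriv g (y u) [f k (y u)])
     + (\<Sum>j\<in>UNIV. \<Sum>k\<in>UNIV. W (graft j (leaf k)) u v *\<^sub>R higher_deriv g (y u) [higher_deriv (f j) (y u) [f k (y u)]])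
     + (\<Sum>j\<in>UNIV. \<Sum>k\<in>UNIV. W (leaf k @ leaf j) u v *\<^sub>R higher_deriv g (y u) [f k (y u), f j (y u)]))
     = (g (y v) - (\<Sum>m<3. (1 / fact m) *\<^sub>R higher_deriv g (y u) (replicate m (dy u v))))
     + higher_deriv g (y u) [dy u v - A1 u v - A2 u v]
     + (1/2) *\<^sub>R (higher_deriv g (y u) [dy u v - A1 u v, dy u v] + higher_deriv g (y u) [A1 u v, dy u v - A1 u v])"
      unfolding a1[symmetric] a2[symmetric] half_A1_A1[OF assms uv, symmetric]
      by (simp add: numeral_3_eq_3 higher_deriv_diff scaleR_diff_right scaleR_add_right)
  qed
qed

text \<open>By Chen's relation each coefficient of \<open>P\<close> on the second interval
  multiplies the remainder of the matching coefficient of the lift on the first. Orders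
  \<open>j * \<alpha>\<close> and \<open>(4 - j) * \<alpha>\<close> meet, for \<open>j\<close> = 1,
  2, 3.\<close>

lemma germ_defect:
  assumes "smooth g" "integrator P"
  shows "defect_order T (4 * \<alpha>) (\<lambda>u m v. germ g P u v - germ g P u m - germ g P m v)"
proof -
  have P: "germ_order T \<alpha> (P [])" "germ_order T (2 * \<alpha>) (P (leaf k))"
    "germ_order T (3 * \<alpha>) (P (graft j (leaf k)))" "germ_order T (3 * \<alpha>) (P (leaf k @ leaf j))" for j k
    using assms(2)[unfolded integrator_def, THEN conjunct1, rule_format, of "[]"]
      assms(2)[unfolded integrator_def, THEN conjunct1, rule_format, of "leaf k"]
      assms(2)[unfolded integrator_def, THEN conjunct1, rule_format, of "graft j (leaf k)"]
      assms(2)[unfolded integrator_def, THEN conjunct1, rule_format, of "leaf k @ leaf j"] by simp_all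
  have chen: "P [] u v = P [] u m + P [] m v"
    "P (leaf k) u v = P (leaf k) u m + W (leaf k) u m * P [] m v + P (leaf k) m v"
    "P (graft j (leaf k)) u v = P (graft j (leaf k)) u m + W (graft j (leaf k)) u m * P [] m v
           + W (leaf k) u m * P (leaf j) m v + P (graft j (leaf k)) m v"
    "P (leaf k @ leaf j) u v = P (leaf k @ leaf j) u m + W (leaf k @ leaf j) u m * P [] m v
           + W (leaf k) u m * P (leaf j) m v + P (leaf k @ leaf j) m v"
    if "0 \<le> u" "u < m" "m < v" "v \<le> T" for u m v j k
    using assms(2)[unfolded integrator_def, THEN conjunct2, rule_format, OF that] by blast+
  define R0 where "R0 = (\<lambda>u v. g (y v) - (g (y u)
     + (\<Sum>k\<in>UNIV. W (leaf k) u v *\<^sub>R higher_deriv g (y u) [f k (y u)])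
     + (\<Sum>j\<in>UNIV. \<Sum>k\<in>UNIV. W (graft j (leaf k)) u v *\<^sub>R higher_deriv g (y u) [higher_deriv (f j) (y u) [f k (y u)]])
     + (\<Sum>j\<in>UNIV. \<Sum>k\<in>UNIV. W (leaf k @ leaf j) u v *\<^sub>R higher_deriv g (y u) [f k (y u), f j (y u)])))"
  define h where "h = (\<lambda>j u. higher_deriv g u [f j u])"
  have hs: "smooth (h j)" for j unfolding h_def by (intro smooth_higher_deriv_1 assms smooth_f)
  \<comment> \<open>The derivative of \<open>h j\<close> along \<open>f k\<close> is the sum of the
    two-leaf and the ladder coefficient of the lift of \<open>g\<close>, so
    \<open>remainder_1\<close> for \<open>h j\<close> is the remainder of the coefficient at one
    leaf.\<close>
  define R1 where "R1 = (\<lambda>j u v. h j (y v) - (h j (y u)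
     + (\<Sum>k\<in>UNIV. W (leaf k) u v *\<^sub>R (higher_deriv g (y u) [f k (y u), f j (y u)]
         + higher_deriv g (y u) [higher_deriv (f j) (y u) [f k (y u)]]))))"
  have R1: "germ_order T (2 * \<alpha>) (R1 j)" for j
    using remainder_1[OF hs, of j] unfolding R1_def h_def higher_deriv_field_1[OF assms(1) smooth_f] .
  define g2 where "g2 = (\<lambda>j k u. higher_deriv g u [higher_deriv (f j) u [f k u]])"
  have g2s: "smooth (g2 j k)" for j k unfolding g2_def by (intro smooth_higher_deriv_1 assms smooth_f)
  define g3 where "g3 = (\<lambda>j k u. higher_deriv g u [f k u, f j u])"
  have g3s: "smooth (g3 j k)" for j k unfolding g3_def by (intro smooth_higher_deriv_2 assms smooth_f)
  have "defect_order T (4 * \<alpha>) (\<lambda>u m v. - (P [] m v *\<^sub>R R0 u m + (\<Sum>j\<in>UNIV. P (leaf j) m v *\<^sub>R R1 j u m)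
      + (\<Sum>j\<in>UNIV. \<Sum>k\<in>UNIV. P (graft j (leaf k)) m v *\<^sub>R (g2 j k (y m) - g2 j k (y u)))
      + (\<Sum>j\<in>UNIV. \<Sum>k\<in>UNIV. P (leaf k @ leaf j) m v *\<^sub>R (g3 j k (y m) - g3 j k (y u)))))"
    unfolding R0_def
    by (intro defect_order_minus defect_order_add defect_order_sum
        defect_order_scaleR[OF P(1) remainder_2[OF assms(1)]]
        defect_order_scaleR[OF P(2) R1] defect_order_scaleR[OF P(3) remainder_0[OF g2s]]
        defect_order_scaleR[OF P(4) remainder_0[OF g3s]]) (use \<alpha>_pos in simp_all)
  then show ?thesis
  proof (rule defect_order_cong)
    fix u m v assume umv: "0 \<le> u" "u < m" "m < v" "v \<le> T"
    show "germ g P u v - germ g P u m - germ g P m v =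
      - (P [] m v *\<^sub>R R0 u m + (\<Sum>j\<in>UNIV. P (leaf j) m v *\<^sub>R R1 j u m)
      + (\<Sum>j\<in>UNIV. \<Sum>k\<in>UNIV. P (graft j (leaf k)) m v *\<^sub>R (g2 j k (y m) - g2 j k (y u)))
      + (\<Sum>j\<in>UNIV. \<Sum>k\<in>UNIV. P (leaf k @ leaf j) m v *\<^sub>R (g3 j k (y m) - g3 j k (y u))))"
      unfolding germ_def R0_def R1_def h_def g2_def g3_def
      by (rule germ_defect_identity) (rule chen[OF umv])+
  qed
qed

lemma germ_sewing:
  assumes "smooth g" "integrator P"
  obtains K where "\<And>s t. 0 \<le> s \<Longrightarrow> s \<le> t \<Longrightarrow> t \<le> T \<Longrightarrow>
      \<exists>I. has_partition_integral (germ g P) s t I \<and> (s < t \<longrightarrow> norm (I - germ g P s t) \<le> K * (t - s) powr (4 * \<alpha>))"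
  using sewing_defect_order[OF germ_defect[OF assms] \<alpha>_4] by blast

text \<open>Integrals from 0 are additive over adjacent intervals, so their increment is the
  integral over \<open>[u, v]\<close>, which the sewing estimate compares with the germ.\<close>

lemma integral_increment_order:
  assumes "smooth g" "integrator P"
  shows "germ_order T (4 * \<alpha>) (\<lambda>u v. partition_integral (germ g P) 0 v - partition_integral (germ g P) 0 u - germ g P u v)"
proof -
  obtain K where K: "\<And>s t. 0 \<le> s \<Longrightarrow> s \<le> t \<Longrightarrow> t \<le> T \<Longrightarrow>
      \<exists>I. has_partition_integral (germ g P) s t I \<and> (s < t \<longrightarrow> norm (I - germ g P s t) \<le> K * (t - s) powr (4 * \<alpha>))"
    using germ_sewing[OF assms] by blast
  show ?thesis
  proof (rule germ_orderI)
    fix u v assume uv: "0 \<le> u" "u < v" "v \<le> T"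
    obtain I where I: "has_partition_integral (germ g P) 0 u I" using K[of 0 u] uv by auto
    obtain J where J: "has_partition_integral (germ g P) 0 v J" using K[of 0 v] uv by auto
    obtain L where L: "has_partition_integral (germ g P) u v L" "norm (L - germ g P u v) \<le> K * (v - u) powr (4 * \<alpha>)"
      using K[of u v] uv by auto
    have "J = I + L" using partition_limit_add[of 0 u v "germ g P" I L J] I J L uv
      by (simp add: has_partition_integral_def)
    then show "norm (partition_integral (germ g P) 0 v - partition_integral (germ g P) 0 u - germ g P u v) \<le> K * (v - u) powr (4 * \<alpha>)"
      using L(2) by (simp add: partition_integral_eq[OF I] partition_integral_eq[OF J])
  qed
qed

end

text \<open>A second stage, because the integral equation is phrased with \<open>germ\<close> and
  \<open>integrator\<close>, which are defined in \<open>rde_expansion\<close>.\<close>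

locale rde_solution = rde_expansion \<alpha> T f y W
  for \<alpha> T :: real and f :: "'d::finite \<Rightarrow> real^'n::finite \<Rightarrow> real^'n" and y :: "real \<Rightarrow> real^'n"
    and W :: "'d forest \<Rightarrow> real \<Rightarrow> real \<Rightarrow> real" +
  fixes \<xi> :: "real^'n"
  assumes W_integrator: "\<And>i. integrator (\<lambda>\<tau>. W (graft i \<tau>))"
    and y_rde: "\<And>t. t \<in> {0..T} \<Longrightarrow>
      y t = \<xi> + (\<Sum>i\<in>UNIV. partition_integral (germ (f i) (\<lambda>\<tau>. W (graft i \<tau>))) 0 t)"
begin

definition A3 :: "real \<Rightarrow> real \<Rightarrow> real^'n" where
  "A3 u v = (\<Sum>i\<in>UNIV. germ (f i) (\<lambda>\<tau>. W (graft i \<tau>)) u v)"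

text \<open>\<open>\<xi>\<close> cancels in the increment of the equation, and each integral is
  within order \<open>4 * \<alpha>\<close> of its germ.\<close>

lemma dy_A3_order: "germ_order T (4 * \<alpha>) (\<lambda>u v. dy u v - A3 u v)"
proof -
  have "germ_order T (4 * \<alpha>) (\<lambda>u v. \<Sum>i\<in>UNIV. partition_integral (germ (f i) (\<lambda>\<tau>. W (graft i \<tau>))) 0 v
      - partition_integral (germ (f i) (\<lambda>\<tau>. W (graft i \<tau>))) 0 u - germ (f i) (\<lambda>\<tau>. W (graft i \<tau>)) u v)"
    by (intro germ_order_sum integral_increment_order smooth_f W_integrator)
  then show ?thesis
    by (rule germ_order_cong) (simp add: dy_def A3_def y_rde sum_subtractf)
qed

text \<open>Two leaves are shuffled first, then the third into each of the two orderings.\<close>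

lemma W_triple_shuffle:
  assumes "0 \<le> u" "u < v" "v \<le> T"
  shows "W (leaf i) u v * W (leaf j) u v * W (leaf k) u v =
    W (leaf i @ leaf j @ leaf k) u v + W (leaf i @ leaf k @ leaf j) u v + W (leaf j @ leaf i @ leaf k) u v
    + W (leaf j @ leaf k @ leaf i) u v + W (leaf k @ leaf i @ leaf j) u v + W (leaf k @ leaf j @ leaf i) u v"
proof -
  have "W (leaf i) u v * W (leaf j) u v * W (leaf k) u v =
      W (leaf i) u v * W (leaf j @ leaf k) u v + W (leaf i) u v * W (leaf k @ leaf j) u v"
    using W_shuffle[OF assms, of "Node j []" "Node k []"] by (simp add: distrib_left[symmetric])
  then show ?thesis
    using W_shuffle3[OF assms, of "Node i []" "Node j []" "Node k []"]
      W_shuffle3[OF assms, of "Node i []" "Node k []" "Node j []"] by simp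
qed

text \<open>In Taylor's formula with remainder of degree four, each power of the increment is
  replaced by the coarsest expansion that costs only order \<open>4 * \<alpha>\<close>:
  \<open>A3\<close> in the linear term, \<open>A1\<close> and \<open>A2\<close> in the quadratic,
  \<open>A1\<close> in the cubic one. The rest is the algebra of
  \<open>ito_expansion_identity\<close>.\<close>

theorem ito_germ_order:
  assumes F: "smooth F"
    and Q0: "\<And>i j u v. 0 \<le> u \<Longrightarrow> u < v \<Longrightarrow> v \<le> T \<Longrightarrow> Q i j [] u v = W (leaf j @ leaf i) u v - W (graft i (leaf j)) u v"
    and Q2: "\<And>i j \<tau>. nodes \<tau> = 2 \<Longrightarrow> germ_order T (4 * \<alpha>) (Q i j \<tau>)"
  shows "germ_order T (4 * \<alpha>) (\<lambda>u v. F (y v) - F (y u) -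
    ((\<Sum>i\<in>UNIV. germ (\<lambda>u. higher_deriv F u [f i u]) (\<lambda>\<tau>. W (graft i \<tau>)) u v)
     + (\<Sum>i\<in>UNIV. \<Sum>j\<in>UNIV. germ (\<lambda>u. higher_deriv F u [f i u, f j u]) (Q i j) u v)
     + (\<Sum>i\<in>UNIV. \<Sum>j\<in>UNIV. \<Sum>k\<in>UNIV.
          (W (leaf k @ leaf j @ leaf i) u v - W (graft i (leaf k @ leaf j)) u v - Q i j (leaf k) u v) *\<^sub>R
          higher_deriv F (y u) [f i (y u), f j (y u), f k (y u)])
     + (\<Sum>i\<in>UNIV. \<Sum>j\<in>UNIV. \<Sum>k\<in>UNIV.
          (W (leaf i @ graft j (leaf k)) u v + W (graft j (leaf k) @ leaf i) u v
           - W (graft i (graft j (leaf k))) u v - W (graft j (leaf i @ leaf k)) u v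
           - W (graft j (leaf k @ leaf i)) u v - Q i j (leaf k) u v - Q j i (leaf k) u v) *\<^sub>R
          higher_deriv F (y u) [f i (y u), higher_deriv (f j) (y u) [f k (y u)]])))"
proof -
  let ?G2 = "\<lambda>i j u. higher_deriv F u [f i u, f j u]"
  \<comment> \<open>The terms of the bracket germs on forests with two vertices have no counterpart
    in the Taylor expansion; \<open>Q2\<close> makes them negligible.\<close>
  define top where "top = (\<lambda>u v. \<Sum>i\<in>UNIV. \<Sum>j\<in>UNIV.
     (\<Sum>j'\<in>UNIV. \<Sum>k\<in>UNIV. Q i j (graft j' (leaf k)) u v *\<^sub>R higher_deriv (?G2 i j) (y u) [higher_deriv (f j') (y u) [f k (y u)]])
     + (\<Sum>j'\<in>UNIV. \<Sum>k\<in>UNIV. Q i j (leaf k @ leaf j') u v *\<^sub>R higher_deriv (?G2 i j) (y u) [f k (y u), f j' (y u)]))"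
  have G2s: "smooth (?G2 i j)" for i j by (intro smooth_higher_deriv_2 F smooth_f)
  have top: "germ_order T (4 * \<alpha>) top"
    unfolding top_def
    by (intro germ_order_sum germ_order_add
        scaleR_coeff_order[OF Q2 smooth_higher_deriv_1[OF G2s smooth_higher_deriv_1[OF smooth_f smooth_f]]]
        scaleR_coeff_order[OF Q2 smooth_higher_deriv_2[OF G2s smooth_f smooth_f]]) simp_all
  have t4: "germ_order T (4 * \<alpha>) (\<lambda>u v. F (y v) - (\<Sum>m<4. (1 / fact m) *\<^sub>R higher_deriv F (y u) (replicate m (dy u v))))"
    using taylor_order[OF F, of 4] by simp
  let ?F = "\<lambda>u. higher_deriv F (y u)"
  let ?r = "\<lambda>u v. dy u v - A1 u v"
  \<comment> \<open>One group per replacement: Taylor remainder, linear, quadratic, cubic. The cubic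
    group telescopes \<open>dy^3 - A1^3\<close> slot by slot.\<close>
  have main: "germ_order T (4 * \<alpha>) (\<lambda>u v. (F (y v) - (\<Sum>m<4. (1 / fact m) *\<^sub>R ?F u (replicate m (dy u v))))
     + ?F u [dy u v - A3 u v]
     + ((1/2) *\<^sub>R ?F u [?r u v, ?r u v] + ?F u [A1 u v, ?r u v - A2 u v])
     + (1/6) *\<^sub>R (?F u [?r u v, dy u v, dy u v] + ?F u [A1 u v, ?r u v, dy u v] + ?F u [A1 u v, A1 u v, ?r u v])
     - top u v)"
    by (intro germ_order_diff germ_order_add t4 top higher_deriv_order_1 F dy_A3_order germ_order_scaleR_const
        germ_order_mono[OF higher_deriv_order_2[OF F dy_A1_order dy_A1_order]]
        germ_order_mono[OF higher_deriv_order_2[OF F A1_order dy_A1_A2_order]]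
        germ_order_mono[OF higher_deriv_order_3[OF F dy_A1_order dy_order dy_order]]
        germ_order_mono[OF higher_deriv_order_3[OF F A1_order dy_A1_order dy_order]]
        germ_order_mono[OF higher_deriv_order_3[OF F A1_order A1_order dy_A1_order]]) simp_all
  show ?thesis
  proof (rule germ_order_cong[OF main])
    fix u v assume uv: "0 \<le> u" "u < v" "v \<le> T"
    define x where "x = (\<lambda>i. W (leaf i) u v)"
    define t where "t = (\<lambda>j k. W (graft j (leaf k)) u v)"
    define s where "s = (\<lambda>i j. W (leaf i @ leaf j) u v)"
    define r where "r = (\<lambda>i j k. W (leaf i @ leaf j @ leaf k) u v)"
    define l where "l = (\<lambda>i j k. W (graft i (graft j (leaf k))) u v)"
    define c where "c = (\<lambda>i k j. W (graft i (leaf k @ leaf j)) u v)"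
    define q where "q = (\<lambda>i j k. Q i j (leaf k) u v)"
    define B where "B = (\<lambda>i j. ?F u [f i (y u), f j (y u)])"
    define C where "C = (\<lambda>i j k. ?F u [f i (y u), higher_deriv (f j) (y u) [f k (y u)]])"
    define E where "E = (\<lambda>i j k. ?F u [f i (y u), f j (y u), f k (y u)])"
    have x2: "x i * x j = s i j + s j i" for i j
      using W_shuffle[OF uv, of "Node i []" "Node j []"] by (simp add: x_def s_def)
    have x3: "x i * x j * x k = r i j k + r i k j + r j i k + r j k i + r k i j + r k j i" for i j k
      unfolding x_def r_def by (rule W_triple_shuffle[OF uv])
    have xt: "x i * t j k = W (leaf i @ graft j (leaf k)) u v + W (graft j (leaf k) @ leaf i) u v" for i j k
      using W_shuffle[OF uv, of "Node i []" "Node j (leaf k)"] by (simp add: x_def t_def)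
    have B: "B i j = B j i" for i j unfolding B_def by (rule higher_deriv_swap[OF F])
    have E: "E i j k = E j i k" "E i j k = E i k j" for i j k
      unfolding E_def by (rule higher_deriv_swap[OF F])+
    \<comment> \<open>The germ of \<open>DF : f_i\<close> is \<open>DF\<close> applied to the germ
      of \<open>f i\<close>, plus the terms in which a derivative hits \<open>DF\<close>. Summed
      over \<open>i\<close>, the former become \<open>DF\<close> applied to
      \<open>A3\<close>.\<close>
    have G1: "(\<Sum>i\<in>UNIV. germ (\<lambda>u. higher_deriv F u [f i u]) (\<lambda>\<tau>. W (graft i \<tau>)) u v) =
        ?F u [A3 u v] + (\<Sum>i\<in>UNIV. \<Sum>j\<in>UNIV. t i j *\<^sub>R B i j)
        + (\<Sum>i\<in>UNIV. \<Sum>j\<in>UNIV. \<Sum>k\<in>UNIV. l i j k *\<^sub>R C i j k)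
        + (\<Sum>i\<in>UNIV. \<Sum>j\<in>UNIV. \<Sum>k\<in>UNIV. c i k j *\<^sub>R (E i j k + C k i j + C j i k))"
    proof -
      have 1: "?F u [f k (y u), f i (y u)] = B i k" for i k
        unfolding B_def by (rule higher_deriv_swap[OF F])
      have 2: "?F u [higher_deriv (f j) (y u) [f k (y u)], f i (y u)] = C i j k" for i j k
        unfolding C_def by (rule higher_deriv_swap[OF F])
      have 3: "?F u [f k (y u), f j (y u), f i (y u)] = E i j k" for i j k
        using E unfolding E_def by metis
      have 4: "?F u [f i (y u), higher_deriv (f j) (y u) [f k (y u)]] = C i j k" for i j k
        by (simp add: C_def)
      have germ_i: "germ (\<lambda>u. higher_deriv F u [f i u]) (\<lambda>\<tau>. W (graft i \<tau>)) u v =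
          ?F u [germ (f i) (\<lambda>\<tau>. W (graft i \<tau>)) u v] + (\<Sum>k\<in>UNIV. t i k *\<^sub>R B i k)
          + (\<Sum>j\<in>UNIV. \<Sum>k\<in>UNIV. l i j k *\<^sub>R C i j k)
          + (\<Sum>j\<in>UNIV. \<Sum>k\<in>UNIV. c i k j *\<^sub>R (E i j k + C k i j + C j i k))" for i
        unfolding germ_def higher_deriv_field_1[OF F smooth_f] higher_deriv_field_1_second[OF F smooth_f] 1 2 3 4
        by (simp add: higher_deriv_add(1) higher_deriv_sum(1) higher_deriv_scaleR(1) scaleR_add_right sum.distrib
            t_def l_def c_def add_ac)
      show ?thesis by (simp add: germ_i A3_def higher_deriv_sum(1) sum.distrib)
    qed
    \<comment> \<open>Differentiating \<open>D^2F : (f_i, f_j)\<close> along \<open>f k\<close> hits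
      \<open>D^2F\<close> or one of the two fields, which gives \<open>E\<close> and the two
      \<open>C\<close> terms.\<close>
    have G2: "(\<Sum>i\<in>UNIV. \<Sum>j\<in>UNIV. germ (?G2 i j) (Q i j) u v) =
        (\<Sum>i\<in>UNIV. \<Sum>j\<in>UNIV. (s j i - t i j) *\<^sub>R B i j)
        + (\<Sum>i\<in>UNIV. \<Sum>j\<in>UNIV. \<Sum>k\<in>UNIV. q i j k *\<^sub>R (E i j k + C j i k + C i j k)) + top u v"
    proof -
      have 2: "?F u [higher_deriv (f i) (y u) [f k (y u)], f j (y u)] = C j i k" for i j k
        unfolding C_def by (rule higher_deriv_swap[OF F])
      have 3: "?F u [f k (y u), f i (y u), f j (y u)] = E i j k" for i j k
        using E unfolding E_def by metis
      have "higher_deriv (?G2 i j) (y u) [f k (y u)] = E i j k + C j i k + C i j k" for i j k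
        unfolding higher_deriv_field_2[OF F smooth_f smooth_f] 2 3 by (simp add: C_def)
      then show ?thesis
        by (simp add: germ_def top_def Q0[OF uv] s_def t_def q_def B_def sum.distrib add.assoc)
    qed
    have A1: "?F u [A1 u v, A1 u v] = (\<Sum>i\<in>UNIV. \<Sum>j\<in>UNIV. (x i * x j) *\<^sub>R B i j)"
      unfolding A1_def higher_deriv_sums x_def B_def ..
    have A2: "?F u [A1 u v, A2 u v] = (\<Sum>i\<in>UNIV. \<Sum>j\<in>UNIV. \<Sum>k\<in>UNIV. (x i * t j k) *\<^sub>R C i j k)"
      unfolding A1_def A2_def higher_deriv_sum(2) higher_deriv_scaleR(2)
      by (simp add: higher_deriv_sum(3) higher_deriv_scaleR(3) scaleR_sum_right x_def t_def C_def)
    have A111: "?F u [A1 u v, A1 u v, A1 u v] = (\<Sum>i\<in>UNIV. \<Sum>j\<in>UNIV. \<Sum>k\<in>UNIV. (x i * x j * x k) *\<^sub>R E i j k)"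
      unfolding A1_def higher_deriv_sums x_def E_def ..
    let ?H3 = "\<Sum>i\<in>UNIV. \<Sum>j\<in>UNIV. \<Sum>k\<in>UNIV. (r k j i - c i k j - q i j k) *\<^sub>R E i j k"
    let ?H2 = "\<Sum>i\<in>UNIV. \<Sum>j\<in>UNIV. \<Sum>k\<in>UNIV. (x i * t j k - l i j k - c j i k - c j k i - q i j k - q j i k) *\<^sub>R C i j k"
    have tot: "?F u [A3 u v] + (1/2) *\<^sub>R ?F u [A1 u v, A1 u v] + ?F u [A1 u v, A2 u v]
        + (1/6) *\<^sub>R ?F u [A1 u v, A1 u v, A1 u v] + top u v
      = (\<Sum>i\<in>UNIV. germ (\<lambda>u. higher_deriv F u [f i u]) (\<lambda>\<tau>. W (graft i \<tau>)) u v)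
        + (\<Sum>i\<in>UNIV. \<Sum>j\<in>UNIV. germ (?G2 i j) (Q i j) u v) + ?H3 + ?H2"
      unfolding A1 A2 A111 G1 G2
      using ito_expansion_identity[where x = x and s = s and r = r and B = B and E = E and t = t and l = l
          and c = c and q = q and C = C, OF x2 B x3 E]
      by (simp add: add.assoc)
    have sym: "?F u [?r u v, A1 u v] = ?F u [A1 u v, ?r u v]" by (rule higher_deriv_swap[OF F])
    have sq: "?F u [dy u v, dy u v] = ?F u [A1 u v, A1 u v] + 2 *\<^sub>R ?F u [A1 u v, ?r u v] + ?F u [?r u v, ?r u v]"
      using sym by (simp add: higher_deriv_diff(2,3) scaleR_2)
    have cu: "?F u [dy u v, dy u v, dy u v] = ?F u [A1 u v, A1 u v, A1 u v]
        + (?F u [?r u v, dy u v, dy u v] + ?F u [A1 u v, ?r u v, dy u v] + ?F u [A1 u v, A1 u v, ?r u v])"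
      by (simp add: higher_deriv_diff(4-6))
    have tay: "(\<Sum>m<4. (1 / fact m) *\<^sub>R ?F u (replicate m (dy u v))) =
        F (y u) + ?F u [dy u v] + (1/2) *\<^sub>R ?F u [dy u v, dy u v] + (1/6) *\<^sub>R ?F u [dy u v, dy u v, dy u v]"
      by (simp add: eval_nat_numeral)
    have H3: "(\<Sum>i\<in>UNIV. \<Sum>j\<in>UNIV. \<Sum>k\<in>UNIV.
          (W (leaf k @ leaf j @ leaf i) u v - W (graft i (leaf k @ leaf j)) u v - Q i j (leaf k) u v) *\<^sub>R
          higher_deriv F (y u) [f i (y u), f j (y u), f k (y u)]) = ?H3"
      by (simp add: r_def c_def q_def E_def)
    have H2: "(\<Sum>i\<in>UNIV. \<Sum>j\<in>UNIV. \<Sum>k\<in>UNIV.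
          (W (leaf i @ graft j (leaf k)) u v + W (graft j (leaf k) @ leaf i) u v
           - W (graft i (graft j (leaf k))) u v - W (graft j (leaf i @ leaf k)) u v
           - W (graft j (leaf k @ leaf i)) u v - Q i j (leaf k) u v - Q j i (leaf k) u v) *\<^sub>R
          higher_deriv F (y u) [f i (y u), higher_deriv (f j) (y u) [f k (y u)]]) = ?H2"
      by (simp add: xt l_def c_def q_def C_def)
    have diffs: "?F u [dy u v - A3 u v] = ?F u [dy u v] - ?F u [A3 u v]"
      "?F u [A1 u v, ?r u v - A2 u v] = ?F u [A1 u v, ?r u v] - ?F u [A1 u v, A2 u v]"
      by (rule higher_deriv_diff)+
    show "F (y v) - F (y u) -
    ((\<Sum>i\<in>UNIV. germ (\<lambda>u. higher_deriv F u [f i u]) (\<lambda>\<tau>. W (graft i \<tau>)) u v)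
     + (\<Sum>i\<in>UNIV. \<Sum>j\<in>UNIV. germ (\<lambda>u. higher_deriv F u [f i u, f j u]) (Q i j) u v)
     + (\<Sum>i\<in>UNIV. \<Sum>j\<in>UNIV. \<Sum>k\<in>UNIV.
          (W (leaf k @ leaf j @ leaf i) u v - W (graft i (leaf k @ leaf j)) u v - Q i j (leaf k) u v) *\<^sub>R
          higher_deriv F (y u) [f i (y u), f j (y u), f k (y u)])
     + (\<Sum>i\<in>UNIV. \<Sum>j\<in>UNIV. \<Sum>k\<in>UNIV.
          (W (leaf i @ graft j (leaf k)) u v + W (graft j (leaf k) @ leaf i) u v
           - W (graft i (graft j (leaf k))) u v - W (graft j (leaf i @ leaf k)) u v
           - W (graft j (leaf k @ leaf i)) u v - Q i j (leaf k) u v - Q j i (leaf k) u v) *\<^sub>R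
          higher_deriv F (y u) [f i (y u), higher_deriv (f j) (y u) [f k (y u)]]))
     = (F (y v) - (\<Sum>m<4. (1 / fact m) *\<^sub>R ?F u (replicate m (dy u v))))
     + ?F u [dy u v - A3 u v]
     + ((1/2) *\<^sub>R ?F u [?r u v, ?r u v] + ?F u [A1 u v, ?r u v - A2 u v])
     + (1/6) *\<^sub>R (?F u [?r u v, dy u v, dy u v] + ?F u [A1 u v, ?r u v, dy u v] + ?F u [A1 u v, A1 u v, ?r u v])
     - top u v"
      unfolding H3 H2 tot[symmetric] tay sq cu diffs
      by (simp add: scaleR_add_right algebra_simps)
  qed
qed

end

section \<open>Rough and Young integrals of the expansion\<close>

lemma has_partition_integral_cong:
  assumes "s \<le> t" "\<And>u v. s \<le> u \<Longrightarrow> u < v \<Longrightarrow> v \<le> t \<Longrightarrow> \<Xi> u v = \<Theta> u v"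
  shows "has_partition_integral \<Xi> s t I \<longleftrightarrow> has_partition_integral \<Theta> s t I"
proof -
  have "partition_sum \<Xi> ps = partition_sum \<Theta> ps" if ps: "is_partition s t ps" for ps
    using ps assms(2) is_partition_mem[OF ps] by (intro partition_sum_cong) (auto simp: is_partition_def)
  then have "\<forall>\<^sub>F ps in partition_filter s t. partition_sum \<Xi> ps = partition_sum \<Theta> ps"
    unfolding eventually_partition_filter by (intro exI[of _ 1]) auto
  from tendsto_cong[OF this] show ?thesis using assms(1) by (simp add: has_partition_integral_def)
qed

lemma partition_integral_cong:
  assumes "s \<le> t" "\<And>u v. s \<le> u \<Longrightarrow> u < v \<Longrightarrow> v \<le> t \<Longrightarrow> \<Xi> u v = \<Theta> u v"
  shows "partition_integral \<Xi> s t = partition_integral \<Theta> s t"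
  using has_partition_integral_cong[OF assms] by (simp add: partition_integral_def)

lemma has_partition_integral_add:
  assumes "s \<le> t" "has_partition_integral \<Xi> s t I" "has_partition_integral \<Theta> s t J"
  shows "has_partition_integral (\<lambda>u v. \<Xi> u v + \<Theta> u v) s t (I + J)"
  using assms by (simp add: has_partition_integral_def partition_sum_add[abs_def] tendsto_add)

lemma has_partition_integral_sum:
  assumes "s \<le> t" "\<And>i. i \<in> A \<Longrightarrow> has_partition_integral (\<Xi> i) s t (I i)"
  shows "has_partition_integral (\<lambda>u v. \<Sum>i\<in>A. \<Xi> i u v) s t (\<Sum>i\<in>A. I i)"
  using assms by (simp add: has_partition_integral_def partition_sum_sum[abs_def] tendsto_sum)

lemma has_partition_integral_increment:
  assumes "germ_order T \<theta> (\<lambda>u v. g v - g u - \<Xi> u v)" "\<theta> > 1" "0 \<le> s" "s \<le> t" "t \<le> T"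
  shows "has_partition_integral \<Xi> s t (g t - g s)"
proof -
  obtain C where "C \<ge> 0" "\<And>u v. 0 \<le> u \<Longrightarrow> u < v \<Longrightarrow> v \<le> T \<Longrightarrow> norm (g v - g u - \<Xi> u v) \<le> C * (v - u) powr \<theta>"
    using germ_orderE[OF assms(1)] by blast
  then have "(partition_sum \<Xi> \<longlongrightarrow> g t - g s) (partition_filter s t)"
    using assms by (intro partition_sum_tendsto_increment[of \<theta> C]) (auto simp: norm_minus_commute)
  then show ?thesis using assms by (simp add: has_partition_integral_def)
qed

lemma has_partition_integral_partition_integral:
  "\<exists>I. has_partition_integral \<Xi> s t I \<Longrightarrow> has_partition_integral \<Xi> s t (partition_integral \<Xi> s t)"
  using partition_integral_eq by metis

context rde_expansion
begin

lemma germ_integrable: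
  assumes "smooth g" "integrator P" "0 \<le> s" "s \<le> t" "t \<le> T"
  shows "\<exists>I. has_partition_integral (germ g P) s t I"
  using germ_sewing[OF assms(1,2)] assms(3-) by metis

text \<open>The defect is an increment of \<open>z\<close>, of order \<open>3 * \<alpha>\<close>,
  times one of the integrand, of order \<open>\<alpha>\<close>; the Young condition is again
  \<open>4 * \<alpha> > 1\<close>.\<close>

lemma young_sewing:
  assumes "smooth p" "germ_order T (3 * \<alpha>) (\<lambda>u v. z v - z u)" "0 \<le> s" "s \<le> t" "t \<le> T"
  shows "\<exists>I. has_partition_integral (young_germ (\<lambda>r. p (y r)) z) s t I"
proof -
  have "defect_order T (4 * \<alpha>) (\<lambda>u m v. - ((z v - z m) *\<^sub>R (p (y m) - p (y u))))"
    by (intro defect_order_minus defect_order_scaleR[OF assms(2) remainder_0[OF assms(1)]])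
      (use \<alpha>_pos in simp_all)
  then have "defect_order T (4 * \<alpha>) (\<lambda>u m v. young_germ (\<lambda>r. p (y r)) z u v
      - young_germ (\<lambda>r. p (y r)) z u m - young_germ (\<lambda>r. p (y r)) z m v)"
    by (rule defect_order_cong) (simp add: young_germ_def algebra_simps)
  from sewing_defect_order[OF this \<alpha>_4] show ?thesis using assms by metis
qed

end

context rde_solution
begin

text \<open>The total germ integrates to the sum of the four families of integrals, and by
  \<open>ito_germ_order\<close> also to the increment of \<open>F\<close> along \<open>y\<close>;
  limits are unique.\<close>

theorem ito_formula:
  assumes F: "smooth F"
    and Q: "\<And>i j. integrator (Q i j)"
    and Q0: "\<And>i j u v. 0 \<le> u \<Longrightarrow> u < v \<Longrightarrow> v \<le> T \<Longrightarrow> Q i j [] u v = W (leaf j @ leaf i) u v - W (graft i (leaf j)) u v"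
    and Q1: "\<And>i j k. germ_order T (3 * \<alpha>) (Q i j (leaf k))"
    and Q2: "\<And>i j \<tau>. nodes \<tau> = 2 \<Longrightarrow> germ_order T (4 * \<alpha>) (Q i j \<tau>)"
    and zt: "\<And>i j k u v. 0 \<le> u \<Longrightarrow> u < v \<Longrightarrow> v \<le> T \<Longrightarrow> zt i j k v - zt i j k u =
      W (leaf k @ leaf j @ leaf i) u v - W (graft i (leaf k @ leaf j)) u v - Q i j (leaf k) u v"
    and zb: "\<And>i j k u v. 0 \<le> u \<Longrightarrow> u < v \<Longrightarrow> v \<le> T \<Longrightarrow> zb i j k v - zb i j k u =
      W (leaf i @ graft j (leaf k)) u v + W (graft j (leaf k) @ leaf i) u v
           - W (graft i (graft j (leaf k))) u v - W (graft j (leaf i @ leaf k)) u v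
           - W (graft j (leaf k @ leaf i)) u v - Q i j (leaf k) u v - Q j i (leaf k) u v"
    and st: "0 \<le> s" "s \<le> t" "t \<le> T"
  shows "\<exists>I1 I2 I3 I4.
    (\<forall>i. has_partition_integral (germ (\<lambda>u. higher_deriv F u [f i u]) (\<lambda>\<tau>. W (graft i \<tau>))) s t (I1 i)) \<and>
    (\<forall>i j. has_partition_integral (germ (\<lambda>u. higher_deriv F u [f i u, f j u]) (Q i j)) s t (I2 i j)) \<and>
    (\<forall>i j k. has_partition_integral (young_germ (\<lambda>r. higher_deriv F (y r) [f i (y r), f j (y r), f k (y r)]) (zt i j k)) s t (I3 i j k)) \<and>
    (\<forall>i j k. has_partition_integral (young_germ (\<lambda>r. higher_deriv F (y r) [f i (y r), higher_deriv (f j) (y r) [f k (y r)]]) (zb i j k)) s t (I4 i j k)) \<and>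
    F (y t) - F (y s) = (\<Sum>i\<in>UNIV. I1 i) + (\<Sum>i\<in>UNIV. \<Sum>j\<in>UNIV. I2 i j)
      + (\<Sum>i\<in>UNIV. \<Sum>j\<in>UNIV. \<Sum>k\<in>UNIV. I3 i j k) + (\<Sum>i\<in>UNIV. \<Sum>j\<in>UNIV. \<Sum>k\<in>UNIV. I4 i j k)"
proof -
  let ?g1 = "\<lambda>i. germ (\<lambda>u. higher_deriv F u [f i u]) (\<lambda>\<tau>. W (graft i \<tau>))"
  let ?g2 = "\<lambda>i j. germ (\<lambda>u. higher_deriv F u [f i u, f j u]) (Q i j)"
  let ?g3 = "\<lambda>i j k. young_germ (\<lambda>r. higher_deriv F (y r) [f i (y r), f j (y r), f k (y r)]) (zt i j k)"
  let ?g4 = "\<lambda>i j k. young_germ (\<lambda>r. higher_deriv F (y r) [f i (y r), higher_deriv (f j) (y r) [f k (y r)]]) (zb i j k)"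
  have W3: "germ_order T (3 * \<alpha>) (W \<tau>)" if "nodes \<tau> = 3" for \<tau>
    using W_order[of \<tau>] that by simp
  \<comment> \<open>The regularity of \<open>zt\<close> is read off its increments: every forest in
    them has weight three, the bracket letter counting twice.\<close>
  have zt_order: "germ_order T (3 * \<alpha>) (\<lambda>u v. zt i j k v - zt i j k u)" for i j k
  proof -
    have "germ_order T (3 * \<alpha>) (\<lambda>u v. W (leaf k @ leaf j @ leaf i) u v - W (graft i (leaf k @ leaf j)) u v - Q i j (leaf k) u v)"
      by (intro germ_order_diff W3 Q1) simp_all
    then show ?thesis by (rule germ_order_cong) (rule zt)
  qed
  have zb_order: "germ_order T (3 * \<alpha>) (\<lambda>u v. zb i j k v - zb i j k u)" for i j k
  proof -
    have "germ_order T (3 * \<alpha>) (\<lambda>u v. W (leaf i @ graft j (leaf k)) u v + W (graft j (leaf k) @ leaf i) u v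
           - W (graft i (graft j (leaf k))) u v - W (graft j (leaf i @ leaf k)) u v
           - W (graft j (leaf k @ leaf i)) u v - Q i j (leaf k) u v - Q j i (leaf k) u v)"
      by (intro germ_order_diff germ_order_add W3 Q1) simp_all
    then show ?thesis by (rule germ_order_cong) (rule zb)
  qed
  define I1 where "I1 = (\<lambda>i. partition_integral (?g1 i) s t)"
  define I2 where "I2 = (\<lambda>i j. partition_integral (?g2 i j) s t)"
  define I3 where "I3 = (\<lambda>i j k. partition_integral (?g3 i j k) s t)"
  define I4 where "I4 = (\<lambda>i j k. partition_integral (?g4 i j k) s t)"
  have I1: "has_partition_integral (?g1 i) s t (I1 i)" for i
    unfolding I1_def
    by (intro has_partition_integral_partition_integral germ_integrable smooth_higher_deriv_1 F smooth_f W_integrator st)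
  have I2: "has_partition_integral (?g2 i j) s t (I2 i j)" for i j
    unfolding I2_def
    by (intro has_partition_integral_partition_integral germ_integrable smooth_higher_deriv_2 F smooth_f Q st)
  have I3: "has_partition_integral (?g3 i j k) s t (I3 i j k)" for i j k
    unfolding I3_def
    by (rule has_partition_integral_partition_integral[OF
        young_sewing[OF smooth_higher_deriv_3[OF F smooth_f smooth_f smooth_f] zt_order st]])
  have I4: "has_partition_integral (?g4 i j k) s t (I4 i j k)" for i j k
    unfolding I4_def
    by (rule has_partition_integral_partition_integral[OF
        young_sewing[OF smooth_higher_deriv_2[OF F smooth_f smooth_higher_deriv_1[OF smooth_f smooth_f]] zb_order st]])
  let ?tot = "\<lambda>u v. (\<Sum>i\<in>UNIV. ?g1 i u v) + (\<Sum>i\<in>UNIV. \<Sum>j\<in>UNIV. ?g2 i j u v)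
     + (\<Sum>i\<in>UNIV. \<Sum>j\<in>UNIV. \<Sum>k\<in>UNIV. ?g3 i j k u v) + (\<Sum>i\<in>UNIV. \<Sum>j\<in>UNIV. \<Sum>k\<in>UNIV. ?g4 i j k u v)"
  have "has_partition_integral ?tot s t ((\<Sum>i\<in>UNIV. I1 i) + (\<Sum>i\<in>UNIV. \<Sum>j\<in>UNIV. I2 i j)
      + (\<Sum>i\<in>UNIV. \<Sum>j\<in>UNIV. \<Sum>k\<in>UNIV. I3 i j k) + (\<Sum>i\<in>UNIV. \<Sum>j\<in>UNIV. \<Sum>k\<in>UNIV. I4 i j k))"
    by (intro has_partition_integral_add has_partition_integral_sum st I1 I2 I3 I4)
  moreover have "germ_order T (4 * \<alpha>) (\<lambda>u v. F (y v) - F (y u) - ?tot u v)"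
    by (rule germ_order_cong[OF ito_germ_order[where Q = Q, OF F Q0 Q2]]) (simp_all add: young_germ_def zt zb)
  then have "has_partition_integral ?tot s t (F (y t) - F (y s))"
    using has_partition_integral_increment[of T "4 * \<alpha>" "\<lambda>r. F (y r)" ?tot s t] \<alpha>_4 st by simp
  ultimately have eq: "F (y t) - F (y s) = (\<Sum>i\<in>UNIV. I1 i) + (\<Sum>i\<in>UNIV. \<Sum>j\<in>UNIV. I2 i j)
      + (\<Sum>i\<in>UNIV. \<Sum>j\<in>UNIV. \<Sum>k\<in>UNIV. I3 i j k) + (\<Sum>i\<in>UNIV. \<Sum>j\<in>UNIV. \<Sum>k\<in>UNIV. I4 i j k)"
    by (rule has_partition_integral_unique[rotated])
  show ?thesis by (intro exI conjI allI) (rule I1 I2 I3 I4 eq)+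
qed

end

section \<open>Coefficients of the rough paths and of the solution\<close>

lemma germ_order_of_quotient_bound:
  fixes R :: "real \<Rightarrow> real \<Rightarrow> real"
  assumes "\<exists>C. \<forall>s\<in>{0..T}. \<forall>t\<in>{0..T}. s \<noteq> t \<longrightarrow> \<bar>R s t\<bar> / \<bar>t - s\<bar> powr \<beta> \<le> C"
  shows "germ_order T \<beta> R"
proof -
  obtain C where C: "\<And>s t. s\<in>{0..T} \<Longrightarrow> t\<in>{0..T} \<Longrightarrow> s \<noteq> t \<Longrightarrow> \<bar>R s t\<bar> / \<bar>t - s\<bar> powr \<beta> \<le> C"
    using assms by blast
  show ?thesis
  proof (rule germ_orderI)
    fix u v assume uv: "0 \<le> u" "u < v" "v \<le> T"
    then show "norm (R u v) \<le> C * (v - u) powr \<beta>"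
      using C[of u v] by (simp add: pos_divide_le_eq)
  qed
qed

lemma rough_path_order:
  assumes Z: "planarly_branched_rough_path \<alpha> T Z" and "nodes \<tau> \<le> level \<alpha>"
  shows "germ_order T (real (nodes \<tau>) * \<alpha>) (\<lambda>u v. Poly_Mapping.lookup (Z u v) \<tau>)"
  using Z[unfolded planarly_branched_rough_path_def, THEN conjunct2, THEN conjunct2, THEN conjunct2,
      rule_format, of \<tau>] assms(2)
  by (intro germ_order_of_quotient_bound) (auto simp: forests_upto_def)

lemma bracket_order:
  assumes Z: "bracket_homogeneous \<alpha> T Z" and "nodes \<tau> \<le> level \<alpha> - 1"
  shows "germ_order T (real (nodes \<tau> + 2) * \<alpha>) (\<lambda>u v. Poly_Mapping.lookup (Z u v) (graft (br i j) (embed_forest \<tau>)))"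
proof (rule germ_order_of_quotient_bound)
  have "\<tau> \<in> forests_upto (level \<alpha> - 1)" using assms by (simp add: forests_upto_def)
  from Z[unfolded bracket_homogeneous_def, THEN spec, THEN spec, THEN bspec, OF this, of i j]
  show "\<exists>C. \<forall>s\<in>{0..T}. \<forall>t\<in>{0..T}. s \<noteq> t \<longrightarrow>
    \<bar>Poly_Mapping.lookup (Z s t) (graft (br i j) (embed_forest \<tau>))\<bar> / \<bar>t - s\<bar> powr (real (nodes \<tau> + 2) * \<alpha>) \<le> C"
    unfolding pairing_basis .
qed

text \<open>Germs involve trees with a given root only. Their coproducts unfold by
  \<open>coprod_graft\<close>, together with \<open>coprod_leaf_leaf\<close> for the cherry.\<close>

lemma rough_path_chen:
  assumes Z: "planarly_branched_rough_path \<alpha> T Z" and N: "level \<alpha> = 3"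
    and s: "s \<in> {0..T}" and u: "u \<in> {0..T}" and t: "t \<in> {0..T}"
  shows "Poly_Mapping.lookup (Z s t) (leaf b) = Poly_Mapping.lookup (Z s u) (leaf b) + Poly_Mapping.lookup (Z u t) (leaf b)"
    "Poly_Mapping.lookup (Z s t) (graft b (leaf k)) = Poly_Mapping.lookup (Z s u) (graft b (leaf k))
       + Poly_Mapping.lookup (Z s u) (leaf k) * Poly_Mapping.lookup (Z u t) (leaf b)
       + Poly_Mapping.lookup (Z u t) (graft b (leaf k))"
    "Poly_Mapping.lookup (Z s t) (graft b (graft j (leaf k))) = Poly_Mapping.lookup (Z s u) (graft b (graft j (leaf k)))
       + Poly_Mapping.lookup (Z s u) (graft j (leaf k)) * Poly_Mapping.lookup (Z u t) (leaf b)
       + Poly_Mapping.lookup (Z s u) (leaf k) * Poly_Mapping.lookup (Z u t) (graft b (leaf j))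
       + Poly_Mapping.lookup (Z u t) (graft b (graft j (leaf k)))"
    "Poly_Mapping.lookup (Z s t) (graft b (leaf k @ leaf j)) = Poly_Mapping.lookup (Z s u) (graft b (leaf k @ leaf j))
       + Poly_Mapping.lookup (Z s u) (leaf k @ leaf j) * Poly_Mapping.lookup (Z u t) (leaf b)
       + Poly_Mapping.lookup (Z s u) (leaf k) * Poly_Mapping.lookup (Z u t) (graft b (leaf j))
       + Poly_Mapping.lookup (Z u t) (graft b (leaf k @ leaf j))"
proof -
  have one: "Poly_Mapping.lookup (Z s u) [] = 1" "Poly_Mapping.lookup (Z u t) [] = 1"
    using Z s u t unfolding planarly_branched_rough_path_def by auto
  have star: "star 3 (Z s u) (Z u t) = Z s t"
    using Z s u t N unfolding planarly_branched_rough_path_def by metis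
  have *: "Poly_Mapping.lookup (Z s t) \<tau> = pairing (tensor (Z s u) (Z u t)) (coprod \<tau>)" if "nodes \<tau> \<le> 3" for \<tau>
    using lookup_star[of 3 "Z s u" "Z u t" \<tau>] that by (simp add: star)
  show "Poly_Mapping.lookup (Z s t) (leaf b) = Poly_Mapping.lookup (Z s u) (leaf b) + Poly_Mapping.lookup (Z u t) (leaf b)"
    by (subst *) (simp_all add: coprod_graft lin_ext_add pairing_add lookup_tensor one)
  show "Poly_Mapping.lookup (Z s t) (graft b (leaf k)) = Poly_Mapping.lookup (Z s u) (graft b (leaf k))
       + Poly_Mapping.lookup (Z s u) (leaf k) * Poly_Mapping.lookup (Z u t) (leaf b)
       + Poly_Mapping.lookup (Z u t) (graft b (leaf k))"
    by (subst *) (simp_all add: coprod_graft lin_ext_add pairing_add lookup_tensor one)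
  show "Poly_Mapping.lookup (Z s t) (graft b (graft j (leaf k))) = Poly_Mapping.lookup (Z s u) (graft b (graft j (leaf k)))
       + Poly_Mapping.lookup (Z s u) (graft j (leaf k)) * Poly_Mapping.lookup (Z u t) (leaf b)
       + Poly_Mapping.lookup (Z s u) (leaf k) * Poly_Mapping.lookup (Z u t) (graft b (leaf j))
       + Poly_Mapping.lookup (Z u t) (graft b (graft j (leaf k)))"
    by (subst *) (simp_all add: coprod_graft lin_ext_add pairing_add lookup_tensor one)
  show "Poly_Mapping.lookup (Z s t) (graft b (leaf k @ leaf j)) = Poly_Mapping.lookup (Z s u) (graft b (leaf k @ leaf j))
       + Poly_Mapping.lookup (Z s u) (leaf k @ leaf j) * Poly_Mapping.lookup (Z u t) (leaf b)
       + Poly_Mapping.lookup (Z s u) (leaf k) * Poly_Mapping.lookup (Z u t) (graft b (leaf j))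
       + Poly_Mapping.lookup (Z u t) (graft b (leaf k @ leaf j))"
    by (subst *) (simp_all add: coprod_graft coprod_leaf_leaf lin_ext_add pairing_add lookup_tensor one)
qed

lemma rough_path_shuffle:
  assumes Z: "planarly_branched_rough_path \<alpha> T Z" and s: "s \<in> {0..T}" and t: "t \<in> {0..T}"
  shows "nodes [a, b] \<le> level \<alpha> \<Longrightarrow> Poly_Mapping.lookup (Z s t) [a] * Poly_Mapping.lookup (Z s t) [b] =
      Poly_Mapping.lookup (Z s t) [a, b] + Poly_Mapping.lookup (Z s t) [b, a]"
    "nodes [a, b, c] \<le> level \<alpha> \<Longrightarrow> Poly_Mapping.lookup (Z s t) [a] * Poly_Mapping.lookup (Z s t) [b, c] =
      Poly_Mapping.lookup (Z s t) [a, b, c] + Poly_Mapping.lookup (Z s t) [b, a, c] + Poly_Mapping.lookup (Z s t) [b, c, a]"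
proof -
  have *: "pairing (Z s t) (shuffle_words \<sigma> \<tau>) = Poly_Mapping.lookup (Z s t) \<sigma> * Poly_Mapping.lookup (Z s t) \<tau>"
    if "nodes \<sigma> + nodes \<tau> \<le> level \<alpha>" for \<sigma> \<tau>
    using Z s t that unfolding planarly_branched_rough_path_def shuffle_basis pairing_basis by blast
  show "nodes [a, b] \<le> level \<alpha> \<Longrightarrow> Poly_Mapping.lookup (Z s t) [a] * Poly_Mapping.lookup (Z s t) [b] =
      Poly_Mapping.lookup (Z s t) [a, b] + Poly_Mapping.lookup (Z s t) [b, a]"
    using *[of "[a]" "[b]"] by (simp add: nodes_def shuffle_words_singletons pairing_add del: shuffle_words.simps)
  show "nodes [a, b, c] \<le> level \<alpha> \<Longrightarrow> Poly_Mapping.lookup (Z s t) [a] * Poly_Mapping.lookup (Z s t) [b, c] =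
      Poly_Mapping.lookup (Z s t) [a, b, c] + Poly_Mapping.lookup (Z s t) [b, a, c] + Poly_Mapping.lookup (Z s t) [b, c, a]"
    using *[of "[a]" "[b, c]"] by (simp add: nodes_def shuffle_words_singletons pairing_add del: shuffle_words.simps)
qed

lemma vpairing_eq_sum:
  assumes "finite S" "\<And>c. Poly_Mapping.keys (y $ c) \<subseteq> S"
  shows "vpairing x y = (\<Sum>\<tau>\<in>S. Poly_Mapping.lookup x \<tau> *\<^sub>R vpairing (basis \<tau>) y)"
  by (simp add: vec_eq_iff vpairing_basis)
    (simp add: vpairing_def pairing_lookup lin_ext_superset[OF assms] mult.commute)

text \<open>The empty forest is a right unit of \<open>star\<close>; the few forests that can pair
  with a controlled path are checked directly.\<close>

lemma lookup_star_unit: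
  "Poly_Mapping.lookup (star 3 x (basis [])) [] = Poly_Mapping.lookup x []"
  "Poly_Mapping.lookup (star 3 x (basis [])) (leaf k) = Poly_Mapping.lookup x (leaf k)"
  "Poly_Mapping.lookup (star 3 x (basis [])) (graft j (leaf k)) = Poly_Mapping.lookup x (graft j (leaf k))"
  "Poly_Mapping.lookup (star 3 x (basis [])) (leaf k @ leaf j) = Poly_Mapping.lookup x (leaf k @ leaf j)"
  by (simp_all add: lookup_star coprod_graft coprod_leaf_leaf lin_ext_add pairing_add lookup_tensor lookup_basis)

lemma rough_integral_eq: "rough_integral N X Y b s t = partition_integral (rough_germ N X Y b) s t"
  by (simp add: rough_integral_def partition_integral_def)

lemma young_integral_eq: "young_integral G H s t = partition_integral (young_germ G H) s t"
  by (simp add: young_integral_def partition_integral_def)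

text \<open>The coefficient equations are recursive: the ladder coefficient is the lift of
  \<open>f j\<close> at one leaf, which in turn needs the leaf coefficient.\<close>

lemma solves_rde_coeffs:
  fixes f :: "'d::finite \<Rightarrow> real^'n::finite \<Rightarrow> real^'n"
  assumes Y: "solves_rde \<alpha> T X f \<xi> Y" and N: "level \<alpha> = 3" and t: "t \<in> {0..T}"
    and y: "y = vpairing (basis []) (Y t)"
  shows "vpairing (basis (leaf k)) (Y t) = f k y"
    "vpairing (basis (graft j (leaf k))) (Y t) = higher_deriv (f j) y [f k y]"
    "vpairing (basis (leaf k @ leaf j)) (Y t) = 0"
proof -
  have graft: "vpairing (basis (graft i \<tau>)) (Y t) = vpairing (basis \<tau>) (lift_path 2 (f i) (Y t))"
    if "nodes \<tau> \<le> 1" for i \<tau>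
    using Y t that unfolding solves_rde_def N by (auto simp: numeral_3_eq_3 numeral_2_eq_2)
  show leaf: "vpairing (basis (leaf k)) (Y t) = f k y" for k
    by (simp add: graft vpairing_lift_path lift_coeff_2 y)
  show "vpairing (basis (graft j (leaf k))) (Y t) = higher_deriv (f j) y [f k y]"
    by (simp add: graft vpairing_lift_path lift_coeff_2 leaf y[symmetric])
  show "vpairing (basis (leaf k @ leaf j)) (Y t) = 0"
    using Y t unfolding solves_rde_def N by (auto simp: forests_upto_def)
qed

text \<open>\<open>c\<close> is arbitrary so that coefficients of \<open>X\<close> and of its
  bracket extension can both be inserted.\<close>

lemma lift_path_solution:
  fixes f :: "'d::finite \<Rightarrow> real^'n::finite \<Rightarrow> real^'n"
  assumes "solves_rde \<alpha> T X f \<xi> Y" "level \<alpha> = 3" "t \<in> {0..T}" and y: "y = vpairing (basis []) (Y t)"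
  shows "(\<Sum>\<tau>\<in>forests_upto 2. c \<tau> *\<^sub>R vpairing (basis \<tau>) (lift_path 2 g (Y t))) =
    c [] *\<^sub>R g y + (\<Sum>k\<in>UNIV. c (leaf k) *\<^sub>R higher_deriv g y [f k y])
    + (\<Sum>j\<in>UNIV. \<Sum>k\<in>UNIV. c (graft j (leaf k)) *\<^sub>R higher_deriv g y [higher_deriv (f j) y [f k y]])
    + (\<Sum>j\<in>UNIV. \<Sum>k\<in>UNIV. c (leaf k @ leaf j) *\<^sub>R higher_deriv g y [f k y, f j y])"
  using solves_rde_coeffs[OF assms]
  by (simp add: sum_forests_upto_2 vpairing_lift_path lift_coeff_2 y[symmetric])

theorem theorem3p8:
  fixes \<alpha> T :: real
    and X :: "real \<Rightarrow> real \<Rightarrow> 'd::finite forest \<Rightarrow>\<^sub>0 real" and x :: "real \<Rightarrow> real^'d"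
    and Xh :: "real \<Rightarrow> real \<Rightarrow> 'd bletter forest \<Rightarrow>\<^sub>0 real"
    and xh :: "'d \<Rightarrow> 'd \<Rightarrow> real \<Rightarrow> real"
    and xt xb :: "'d \<Rightarrow> 'd \<Rightarrow> 'd \<Rightarrow> real \<Rightarrow> real"
    and f :: "'d \<Rightarrow> real^'n::finite \<Rightarrow> real^'n" and F :: "real^'n \<Rightarrow> real^'n"
    and \<xi> :: "real^'n"
    and Y :: "real \<Rightarrow> ('d forest \<Rightarrow>\<^sub>0 real)^'n" and y :: "real \<Rightarrow> real^'n"
  defines "G1 \<equiv> \<lambda>i u. higher_deriv F u [f i u]"
    and "G2 \<equiv> \<lambda>i j u. higher_deriv F u [f i u, f j u]"
    and "H3 \<equiv> \<lambda>i j k r. higher_deriv F (y r) [f i (y r), f j (y r), f k (y r)]"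
    and "H2 \<equiv> \<lambda>i j k r. higher_deriv F (y r) [f i (y r), higher_deriv (f j) (y r) [f k (y r)]]"
    and "N \<equiv> level \<alpha>"
  assumes "1/4 < \<alpha>" "\<alpha> \<le> 1/3" and "0 < T"
    and "planarly_branched_rough_path \<alpha> T X"
    and "lies_above T X (\<lambda>i t. x t $ i)"
    and "\<And>i. smooth (f i)" and "smooth F"
    and "solves_rde \<alpha> T X f \<xi> Y"
    and "\<And>t. t \<in> {0..T} \<Longrightarrow> y t = vpairing (basis []) (Y t)"
    and "bracket_extension \<alpha> T X Xh" and "bracket_homogeneous \<alpha> T Xh"
    and "lies_above T Xh (case_sum (\<lambda>i t. x t $ i) (\<lambda>(i, j). xh i j))"
    and "\<And>i j k s t. s \<in> {0..T} \<Longrightarrow> t \<in> {0..T} \<Longrightarrow>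
           xt i j k t - xt i j k s = pairing (Xh s t) (tilde_elem i j k)"
    and "\<And>i j k s t. s \<in> {0..T} \<Longrightarrow> t \<in> {0..T} \<Longrightarrow>
           xb i j k t - xb i j k s = pairing (Xh s t) (bar_elem i j k)"
    and "s \<in> {0..T}" "t \<in> {0..T}"
  shows "(\<forall>i. rough_integrable N X (\<lambda>r. lift_path (N - 1) (G1 i) (Y r)) i s t) \<and>
    (\<forall>i j. rough_integrable N Xh (\<lambda>r. extend_path (lift_path (N - 1) (G2 i j) (Y r))) (br i j) s t) \<and>
    (\<forall>i j k. young_integrable (H3 i j k) (xt i j k) s t) \<and>
    (\<forall>i j k. young_integrable (H2 i j k) (xb i j k) s t) \<and>
    F (y t) - F (y s) =
      (\<Sum>i\<in>UNIV. rough_integral N X (\<lambda>r. lift_path (N - 1) (G1 i) (Y r)) i s t) +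
      (\<Sum>i\<in>UNIV. \<Sum>j\<in>UNIV.
         rough_integral N Xh (\<lambda>r. extend_path (lift_path (N - 1) (G2 i j) (Y r))) (br i j) s t) +
      (\<Sum>i\<in>UNIV. \<Sum>j\<in>UNIV. \<Sum>k\<in>UNIV. young_integral (H3 i j k) (xt i j k) s t) +
      (\<Sum>i\<in>UNIV. \<Sum>j\<in>UNIV. \<Sum>k\<in>UNIV. young_integral (H2 i j k) (xb i j k) s t)"
proof -
  have N3: "level \<alpha> = 3"
  proof -
    have "\<lfloor>1 / \<alpha>\<rfloor> = 3"
      using \<open>1/4 < \<alpha>\<close> \<open>\<alpha> \<le> 1/3\<close> by (intro floor_unique) (auto simp: field_simps)
    then show ?thesis by (simp add: level_def)
  qed
  have N: "N = 3" by (simp add: N_def N3)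
  note X = \<open>planarly_branched_rough_path \<alpha> T X\<close>
  note Y = \<open>solves_rde \<alpha> T X f \<xi> Y\<close>
  note f = \<open>\<And>i. smooth (f i)\<close>
  note y = \<open>\<And>t. t \<in> {0..T} \<Longrightarrow> y t = vpairing (basis []) (Y t)\<close>
  have Xh: "planarly_branched_rough_path \<alpha> T Xh"
    using \<open>bracket_extension \<alpha> T X Xh\<close> by (simp add: bracket_extension_def)
  define W where "W = (\<lambda>\<tau> u v. Poly_Mapping.lookup (X u v) \<tau>)"
  define Q where "Q = (\<lambda>i j \<tau> u v. Poly_Mapping.lookup (Xh u v) (graft (br i j) (embed_forest \<tau>)))"
  have Xh_embed: "Poly_Mapping.lookup (Xh u v) (embed_forest \<tau>) = W \<tau> u v"
    if "nodes \<tau> \<le> 3" "u \<in> {0..T}" "v \<in> {0..T}" for u v \<tau>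
    using \<open>bracket_extension \<alpha> T X Xh\<close> that
    unfolding bracket_extension_def N3 W_def forests_upto_def pairing_basis by blast
  have Q_Nil: "Q i j [] u v = W (leaf j @ leaf i) u v - W (graft i (leaf j)) u v"
    if "u \<in> {0..T}" "v \<in> {0..T}" for i j u v
    using \<open>bracket_extension \<alpha> T X Xh\<close> that
    unfolding bracket_extension_def pairing_basis pairing_diff Q_def W_def by simp
  \<comment> \<open>This is controlledness at the empty forest, with the coefficients of a solution
    inserted.\<close>
  have y_order: "germ_order T (3 * \<alpha>) (\<lambda>u v. y v - y u - (\<Sum>i\<in>UNIV. W (leaf i) u v *\<^sub>R f i (y u))
      - (\<Sum>j\<in>UNIV. \<Sum>k\<in>UNIV. W (graft j (leaf k)) u v *\<^sub>R higher_deriv (f j) (y u) [f k (y u)]))"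
  proof -
    have Yc: "controlled_path \<alpha> T X Y" using Y by (simp add: solves_rde_def)
    then have keys: "Poly_Mapping.keys (Y t $ c) \<subseteq> forests_upto 2" if "t \<in> {0..T}" for t c
      using that by (simp add: controlled_path_def N3)
    have "\<exists>C. \<forall>s\<in>{0..T}. \<forall>t\<in>{0..T}. norm (vpairing (basis []) (Y t) - vpairing (star 3 (X s t) (basis [])) (Y s))
        \<le> C * \<bar>t - s\<bar> powr (3 * \<alpha>)"
      using Yc[unfolded controlled_path_def N3, THEN conjunct2, rule_format, of "[]"] by (simp add: forests_upto_def)
    then obtain C where C: "\<And>s t. s \<in> {0..T} \<Longrightarrow> t \<in> {0..T} \<Longrightarrow>
        norm (vpairing (basis []) (Y t) - vpairing (star 3 (X s t) (basis [])) (Y s)) \<le> C * \<bar>t - s\<bar> powr (3 * \<alpha>)"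
      by blast
    show ?thesis
    proof (rule germ_orderI)
      fix u v assume uv: "0 \<le> u" "u < v" "v \<le> T"
      then have u: "u \<in> {0..T}" and v: "v \<in> {0..T}" by auto
      have one: "Poly_Mapping.lookup (X u v) [] = 1"
        using X u v unfolding planarly_branched_rough_path_def by auto
      have "vpairing (star 3 (X u v) (basis [])) (Y u) = y u + (\<Sum>i\<in>UNIV. W (leaf i) u v *\<^sub>R f i (y u))
          + (\<Sum>j\<in>UNIV. \<Sum>k\<in>UNIV. W (graft j (leaf k)) u v *\<^sub>R higher_deriv (f j) (y u) [f k (y u)])"
        by (subst vpairing_eq_sum[OF finite_forests_upto keys[OF u]])
          (simp only: sum_forests_upto_2 lookup_star_unit solves_rde_coeffs[OF Y N3 u y[OF u]] one
            y[OF u, symmetric] W_def scaleR_one scaleR_zero_right sum.neutral_const add_0_right)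
      then show "norm (y v - y u - (\<Sum>i\<in>UNIV. W (leaf i) u v *\<^sub>R f i (y u))
          - (\<Sum>j\<in>UNIV. \<Sum>k\<in>UNIV. W (graft j (leaf k)) u v *\<^sub>R higher_deriv (f j) (y u) [f k (y u)]))
          \<le> C * (v - u) powr (3 * \<alpha>)"
        using C[OF u v] uv by (simp add: y[OF v, symmetric] diff_diff_eq)
    qed
  qed
  have exp: "rde_expansion \<alpha> T f y W"
  proof
    show "0 < \<alpha>" "1 < 4 * \<alpha>" using \<open>1/4 < \<alpha>\<close> by auto
    show "smooth (f i)" for i by (rule f)
    show "germ_order T (real (nodes \<tau>) * \<alpha>) (W \<tau>)" if "nodes \<tau> \<le> 3" for \<tau>
      using rough_path_order[OF X, of \<tau>] that by (simp add: N3 W_def)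
    show "W [a] u v * W [b] u v = W [a, b] u v + W [b, a] u v"
      if "0 \<le> u" "u < v" "v \<le> T" "nodes [a, b] \<le> 3" for a b u v
      using rough_path_shuffle(1)[OF X, of u v a b] that by (simp add: N3 W_def)
    show "W [a] u v * W [b, c] u v = W [a, b, c] u v + W [b, a, c] u v + W [b, c, a] u v"
      if "0 \<le> u" "u < v" "v \<le> T" "nodes [a, b, c] \<le> 3" for a b c u v
      using rough_path_shuffle(2)[OF X, of u v a b c] that by (simp add: N3 W_def)
  qed (rule y_order)
  interpret rde_expansion \<alpha> T f y W by (rule exp)
  have germ_X: "rough_germ N X (\<lambda>r. lift_path (N - 1) g (Y r)) i u v = germ g (\<lambda>\<tau>. W (graft i \<tau>)) u v"
    if u: "u \<in> {0..T}" for g i u v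
    using lift_path_solution[OF Y N3 u y[OF u], of "\<lambda>\<tau>. W (graft i \<tau>) u v" g]
    by (simp add: rough_germ_def germ_def N W_def)
  have germ_Xh: "rough_germ N Xh (\<lambda>r. extend_path (lift_path (N - 1) g (Y r))) (br i j) u v = germ g (Q i j) u v"
    if u: "u \<in> {0..T}" for g i j u v
    using lift_path_solution[OF Y N3 u y[OF u], of "\<lambda>\<tau>. Q i j \<tau> u v" g]
    by (simp add: rough_germ_extend_path germ_def N Q_def)
  have int_W: "integrator (\<lambda>\<tau>. W (graft i \<tau>))" for i
    unfolding integrator_def
  proof (intro conjI allI impI)
    fix \<tau> :: "'d forest" assume "nodes \<tau> \<le> 2"
    then show "germ_order T (real (Suc (nodes \<tau>)) * \<alpha>) (W (graft i \<tau>))"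
      using W_order[of "graft i \<tau>"] by simp
  qed (unfold W_def, (rule rough_path_chen[OF X N3]; simp)+)
  have int_Q: "integrator (Q i j)" for i j
    unfolding integrator_def
  proof (intro conjI allI impI)
    fix \<tau> :: "'d forest" assume "nodes \<tau> \<le> 2"
    then show "germ_order T (real (Suc (nodes \<tau>)) * \<alpha>) (Q i j \<tau>)"
      using rough_path_order[OF Xh, of "graft (br i j) (embed_forest \<tau>)"] by (simp add: N3 Q_def)
  next
    fix u m v k l assume uv: "0 \<le> u" "u < m" "m < v" "v \<le> T"
    then have mem: "u \<in> {0..T}" "m \<in> {0..T}" "v \<in> {0..T}" by auto
    \<comment> \<open>A cut below the root \<open>(ij)\<close> prunes a forest over the small
      alphabet, on which the extension agrees with \<open>X\<close>.\<close>
    note W = Xh_embed[OF _ mem(1,2), symmetric]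
    note chen = rough_path_chen[OF Xh N3 mem, of "br i j"]
    show "Q i j [] u v = Q i j [] u m + Q i j [] m v"
      using chen(1) by (simp add: Q_def)
    show "Q i j (leaf k) u v = Q i j (leaf k) u m + W (leaf k) u m * Q i j [] m v + Q i j (leaf k) m v"
      using chen(2)[of "Inl k"] by (simp add: Q_def W)
    show "Q i j (graft l (leaf k)) u v = Q i j (graft l (leaf k)) u m + W (graft l (leaf k)) u m * Q i j [] m v
        + W (leaf k) u m * Q i j (leaf l) m v + Q i j (graft l (leaf k)) m v"
      using chen(3)[of "Inl l" "Inl k"] by (simp add: Q_def W)
    show "Q i j (leaf k @ leaf l) u v = Q i j (leaf k @ leaf l) u m + W (leaf k @ leaf l) u m * Q i j [] m v
        + W (leaf k) u m * Q i j (leaf l) m v + Q i j (leaf k @ leaf l) m v"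
      using chen(4)[of "Inl k" "Inl l"] by (simp add: Q_def W)
  qed
  have "rde_solution \<alpha> T f y W \<xi>"
  proof
    fix t assume t: "t \<in> {0..T}"
    have "y t = \<xi> + (\<Sum>i\<in>UNIV. rough_integral N X (\<lambda>r. lift_path (N - 1) (f i) (Y r)) i 0 t)"
      using Y t unfolding y[OF t] solves_rde_def N_def by blast
    \<comment> \<open>The germs agree for base points between 0 and \<open>T\<close>, which is where
      a partition of \<open>[0, t]\<close> has them.\<close>
    also have "\<dots> = \<xi> + (\<Sum>i\<in>UNIV. partition_integral (germ (f i) (\<lambda>\<tau>. W (graft i \<tau>))) 0 t)"
      unfolding rough_integral_eq using t germ_X
      by (intro arg_cong2[where f = "(+)"] refl sum.cong partition_integral_cong) auto
    finally show "y t = \<xi> + (\<Sum>i\<in>UNIV. partition_integral (germ (f i) (\<lambda>\<tau>. W (graft i \<tau>))) 0 t)" .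
  qed (rule int_W)
  then interpret rde_solution \<alpha> T f y W \<xi> .
  let ?g1 = "\<lambda>i. rough_germ N X (\<lambda>r. lift_path (N - 1) (G1 i) (Y r)) i"
  let ?g2 = "\<lambda>i j. rough_germ N Xh (\<lambda>r. extend_path (lift_path (N - 1) (G2 i j) (Y r))) (br i j)"
  let ?P = "\<lambda>s t. \<exists>I1 I2 I3 I4.
    (\<forall>i. has_partition_integral (?g1 i) s t (I1 i)) \<and>
    (\<forall>i j. has_partition_integral (?g2 i j) s t (I2 i j)) \<and>
    (\<forall>i j k. has_partition_integral (young_germ (H3 i j k) (xt i j k)) s t (I3 i j k)) \<and>
    (\<forall>i j k. has_partition_integral (young_germ (H2 i j k) (xb i j k)) s t (I4 i j k)) \<and>
    F (y t) - F (y s) = (\<Sum>i\<in>UNIV. I1 i) + (\<Sum>i\<in>UNIV. \<Sum>j\<in>UNIV. I2 i j)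
      + (\<Sum>i\<in>UNIV. \<Sum>j\<in>UNIV. \<Sum>k\<in>UNIV. I3 i j k) + (\<Sum>i\<in>UNIV. \<Sum>j\<in>UNIV. \<Sum>k\<in>UNIV. I4 i j k)"
  have forward: "?P s t" if st: "0 \<le> s" "s \<le> t" "t \<le> T" for s t
  proof -
    have g1: "has_partition_integral (?g1 i) s t I \<longleftrightarrow>
        has_partition_integral (germ (\<lambda>u. higher_deriv F u [f i u]) (\<lambda>\<tau>. W (graft i \<tau>))) s t I" for i I
      using st germ_X by (intro has_partition_integral_cong) (auto simp: G1_def)
    have g2: "has_partition_integral (?g2 i j) s t I \<longleftrightarrow>
        has_partition_integral (germ (\<lambda>u. higher_deriv F u [f i u, f j u]) (Q i j)) s t I" for i j I
      using st germ_Xh by (intro has_partition_integral_cong) (auto simp: G2_def)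
    show ?thesis
      unfolding g1 g2 H3_def H2_def
    proof (rule ito_formula[OF \<open>smooth F\<close> int_Q _ _ _ _ _ st])
      fix u v i j k assume uv: "0 \<le> u" "u < v" "v \<le> T"
      then have mem: "u \<in> {0..T}" "v \<in> {0..T}" by auto
      show "Q i j [] u v = W (leaf j @ leaf i) u v - W (graft i (leaf j)) u v" by (rule Q_Nil[OF mem])
      show "xt i j k v - xt i j k u =
        W (leaf k @ leaf j @ leaf i) u v - W (graft i (leaf k @ leaf j)) u v - Q i j (leaf k) u v"
        \<comment> \<open>The forests must keep the form \<open>embed_forest\<close> of a small
          forest for \<open>Xh_embed\<close> to apply, so the rules that would unfold it are
          withheld.\<close>
        using assms(18)[OF mem] Xh_embed[OF _ mem]
        by (simp add: tilde_elem_def pairing_diff Q_def nodes_append del: embed_forest_simps append_Cons)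
      show "xb i j k v - xb i j k u =
        W (leaf i @ graft j (leaf k)) u v + W (graft j (leaf k) @ leaf i) u v
           - W (graft i (graft j (leaf k))) u v - W (graft j (leaf i @ leaf k)) u v
           - W (graft j (leaf k @ leaf i)) u v - Q i j (leaf k) u v - Q j i (leaf k) u v"
        using assms(19)[OF mem] Xh_embed[OF _ mem]
        by (simp add: bar_elem_def pairing_diff pairing_add Q_def nodes_append del: embed_forest_simps append_Cons)
    next
      fix i j k
      show "germ_order T (3 * \<alpha>) (Q i j (leaf k))"
        using bracket_order[OF \<open>bracket_homogeneous \<alpha> T Xh\<close>, of "leaf k" i j] by (simp add: N3 Q_def)
    next
      fix i j and \<tau> :: "'d forest" assume "nodes \<tau> = 2"
      then show "germ_order T (4 * \<alpha>) (Q i j \<tau>)"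
        using bracket_order[OF \<open>bracket_homogeneous \<alpha> T Xh\<close>, of \<tau> i j] by (simp add: N3 Q_def)
    qed
  qed
  have "?P s t"
  proof (cases "s \<le> t")
    case True
    then show ?thesis using forward[of s t] \<open>s \<in> {0..T}\<close> \<open>t \<in> {0..T}\<close> by simp
  next
    case False
    \<comment> \<open>For \<open>t < s\<close> the formula from \<open>t\<close> to \<open>s\<close>
      is negated term by term.\<close>
    then have ts: "t \<le> s" by simp
    obtain I1 I2 I3 I4 where I:
      "\<And>i. has_partition_integral (?g1 i) t s (I1 i)"
      "\<And>i j. has_partition_integral (?g2 i j) t s (I2 i j)"
      "\<And>i j k. has_partition_integral (young_germ (H3 i j k) (xt i j k)) t s (I3 i j k)"
      "\<And>i j k. has_partition_integral (young_germ (H2 i j k) (xb i j k)) t s (I4 i j k)"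
      and eq: "F (y s) - F (y t) = (\<Sum>i\<in>UNIV. I1 i) + (\<Sum>i\<in>UNIV. \<Sum>j\<in>UNIV. I2 i j)
      + (\<Sum>i\<in>UNIV. \<Sum>j\<in>UNIV. \<Sum>k\<in>UNIV. I3 i j k) + (\<Sum>i\<in>UNIV. \<Sum>j\<in>UNIV. \<Sum>k\<in>UNIV. I4 i j k)"
      using forward[of t s] ts \<open>s \<in> {0..T}\<close> \<open>t \<in> {0..T}\<close> by auto
    have eq': "F (y t) - F (y s) = (\<Sum>i\<in>UNIV. - I1 i) + (\<Sum>i\<in>UNIV. \<Sum>j\<in>UNIV. - I2 i j)
      + (\<Sum>i\<in>UNIV. \<Sum>j\<in>UNIV. \<Sum>k\<in>UNIV. - I3 i j k) + (\<Sum>i\<in>UNIV. \<Sum>j\<in>UNIV. \<Sum>k\<in>UNIV. - I4 i j k)"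
      using eq by (simp add: sum_negf algebra_simps)
    show ?thesis
      by (intro exI conjI allI) (rule I[THEN has_partition_integral_reverse[OF ts]] eq')+
  qed
  then obtain I1 I2 I3 I4 where I:
      "\<And>i. has_partition_integral (?g1 i) s t (I1 i)"
      "\<And>i j. has_partition_integral (?g2 i j) s t (I2 i j)"
      "\<And>i j k. has_partition_integral (young_germ (H3 i j k) (xt i j k)) s t (I3 i j k)"
      "\<And>i j k. has_partition_integral (young_germ (H2 i j k) (xb i j k)) s t (I4 i j k)"
      and eq: "F (y t) - F (y s) = (\<Sum>i\<in>UNIV. I1 i) + (\<Sum>i\<in>UNIV. \<Sum>j\<in>UNIV. I2 i j)
      + (\<Sum>i\<in>UNIV. \<Sum>j\<in>UNIV. \<Sum>k\<in>UNIV. I3 i j k) + (\<Sum>i\<in>UNIV. \<Sum>j\<in>UNIV. \<Sum>k\<in>UNIV. I4 i j k)"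
    by auto
  show ?thesis
    unfolding rough_integrable_def young_integrable_def rough_integral_eq young_integral_eq
      partition_integral_eq[OF I(1)] partition_integral_eq[OF I(2)]
      partition_integral_eq[OF I(3)] partition_integral_eq[OF I(4)]
    using I eq by blast
qed

end
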